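(* There exist two compact (smooth) Riemannian manifolds with boundary $(M_1,g_1)$ and $(M_2,g_2)$ and an isometry $\phi:\partial M_1\to\partial M_2$ between their boundaries (with the induced Riemannian metrics) such that, when the boundaries are identified via $\phi$, the two manifolds have identical lens data, but the $C^1$ jets of $g_1$ and $g_2$ at the boundary are different.
   Context: Lens data: let $(M,g)$ be a Riemannian manifold with boundary, $\nu$ the inward-pointing unit normal along $\partial M$, and $\partial(SM)$ the set of unit tangent vectors of $M$ with base point in $\partial M$. Let $\Omega\subset\partial(SM)\times\partial(SM)\times\mathbb{R}^+$ be the set of triples $(\gamma'(0),\gamma'(T),T)$ such that (1) $\gamma$ is a unit speed geodesic of $M$, (2) $\langle\gamma'(0),\nu\rangle>0$, i.e. $\gamma'(0)$ points inwards, and (3) $T$ is the first time at which $\gamma$ hits $\partial M$ again. Let $B(\partial M)\subset T(\partial M)$ be the open unit ball bundle and $\overline{B(\partial M)}$ the closed unit ball bundle of $\partial M$. Orthogonal projection $\partial(SM)\to\overline{B(\partial M)}$ (removing the normal component) maps $\Omega$ to a set $\Omega'\subset B(\partial M)\times\overline{B(\partial M)}\times\mathbb{R}^+$. The lens data of $(M,g)$ consist of $\Omega'$ together with the restriction of the distance function $\tau$ of $(M,g)$ to $\partial M\times\partial M$. Here $\tau(p,q)$ is the infimum of $g$-lengths of curves in $M$ from $p$ to $q$ (curves may run along $\partial M$). Boundary normal coordinates: given a coordinate chart $(x_1,\dots,x_{n-1})$ on $\partial M$ ($n=\dim M$), a point $p\in M$ close enough to $\partial M$ gets coordinates $(y_1,\dots,y_{n-1},y_n)$,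 where $(y_1,\dots,y_{n-1})$ are the coordinates of the unique boundary point closest to $p$ and $y_n$ is the distance from $p$ to it. $C^1$ jet at the boundary: the collection of $\partial_{x_n}^k g_{ij}|_{\partial M}$ for $k\in\{0,1\}$ and all $i,j$, in boundary normal coordinates. The $C^1$ jets of $g_1$ and $g_2$ are different if, for some chart of the (identified) boundary, some $k\in\{0,1\}$ and some $i,j$, the functions $\partial_{x_n}^k (g_1)_{ij}|_{\partial M}$ and $\partial_{x_n}^k (g_2)_{ij}|_{\partial M}$ in the corresponding boundary normal coordinates are not equal. *)

theory Defs
  imports "HOL-Analysis.Analysis"
begin

section \<open>Smooth functions on subsets of Euclidean space and of half-space\<close>

text \<open>Coordinate space of dimension \<open>n\<close> is the library's \<^term>\<open>Euclidean_space n\<close>, that is, the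
  functions \<open>nat \<Rightarrow> real\<close> that vanish from index \<open>n\<close> on. Indices start at \<open>0\<close>, so the last coordinate,
  which is the normal one at the boundary, has index \<open>n - 1\<close>.\<close>

definition half_space :: "nat \<Rightarrow> (nat \<Rightarrow> real) topology" where
  "half_space n = subtopology (Euclidean_space n) {x. 0 \<le> x (n - 1)}"

definition coord_slice :: "(nat \<Rightarrow> real) set \<Rightarrow> nat \<Rightarrow> (nat \<Rightarrow> real) \<Rightarrow> real set" where
  "coord_slice S i x = {t. x(i := t) \<in> S}"

text \<open>Partial derivatives relative to \<open>S\<close>. They are only used for \<open>S\<close> open in Euclidean space or in the
  half-space; at boundary points of the half-space the normal derivative is thus one-sided.\<close>

definition partial_in ::
  "(nat \<Rightarrow> real) set \<Rightarrow> nat \<Rightarrow> ((nat \<Rightarrow> real) \<Rightarrow> real) \<Rightarrow> (nat \<Rightarrow> real) \<Rightarrow> real" where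
  "partial_in S i f x = vector_derivative (\<lambda>t. f (x(i := t))) (at (x i) within coord_slice S i x)"

primrec Ck_on ::
  "nat \<Rightarrow> nat \<Rightarrow> (nat \<Rightarrow> real) set \<Rightarrow> ((nat \<Rightarrow> real) \<Rightarrow> real) \<Rightarrow> bool" where
  "Ck_on 0 n S f \<longleftrightarrow> continuous_on S f"
| "Ck_on (Suc k) n S f \<longleftrightarrow> continuous_on S f \<and>
     (\<forall>i<n. (\<forall>x\<in>S. (\<lambda>t. f (x(i := t))) differentiable (at (x i) within coord_slice S i x)) \<and>
            Ck_on k n S (partial_in S i f))"

definition smooth_on_coords :: "nat \<Rightarrow> (nat \<Rightarrow> real) set \<Rightarrow> ((nat \<Rightarrow> real) \<Rightarrow> real) \<Rightarrow> bool" where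
  "smooth_on_coords n S f \<longleftrightarrow> (\<forall>k. Ck_on k n S f)"


section \<open>Smooth manifolds with boundary\<close>

text \<open>The topology is part of the structure and need not be related to a topology of the point type
  \<open>'a\<close>. Every second countable Hausdorff manifold has at most continuum many points, so
  \<open>nat \<Rightarrow> real\<close> is large enough as a point type for all of them, in every dimension.\<close>

type_synonym 'a chart = "'a set \<times> ('a \<Rightarrow> nat \<Rightarrow> real)"

record 'a mfd =
  mtop :: "'a topology"
  mdim :: nat
  matlas :: "'a chart set"

abbreviation pts :: "'a mfd \<Rightarrow> 'a set" where
  "pts M \<equiv> topspace (mtop M)"

definition chart_image :: "'a chart \<Rightarrow> (nat \<Rightarrow> real) set" where
  "chart_image c = snd c ` fst c"

definition chart_inv :: "'a chart \<Rightarrow> (nat \<Rightarrow> real) \<Rightarrow> 'a" where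
  "chart_inv c = inv_into (fst c) (snd c)"

text \<open>Both interior charts (onto open subsets of Euclidean space) and boundary charts (onto open
  subsets of the half-space) are allowed.\<close>

definition is_chart :: "'a mfd \<Rightarrow> 'a chart \<Rightarrow> bool" where
  "is_chart M c \<longleftrightarrow>
     openin (mtop M) (fst c) \<and>
     (openin (Euclidean_space (mdim M)) (chart_image c) \<or> openin (half_space (mdim M)) (chart_image c)) \<and>
     homeomorphic_map (subtopology (mtop M) (fst c))
       (subtopology (Euclidean_space (mdim M)) (chart_image c)) (snd c)"

definition smooth_transition :: "nat \<Rightarrow> 'a chart \<Rightarrow> 'a chart \<Rightarrow> bool" where
  "smooth_transition n c d \<longleftrightarrow>
     (\<forall>i<n. smooth_on_coords n (snd c ` (fst c \<inter> fst d)) (\<lambda>x. snd d (chart_inv c x) i))"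

text \<open>The charts of the smooth structure generated by the atlas.\<close>

definition smooth_chart :: "'a mfd \<Rightarrow> 'a chart \<Rightarrow> bool" where
  "smooth_chart M c \<longleftrightarrow> is_chart M c \<and>
     (\<forall>d\<in>matlas M. smooth_transition (mdim M) c d \<and> smooth_transition (mdim M) d c)"

definition smooth_manifold :: "'a mfd \<Rightarrow> bool" where
  "smooth_manifold M \<longleftrightarrow>
     Hausdorff_space (mtop M) \<and> second_countable (mtop M) \<and>
     (\<forall>c\<in>matlas M. smooth_chart M c) \<and> (\<Union>c\<in>matlas M. fst c) = pts M"

definition boundary_chart_at :: "'a mfd \<Rightarrow> 'a chart \<Rightarrow> 'a \<Rightarrow> bool" where
  "boundary_chart_at M c p \<longleftrightarrow>
     0 < mdim M \<and> c \<in> matlas M \<and> p \<in> fst c \<and>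
     openin (half_space (mdim M)) (chart_image c) \<and> snd c p (mdim M - 1) = 0"

definition boundary_pts :: "'a mfd \<Rightarrow> 'a set" where
  "boundary_pts M = {p. \<exists>c. boundary_chart_at M c p}"

text \<open>The boundary as a manifold of dimension one less. On the boundary the last coordinate of a
  chart is \<open>0\<close>, so the restricted chart already takes values in \<open>Euclidean_space (n - 1)\<close>.\<close>

definition boundary :: "'a mfd \<Rightarrow> 'a mfd" where
  "boundary M = \<lparr> mtop = subtopology (mtop M) (boundary_pts M),
                  mdim = mdim M - 1,
                  matlas = (\<lambda>c. (fst c \<inter> boundary_pts M, snd c)) ` matlas M \<rparr>"

definition smooth_map :: "'a mfd \<Rightarrow> 'b mfd \<Rightarrow> ('a \<Rightarrow> 'b) \<Rightarrow> bool" where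
  "smooth_map M N F \<longleftrightarrow> continuous_map (mtop M) (mtop N) F \<and>
     (\<forall>c\<in>matlas M. \<forall>d\<in>matlas N. \<forall>i<mdim N.
        smooth_on_coords (mdim M) (snd c ` (fst c \<inter> F -` fst d)) (\<lambda>x. snd d (F (chart_inv c x)) i))"


section \<open>Tangent vectors\<close>

text \<open>A tangent vector at \<open>p\<close> is a point derivation, acting on the real functions that are smooth near
  \<open>p\<close> and set to \<open>0\<close> on all other functions. The tangent space is the span of the coordinate
  derivations; it includes the outward directions at boundary points. Since the zero vectors at
  different points are the same functional, elements of tangent bundles are pairs \<open>(p, v)\<close>.\<close>

type_synonym 'a tvec = "('a \<Rightarrow> real) \<Rightarrow> real"

definition smooth_near :: "'a mfd \<Rightarrow> 'a \<Rightarrow> ('a \<Rightarrow> real) set" where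
  "smooth_near M p = {f. \<exists>U. openin (mtop M) U \<and> p \<in> U \<and>
     (\<forall>c\<in>matlas M. smooth_on_coords (mdim M) (snd c ` (U \<inter> fst c)) (\<lambda>x. f (chart_inv c x)))}"

definition coord_vec :: "'a mfd \<Rightarrow> 'a chart \<Rightarrow> nat \<Rightarrow> 'a \<Rightarrow> 'a tvec" where
  "coord_vec M c i p = (\<lambda>f. if f \<in> smooth_near M p
     then partial_in (chart_image c) i (\<lambda>x. f (chart_inv c x)) (snd c p) else 0)"

definition tangent_space :: "'a mfd \<Rightarrow> 'a \<Rightarrow> 'a tvec set" where
  "tangent_space M p = {v. \<exists>c\<in>matlas M. p \<in> fst c \<and>
     (\<exists>a. v = (\<lambda>f. \<Sum>i<mdim M. a i * coord_vec M c i p f))}"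

text \<open>Image of a tangent vector under the differential of \<open>F\<close>, a map into \<open>N\<close> sending the base point
  to \<open>q\<close>. For \<open>F = id\<close> and \<open>N = M\<close> this is the inclusion of a tangent space of \<open>boundary M\<close> into the
  corresponding tangent space of \<open>M\<close>.\<close>

definition push :: "'b mfd \<Rightarrow> 'b \<Rightarrow> ('a \<Rightarrow> 'b) \<Rightarrow> 'a tvec \<Rightarrow> 'b tvec" where
  "push N q F v = (\<lambda>f. if f \<in> smooth_near N q then v (\<lambda>x. f (F x)) else 0)"

definition velocity :: "'a mfd \<Rightarrow> real set \<Rightarrow> (real \<Rightarrow> 'a) \<Rightarrow> real \<Rightarrow> 'a tvec" where
  "velocity M J \<gamma> t = (\<lambda>f. if f \<in> smooth_near M (\<gamma> t)
     then vector_derivative (\<lambda>s. f (\<gamma> s)) (at t within J) else 0)"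


section \<open>Riemannian metrics\<close>

type_synonym 'a metric = "'a \<Rightarrow> 'a tvec \<Rightarrow> 'a tvec \<Rightarrow> real"

definition metric_coeff :: "'a mfd \<Rightarrow> 'a metric \<Rightarrow> 'a chart \<Rightarrow> nat \<Rightarrow> nat \<Rightarrow> (nat \<Rightarrow> real) \<Rightarrow> real" where
  "metric_coeff M g c i j x =
     (let p = chart_inv c x in g p (coord_vec M c i p) (coord_vec M c j p))"

definition riemannian_metric :: "'a mfd \<Rightarrow> 'a metric \<Rightarrow> bool" where
  "riemannian_metric M g \<longleftrightarrow>
     (\<forall>p\<in>pts M.
        (\<forall>u\<in>tangent_space M p. \<forall>v\<in>tangent_space M p. \<forall>w\<in>tangent_space M p. \<forall>a b.
           g p (\<lambda>f. a * u f + b * v f) w = a * g p u w + b * g p v w) \<and>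
        (\<forall>v\<in>tangent_space M p. \<forall>w\<in>tangent_space M p. g p v w = g p w v) \<and>
        (\<forall>v\<in>tangent_space M p. v \<noteq> (\<lambda>f. 0) \<longrightarrow> 0 < g p v v)) \<and>
     (\<forall>c\<in>matlas M. \<forall>i<mdim M. \<forall>j<mdim M.
        smooth_on_coords (mdim M) (chart_image c) (metric_coeff M g c i j))"

definition riemannian_manifold :: "'a mfd \<Rightarrow> 'a metric \<Rightarrow> bool" where
  "riemannian_manifold M g \<longleftrightarrow> smooth_manifold M \<and> riemannian_metric M g"

definition boundary_metric :: "'a mfd \<Rightarrow> 'a metric \<Rightarrow> 'a metric" where
  "boundary_metric M g = (\<lambda>p v w. g p (push M p id v) (push M p id w))"

definition isometry :: "'a mfd \<Rightarrow> 'a metric \<Rightarrow> 'b mfd \<Rightarrow> 'b metric \<Rightarrow> ('a \<Rightarrow> 'b) \<Rightarrow> bool" where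
  "isometry M g N h F \<longleftrightarrow>
     bij_betw F (pts M) (pts N) \<and> smooth_map M N F \<and> smooth_map N M (inv_into (pts M) F) \<and>
     (\<forall>p\<in>pts M. \<forall>v\<in>tangent_space M p. \<forall>w\<in>tangent_space M p.
        h (F p) (push N (F p) F v) (push N (F p) F w) = g p v w)"


section \<open>Geodesics and distance\<close>

text \<open>Christoffel symbols of the first kind,
  \<open>1/2 (\<partial>\<^sub>i g\<^sub>j\<^sub>l + \<partial>\<^sub>j g\<^sub>i\<^sub>l - \<partial>\<^sub>l g\<^sub>i\<^sub>j)\<close>.\<close>

definition christoffel :: "'a mfd \<Rightarrow> 'a metric \<Rightarrow> 'a chart \<Rightarrow> nat \<Rightarrow> nat \<Rightarrow> nat \<Rightarrow> (nat \<Rightarrow> real) \<Rightarrow> real" where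
  "christoffel M g c l i j x =
     (partial_in (chart_image c) i (metric_coeff M g c j l) x +
      partial_in (chart_image c) j (metric_coeff M g c i l) x -
      partial_in (chart_image c) l (metric_coeff M g c i j) x) / 2"

definition coord_deriv :: "'a chart \<Rightarrow> real set \<Rightarrow> (real \<Rightarrow> 'a) \<Rightarrow> nat \<Rightarrow> real \<Rightarrow> real" where
  "coord_deriv c J \<gamma> k t = vector_derivative (\<lambda>s. snd c (\<gamma> s) k) (at t within J)"

definition coord_deriv2 :: "'a chart \<Rightarrow> real set \<Rightarrow> (real \<Rightarrow> 'a) \<Rightarrow> nat \<Rightarrow> real \<Rightarrow> real" where
  "coord_deriv2 c J \<gamma> k t = vector_derivative (coord_deriv c J \<gamma> k) (at t within J)"

text \<open>The geodesic equation in every chart, with the free index lowered (that is, the usual equation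
  \<open>\<gamma>''\<^sup>k + \<Gamma>\<^sup>k\<^sub>i\<^sub>j \<gamma>'\<^sup>i \<gamma>'\<^sup>j = 0\<close> multiplied by the invertible matrix
  \<open>g\<^sub>l\<^sub>k\<close>). Derivatives at the endpoints of \<open>J\<close> are one-sided. A geodesic may touch the boundary, but it
  satisfies the equation there, too.\<close>

definition geodesic :: "'a mfd \<Rightarrow> 'a metric \<Rightarrow> real set \<Rightarrow> (real \<Rightarrow> 'a) \<Rightarrow> bool" where
  "geodesic M g J \<gamma> \<longleftrightarrow>
     continuous_map (top_of_set J) (mtop M) \<gamma> \<and>
     (\<forall>c\<in>matlas M. \<forall>t\<in>J. \<gamma> t \<in> fst c \<longrightarrow>
        (\<forall>k<mdim M. (\<lambda>s. snd c (\<gamma> s) k) differentiable (at t within J) \<and>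
                    coord_deriv c J \<gamma> k differentiable (at t within J)) \<and>
        (\<forall>l<mdim M.
           (\<Sum>k<mdim M. metric_coeff M g c l k (snd c (\<gamma> t)) * coord_deriv2 c J \<gamma> k t) +
           (\<Sum>i<mdim M. \<Sum>j<mdim M. christoffel M g c l i j (snd c (\<gamma> t)) *
              coord_deriv c J \<gamma> i t * coord_deriv c J \<gamma> j t) = 0))"

definition unit_speed_geodesic :: "'a mfd \<Rightarrow> 'a metric \<Rightarrow> real set \<Rightarrow> (real \<Rightarrow> 'a) \<Rightarrow> bool" where
  "unit_speed_geodesic M g J \<gamma> \<longleftrightarrow> geodesic M g J \<gamma> \<and>
     (\<forall>t\<in>J. g (\<gamma> t) (velocity M J \<gamma> t) (velocity M J \<gamma> t) = 1)"

definition C1_curve :: "'a mfd \<Rightarrow> real set \<Rightarrow> (real \<Rightarrow> 'a) \<Rightarrow> bool" where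
  "C1_curve M J \<gamma> \<longleftrightarrow>
     continuous_map (top_of_set J) (mtop M) \<gamma> \<and>
     (\<forall>c\<in>matlas M. \<forall>t\<in>J. \<gamma> t \<in> fst c \<longrightarrow>
        (\<forall>k<mdim M. (\<lambda>s. snd c (\<gamma> s) k) differentiable (at t within J) \<and>
                    continuous (at t within J) (coord_deriv c J \<gamma> k)))"

definition piecewise_C1_curve :: "'a mfd \<Rightarrow> (real \<Rightarrow> 'a) \<Rightarrow> bool" where
  "piecewise_C1_curve M \<gamma> \<longleftrightarrow>
     continuous_map (top_of_set {0..1}) (mtop M) \<gamma> \<and>
     (\<exists>(N::nat) b. b 0 = 0 \<and> b N = 1 \<and>
        (\<forall>i<N. b i < b (Suc i) \<and> C1_curve M {b i..b (Suc i)} \<gamma>))"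

definition curve_length :: "'a mfd \<Rightarrow> 'a metric \<Rightarrow> (real \<Rightarrow> 'a) \<Rightarrow> real" where
  "curve_length M g \<gamma> = integral {0..1}
     (\<lambda>t. sqrt (g (\<gamma> t) (velocity M {0..1} \<gamma> t) (velocity M {0..1} \<gamma> t)))"

text \<open>The value is \<open>\<infinity>\<close> for points in different components.\<close>

definition riem_dist :: "'a mfd \<Rightarrow> 'a metric \<Rightarrow> 'a \<Rightarrow> 'a \<Rightarrow> ennreal" where
  "riem_dist M g p q =
     (INF \<gamma> \<in> {\<gamma>. piecewise_C1_curve M \<gamma> \<and> \<gamma> 0 = p \<and> \<gamma> 1 = q}. ennreal (curve_length M g \<gamma>))"


section \<open>Lens data\<close>

definition inward_normal :: "'a mfd \<Rightarrow> 'a metric \<Rightarrow> 'a \<Rightarrow> 'a tvec" where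
  "inward_normal M g p = (THE v. v \<in> tangent_space M p \<and> g p v v = 1 \<and>
     (\<forall>w\<in>tangent_space (boundary M) p. g p v (push M p id w) = 0) \<and>
     (\<exists>c. boundary_chart_at M c p \<and> 0 < v (\<lambda>q. snd c q (mdim M - 1))))"

text \<open>The set \<open>\<Omega>\<close>. Only the part of the geodesic between the times \<open>0\<close> and \<open>T\<close> matters.\<close>

definition lens_set :: "'a mfd \<Rightarrow> 'a metric \<Rightarrow> (('a \<times> 'a tvec) \<times> ('a \<times> 'a tvec) \<times> real) set" where
  "lens_set M g = {((\<gamma> 0, velocity M {0..T} \<gamma> 0), (\<gamma> T, velocity M {0..T} \<gamma> T), T) | \<gamma> T.
     0 < T \<and> unit_speed_geodesic M g {0..T} \<gamma> \<and>
     \<gamma> 0 \<in> boundary_pts M \<and> 0 < g (\<gamma> 0) (velocity M {0..T} \<gamma> 0) (inward_normal M g (\<gamma> 0)) \<and>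
     \<gamma> T \<in> boundary_pts M \<and> (\<forall>t\<in>{0<..<T}. \<gamma> t \<notin> boundary_pts M)}"

text \<open>Removal of the normal component; the result is the unique vector tangent to the boundary whose
  image in the tangent space of \<open>M\<close> is the tangential component.\<close>

definition tangential_part :: "'a mfd \<Rightarrow> 'a metric \<Rightarrow> 'a \<times> 'a tvec \<Rightarrow> 'a \<times> 'a tvec" where
  "tangential_part M g = (\<lambda>(p, v). (p, THE w. w \<in> tangent_space (boundary M) p \<and>
     push M p id w = (\<lambda>f. v f - g p v (inward_normal M g p) * inward_normal M g p f)))"

definition projected_lens_set ::
  "'a mfd \<Rightarrow> 'a metric \<Rightarrow> (('a \<times> 'a tvec) \<times> ('a \<times> 'a tvec) \<times> real) set" where
  "projected_lens_set M g =
     (\<lambda>(X, Y, T). (tangential_part M g X, tangential_part M g Y, T)) ` lens_set M g"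

text \<open>Equality of the lens data (\<open>\<Omega>'\<close> and the boundary distance function) after identifying the
  boundaries via \<open>\<phi>\<close> and their tangent bundles via the differential of \<open>\<phi>\<close>.\<close>

definition same_lens_data ::
  "'a mfd \<Rightarrow> 'a metric \<Rightarrow> 'b mfd \<Rightarrow> 'b metric \<Rightarrow> ('a \<Rightarrow> 'b) \<Rightarrow> bool" where
  "same_lens_data M1 g1 M2 g2 \<phi> \<longleftrightarrow>
     (let d\<phi> = (\<lambda>(p, v). (\<phi> p, push (boundary M2) (\<phi> p) \<phi> v))
      in projected_lens_set M2 g2 = (\<lambda>(X, Y, T). (d\<phi> X, d\<phi> Y, T)) ` projected_lens_set M1 g1) \<and>
     (\<forall>p\<in>boundary_pts M1. \<forall>q\<in>boundary_pts M1. riem_dist M2 g2 (\<phi> p) (\<phi> q) = riem_dist M1 g1 p q)"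


section \<open>Boundary normal coordinates and jets at the boundary\<close>

definition closest_boundary_pt :: "'a mfd \<Rightarrow> 'a metric \<Rightarrow> 'a \<Rightarrow> 'a \<Rightarrow> bool" where
  "closest_boundary_pt M g p q \<longleftrightarrow> q \<in> boundary_pts M \<and> riem_dist M g p q < \<infinity> \<and>
     (\<forall>q'\<in>boundary_pts M. riem_dist M g p q \<le> riem_dist M g p q')"

text \<open>\<open>d\<close> is the boundary normal coordinate system of \<open>M\<close> given by the boundary chart \<open>b\<close>, on some open
  set \<open>fst d\<close> of points that are close enough to the boundary.\<close>

definition boundary_normal_chart :: "'a mfd \<Rightarrow> 'a metric \<Rightarrow> 'a chart \<Rightarrow> 'a chart \<Rightarrow> bool" where
  "boundary_normal_chart M g b d \<longleftrightarrow> smooth_chart M d \<and>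
     (\<forall>p\<in>fst d. \<exists>q\<in>fst b. closest_boundary_pt M g p q \<and>
        (\<forall>q'. closest_boundary_pt M g p q' \<longrightarrow> q' = q) \<and>
        snd d p = (snd b q)(mdim M - 1 := enn2real (riem_dist M g p q)))"

text \<open>The derivative \<open>\<partial>\<^sub>n\<^sup>k g\<^sub>i\<^sub>j\<close> at the boundary point \<open>q\<close>, in the coordinates \<open>d\<close>.\<close>

definition boundary_jet :: "'a mfd \<Rightarrow> 'a metric \<Rightarrow> 'a chart \<Rightarrow> nat \<Rightarrow> nat \<Rightarrow> nat \<Rightarrow> 'a \<Rightarrow> real" where
  "boundary_jet M g d k i j q =
     ((partial_in (chart_image d) (mdim M - 1) ^^ k) (metric_coeff M g d i j)) (snd d q)"

text \<open>Two functions on the domain of a boundary chart \<open>b\<close> differ iff they differ at some \<open>q\<close>, and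
  boundary normal coordinates are only needed near \<open>q\<close>. The chart \<open>b\<close> is transported to the second
  boundary by \<open>\<phi>\<close>.\<close>

definition C1_jets_differ ::
  "'a mfd \<Rightarrow> 'a metric \<Rightarrow> 'b mfd \<Rightarrow> 'b metric \<Rightarrow> ('a \<Rightarrow> 'b) \<Rightarrow> bool" where
  "C1_jets_differ M1 g1 M2 g2 \<phi> \<longleftrightarrow>
     (\<exists>b d1 d2 q. \<exists>k\<in>{0, 1}. \<exists>i<mdim M1. \<exists>j<mdim M1.
        smooth_chart (boundary M1) b \<and>
        boundary_normal_chart M1 g1 b d1 \<and>
        boundary_normal_chart M2 g2 (\<phi> ` fst b, snd b \<circ> inv_into (boundary_pts M1) \<phi>) d2 \<and>
        q \<in> fst b \<and> q \<in> fst d1 \<and> \<phi> q \<in> fst d2 \<and>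
        boundary_jet M1 g1 d1 k i j q \<noteq> boundary_jet M2 g2 d2 k i j (\<phi> q))"

end

(*
  Both manifolds are the cylinder S^1 x [0,1], with the rotationally symmetric metrics
  dr^2 + G(r) dtheta^2 for G(r) = 1 + r - r^3 and for its mirror image H(r) = G(1 - r). As
  G(0) = G(1) = 1, they induce the same metric on the boundary, but G'(0) = 1 and H'(0) = 2, and
  (theta, r) are boundary normal coordinates.

  By Clairaut's relation the angular momentum G(r) theta' is constant along a geodesic. As G >= 1,
  with equality at the ends, r' never vanishes on a geodesic that enters the cylinder, so that it
  leaves at the opposite end and with the angular velocity of its start. Reversing its time and
  applying a reflection of the circle together with r -> 1 - r turns it into a geodesic of the other
  metric with the same start, end, tangential components and length. The same operation transfers curves between
  different ends and thus the distances of their end points. For points at the same end, projecting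
  curves to this end does not increase their length.
*)
theory Submission
  imports Defs
begin

section \<open>Smooth functions in coordinates\<close>

text \<open>Unit speed turns Clairaut's relation G theta' = L into r'^2 = 1 - L^2/G, and L^2 < 1 for
  a geodesic that enters transversally at an end, where G = 1; this uses that G is smallest at the
  ends. Time reversal negates both velocities, the reflection of the circle restores the angular one
  and r -> 1 - r the vertical one. Exactly one reflection exchanges the two end points, so it is
  chosen anew for each geodesic or curve. The projected lens data retain only the angular velocities
  at the ends, and both equal L. The definitions quantify over charts and smooth test functions,
  while the argument speaks of theta' and r' only. The cylinder is therefore embedded in
  three-dimensional space: ambient coordinates are global, a curve is described there by its two
  velocities, and charts serve to translate the notions of smooth curve, geodesic and tangent vector
  into this description. The embedding also yields the distance to the boundary: as G >= 1, no curve
  is shorter than the Euclidean chord between its end points, and vertical segments attain this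
  bound.\<close>

lemma Euclidean_space_top_of_set: "Euclidean_space n = top_of_set {x. \<forall>i\<ge>n. x i = 0}"
  by (simp add: Euclidean_space_def euclidean_product_topology)

lemma half_space_top_of_set:
  "half_space n = top_of_set {x. (\<forall>i\<ge>n. x i = 0) \<and> 0 \<le> x (n - 1)}"
  by (simp add: half_space_def Euclidean_space_top_of_set subtopology_subtopology Collect_conj_eq)

lemma continuous_fun_upd: "continuous_on UNIV (\<lambda>t. x(i := t) :: nat \<Rightarrow> real)"
proof (rule continuous_on_coordinatewise_then_product)
  show "continuous_on UNIV (\<lambda>t. (x(i := t)) j)" for j
    by (cases "j = i") auto
qed

text \<open>Partial derivatives are only meaningful where no point is isolated in its coordinate slices.
  In open sets of Euclidean space and of the half-space each slice contains a small interval to the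
  right of the base point.\<close>

definition thick :: "nat \<Rightarrow> (nat \<Rightarrow> real) set \<Rightarrow> bool" where
  "thick n S \<longleftrightarrow> (\<forall>x\<in>S. \<forall>i<n. \<exists>e>0. \<forall>t. x i \<le> t \<and> t < x i + e \<longrightarrow> x(i := t) \<in> S)"

text \<open>\<open>H\<close> stands for Euclidean space or the half-space, and both are closed under
  increasing one of the first \<open>n\<close> coordinates. At the boundary of the half-space the
  normal coordinate can move in no other direction, hence the one-sided interval in
  \<open>thick\<close>.\<close>

lemma thickI_open:
  assumes "open T" "S = T \<inter> H"
    "\<And>x i t. x \<in> H \<Longrightarrow> i < n \<Longrightarrow> x i \<le> t \<Longrightarrow> x(i := t) \<in> H"
  shows "thick n S"
  unfolding thick_def
proof (intro ballI allI impI)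
  fix x i assume x: "x \<in> S" and i: "i < n"
  have "open ((\<lambda>t. x(i := t)) -` T)"
    using continuous_fun_upd assms(1) by (metis continuous_on_open_vimage open_UNIV inf_top_right)
  moreover have "x i \<in> (\<lambda>t. x(i := t)) -` T" using x assms(2) by simp
  ultimately obtain e where e: "e > 0" "\<And>t. dist t (x i) < e \<Longrightarrow> x(i := t) \<in> T"
    by (auto simp: open_dist)
  show "\<exists>e>0. \<forall>t. x i \<le> t \<and> t < x i + e \<longrightarrow> x(i := t) \<in> S"
    using e x assms(2,3) i by (intro exI[of _ e]) (auto simp: dist_real_def)
qed

lemma thick_Euclidean: "openin (Euclidean_space n) S \<Longrightarrow> thick n S"
  unfolding Euclidean_space_top_of_set openin_open
  by (auto intro!: thickI_open[where H = "{x. \<forall>i\<ge>n. x i = 0}"])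

lemma thick_half_space: "openin (half_space n) S \<Longrightarrow> thick n S"
  unfolding half_space_top_of_set openin_open
  by (auto intro!: thickI_open[where H = "{x. (\<forall>i\<ge>n. x i = 0) \<and> 0 \<le> x (n - 1)}"])

text \<open>Nontriviality of this filter makes derivatives within a slice unique. At an isolated
  point every number would be a derivative, and \<open>partial_in\<close> an arbitrary
  choice.\<close>

lemma thick_nontrivial:
  assumes "thick n S" "x \<in> S" "i < n"
  shows "at (x i) within coord_slice S i x \<noteq> bot"
proof -
  obtain e where e: "e > 0" "\<And>t. x i \<le> t \<Longrightarrow> t < x i + e \<Longrightarrow> x(i := t) \<in> S"
    using assms unfolding thick_def by blast
  have "at (x i) within {x i..<x i + e} \<noteq> bot"
    using e(1) by (auto simp: trivial_limit_within islimpt_Ico)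
  moreover have "{x i..<x i + e} \<subseteq> coord_slice S i x"
    using e by (auto simp: coord_slice_def)
  ultimately show ?thesis
    by (metis at_le bot.extremum_uniqueI)
qed

lemma partial_in_eqI:
  assumes "thick n S" "x \<in> S" "i < n"
    "((\<lambda>t. f (x(i := t))) has_vector_derivative d) (at (x i) within coord_slice S i x)"
  shows "partial_in S i f x = d"
  unfolding partial_in_def
  using vector_derivative_within[OF thick_nontrivial[OF assms(1-3)] assms(4)] .

lemma has_vector_derivative_cong_within:
  assumes "\<And>t. t \<in> A \<Longrightarrow> f t = g t" "a \<in> A"
  shows "(f has_vector_derivative d) (at a within A) \<longleftrightarrow> (g has_vector_derivative d) (at a within A)"
  using assms has_vector_derivative_transform[of a A g f d] has_vector_derivative_transform[of a A f g d]
  by auto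

lemma vector_derivative_cong_within:
  assumes "\<And>t. t \<in> A \<Longrightarrow> f t = g t" "a \<in> A"
  shows "vector_derivative f (at a within A) = vector_derivative g (at a within A)"
  unfolding vector_derivative_def using has_vector_derivative_cong_within[OF assms] by simp

lemma differentiable_cong_within:
  assumes "\<And>t. t \<in> A \<Longrightarrow> f t = g t" "a \<in> A"
  shows "f differentiable (at a within A) \<longleftrightarrow> g differentiable (at a within A)"
  using assms by (metis differentiable_transform_within zero_less_one)

lemma partial_in_cong:
  assumes "\<And>y. y \<in> S \<Longrightarrow> f y = g y" "x \<in> S"
  shows "partial_in S i f x = partial_in S i g x"
  unfolding partial_in_def
  by (rule vector_derivative_cong_within) (use assms in \<open>auto simp: coord_slice_def\<close>)

lemma Ck_on_cong:
  assumes "\<And>x. x \<in> S \<Longrightarrow> f x = g x"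
  shows "Ck_on k n S f \<longleftrightarrow> Ck_on k n S g"
  using assms
proof (induction k arbitrary: f g)
  case 0
  then show ?case by (simp cong: continuous_on_cong)
next
  case (Suc k)
  have "Ck_on k n S (partial_in S i f) = Ck_on k n S (partial_in S i g)" for i
    by (rule Suc.IH) (rule partial_in_cong[OF Suc.prems])
  moreover have "(\<lambda>t. f (x(i := t))) differentiable (at (x i) within coord_slice S i x) \<longleftrightarrow>
     (\<lambda>t. g (x(i := t))) differentiable (at (x i) within coord_slice S i x)" if "x \<in> S" for x i
    by (rule differentiable_cong_within) (use Suc.prems that in \<open>auto simp: coord_slice_def\<close>)
  moreover have "continuous_on S f = continuous_on S g"
    using Suc.prems by (simp cong: continuous_on_cong)
  ultimately show ?case by auto
qed

lemma smooth_on_coords_cong: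
  "(\<And>x. x \<in> S \<Longrightarrow> f x = g x) \<Longrightarrow> smooth_on_coords n S f \<longleftrightarrow> smooth_on_coords n S g"
  unfolding smooth_on_coords_def using Ck_on_cong by metis

lemma Ck_on_const: "thick n S \<Longrightarrow> Ck_on k n S (\<lambda>x. c)"
proof (induction k arbitrary: c)
  case (Suc k)
  have "Ck_on k n S (partial_in S i (\<lambda>x. c))" if "i < n" for i
    using Suc.IH[OF Suc.prems, of 0] that Suc.prems
    by (subst Ck_on_cong[where g = "\<lambda>x. 0"]) (auto intro!: partial_in_eqI)
  then show ?case by simp
qed simp

text \<open>The sequence \<open>D\<close> lists all derivatives in closed form. The transitions,
  metric coefficients and explicit test functions of the proof all turn out to be functions of a
  single coordinate, so such sequences take the place of closure properties of \<open>Ck_on\<close>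
  under products and composition.\<close>

definition smooth_real :: "real set \<Rightarrow> (real \<Rightarrow> real) \<Rightarrow> bool" where
  "smooth_real T h \<longleftrightarrow>
     (\<exists>D. D 0 = h \<and> (\<forall>m. \<forall>t\<in>T. (D m has_real_derivative D (Suc m) t) (at t)))"

text \<open>The induction on \<open>k\<close> treats all \<open>m\<close> at once: the partial
  derivative in direction \<open>j\<close> raises \<open>m\<close> by one, and those in the other
  directions vanish.\<close>

lemma Ck_on_coordinate:
  assumes "thick n S" "\<And>x. x \<in> S \<Longrightarrow> x j \<in> T"
    "\<And>m t. t \<in> T \<Longrightarrow> (D m has_real_derivative D (Suc m) t) (at t)"
  shows "Ck_on k n S (\<lambda>x. D m (x j))"
proof -
  have cont: "continuous_on S (\<lambda>x. D m (x j))" for m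
  proof (rule continuous_on_compose2[of T "D m" S "\<lambda>x. x j"])
    show "continuous_on T (D m)"
      using assms(3) DERIV_isCont continuous_at_imp_continuous_on by blast
    show "continuous_on S (\<lambda>x. x j)"
      by (rule continuous_on_subset[OF continuous_on_product_coordinates]) simp
  qed (use assms(2) in auto)
  show ?thesis
  proof (induction k arbitrary: m)
    case 0
    then show ?case using cont by simp
  next
    case (Suc k)
    have d: "((\<lambda>t. D m ((x(i := t)) j)) has_vector_derivative (if i = j then D (Suc m) (x j) else 0))
        (at (x i) within coord_slice S i x)" if "x \<in> S" for i x
      using assms(2,3) that
      by (auto simp: has_real_derivative_iff_has_vector_derivative[symmetric]
          intro: has_field_derivative_at_within)
    have "partial_in S i (\<lambda>x. D m (x j)) x = (if i = j then D (Suc m) (x j) else 0)"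
      if "x \<in> S" "i < n" for x i
      by (rule partial_in_eqI[OF assms(1) that d[OF that(1)]])
    then have "Ck_on k n S (partial_in S i (\<lambda>x. D m (x j)))" if "i < n" for i
      using Ck_on_const[OF assms(1)] Suc that
      by (subst Ck_on_cong[where g = "\<lambda>x. if i = j then D (Suc m) (x j) else 0"]) (cases "i = j"; simp)+
    moreover have "(\<lambda>t. D m ((x(i := t)) j)) differentiable (at (x i) within coord_slice S i x)"
      if "x \<in> S" for x i
      using d[OF that] differentiableI_vector by blast
    ultimately show ?case using cont by auto
  qed
qed

lemma smooth_on_coords_coordinate:
  assumes "thick n S" "\<And>x. x \<in> S \<Longrightarrow> x j \<in> T" "smooth_real T h"
  shows "smooth_on_coords n S (\<lambda>x. h (x j))"
proof -
  obtain D where "D 0 = h" and D: "\<And>m t. t \<in> T \<Longrightarrow> (D m has_real_derivative D (Suc m) t) (at t)"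
    using assms(3) unfolding smooth_real_def by blast
  then show ?thesis
    using Ck_on_coordinate[of n S j T D _ 0] assms(1,2) by (simp add: smooth_on_coords_def)
qed

lemma smooth_on_coords_const: "thick n S \<Longrightarrow> smooth_on_coords n S (\<lambda>x. c)"
  by (simp add: smooth_on_coords_def Ck_on_const)

lemma smooth_real_affine: "smooth_real T (\<lambda>t. c + s * t)"
  unfolding smooth_real_def
  by (rule exI[of _ "\<lambda>m t. if m = 0 then c + s * t else if m = 1 then s else 0"])
     (auto intro!: derivative_eq_intros)

lemma smooth_real_compose_affine:
  assumes "smooth_real UNIV h"
  shows "smooth_real T (\<lambda>t. h (c + s * t))"
proof -
  obtain D where D: "D 0 = h" "\<And>m t. (D m has_real_derivative D (Suc m) t) (at t)"
    using assms unfolding smooth_real_def by auto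
  have "((\<lambda>t. s ^ m * D m (c + s * t)) has_real_derivative s ^ Suc m * D (Suc m) (c + s * t)) (at t)" for m t
  proof -
    have "((\<lambda>t. D m (c + s * t)) has_real_derivative D (Suc m) (c + s * t) * s) (at t)"
      by (rule DERIV_chain2[OF D(2)]) (auto intro!: derivative_eq_intros)
    from DERIV_cmult[OF this, of "s ^ m"] show ?thesis by (simp add: mult_ac)
  qed
  then show ?thesis unfolding smooth_real_def
    by (intro exI[of _ "\<lambda>m t. s ^ m * D m (c + s * t)"]) (use D(1) in auto)
qed

text \<open>Each differentiation advances the phase by pi/2, which describes all derivatives by one
  formula.\<close>

lemma smooth_real_sin: "smooth_real T (\<lambda>t. sin (t + a))"
proof -
  have "((\<lambda>t. sin (t + a + real m * (pi/2))) has_real_derivative sin (t + a + real (Suc m) * (pi/2))) (at t)" for m t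
  proof -
    have "t + a + real (Suc m) * (pi/2) = (t + a + real m * (pi/2)) + pi/2" by (simp add: algebra_simps)
    then have "sin (t + a + real (Suc m) * (pi/2)) = cos (t + a + real m * (pi/2))"
      by (simp only: sin_add[of "t + a + real m * (pi/2)"] sin_pi_half cos_pi_half mult_zero_right mult_1_right add_0)
    then show ?thesis by (auto intro!: derivative_eq_intros)
  qed
  then show ?thesis unfolding smooth_real_def
    by (intro exI[of _ "\<lambda>m t. sin (t + a + real m * (pi/2))"]) auto
qed

lemma smooth_real_cos: "smooth_real T (\<lambda>t. cos (t + a))"
proof -
  have "sin (t + (a + pi/2)) = cos (t + a)" for t
    by (simp only: add.assoc[symmetric] sin_add[of "t + a"] sin_pi_half cos_pi_half mult_zero_right mult_1_right add_0)
  then show ?thesis using smooth_real_sin[of T "a + pi/2"] by simp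
qed

text \<open>Where the cosine is positive, \<open>arcsin\<close> after \<open>sin\<close> is locally
  the identity up to a constant, so its derivatives are 1, 0, 0 and so on. This function is the
  angular part of the chart transitions.\<close>

lemma smooth_real_arcsin_sin:
  "smooth_real {t. 0 < cos (t + a)} (\<lambda>t. arcsin (sin (t + a)))"
proof -
  have "((\<lambda>t. arcsin (sin (t + a))) has_real_derivative 1) (at t)" if "0 < cos (t + a)" for t
  proof -
    have "sin (t + a) ^ 2 < 1" using that by (simp add: sin_squared_eq)
    then have "-1 < sin (t + a)" "sin (t + a) < 1"
      by (auto simp: power2_less_1_iff abs_less_iff abs_square_less_1)
    moreover have "sqrt (1 - (sin (t + a))\<^sup>2) = cos (t + a)"
      using that by (simp add: cos_squared_eq[symmetric])
    ultimately show ?thesis using that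
      by (auto intro!: derivative_eq_intros)
  qed
  then show ?thesis unfolding smooth_real_def
    by (intro exI[of _ "\<lambda>m t. if m = 0 then arcsin (sin (t + a)) else if m = 1 then 1 else 0"]) auto
qed

lemma smooth_real_poly: "smooth_real T (poly p)"
  unfolding smooth_real_def
  by (rule exI[of _ "\<lambda>m. poly ((pderiv ^^ m) p)"]) (auto intro: poly_DERIV)

section \<open>The cylinder\<close>

text \<open>Only the indices 0, 1 and 2 carry information. The angle is represented by a point of
  the unit circle and thus has no jump; index 2 is the height.\<close>

definition cyl :: "(nat \<Rightarrow> real) set" where
  "cyl = {p. (p 0)\<^sup>2 + (p 1)\<^sup>2 = 1 \<and> 0 \<le> p 2 \<and> p 2 \<le> 1 \<and> (\<forall>i\<ge>3. p i = 0)}"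

definition pt :: "real \<Rightarrow> real \<Rightarrow> nat \<Rightarrow> real" where
  "pt t r = (\<lambda>i. if i = 0 then cos t else if i = 1 then sin t else if i = 2 then r else 0)"

lemma pt_simps [simp]: "pt t r 0 = cos t" "pt t r (Suc 0) = sin t" "pt t r 2 = r"
  by (auto simp: pt_def)

lemma pt_in_cyl: "pt t r \<in> cyl \<longleftrightarrow> 0 \<le> r \<and> r \<le> 1"
  by (auto simp: cyl_def pt_def)

lemma fun_eq_3I:
  fixes p q :: "nat \<Rightarrow> real"
  assumes "p 0 = q 0" "p 1 = q 1" "p 2 = q 2" "\<And>i. i \<ge> 3 \<Longrightarrow> p i = q i"
  shows "p = q"
proof
  fix i :: nat
  consider "i = 0" | "i = 1" | "i = 2" | "i \<ge> 3" by linarith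
  then show "p i = q i" using assms by cases auto
qed

lemma fun_eq_2I:
  fixes p q :: "nat \<Rightarrow> real"
  assumes "p 0 = q 0" "p 1 = q 1" "\<And>i. i \<ge> 2 \<Longrightarrow> p i = q i"
  shows "p = q"
  using assms by (intro fun_eq_3I) auto

lemma cyl_eq_pt:
  assumes "p \<in> cyl"
  obtains t where "0 \<le> t" "t \<le> 2 * pi" "p = pt t (p 2)"
proof -
  obtain t where "0 \<le> t" "t < 2 * pi" "p 0 = cos t" "p 1 = sin t"
    using sincos_total_2pi[of "p 0" "p 1"] assms by (auto simp: cyl_def)
  then show ?thesis using assms
    by (intro that[of t] fun_eq_3I) (auto simp: cyl_def pt_def)
qed

lemma continuous_on_pt [continuous_intros]:
  fixes f :: "'a::t2_space \<Rightarrow> real"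
  assumes "continuous_on S f" "continuous_on S g"
  shows "continuous_on S (\<lambda>x. pt (f x) (g x))"
proof (rule continuous_on_coordinatewise_then_product)
  fix i
  show "continuous_on S (\<lambda>x. pt (f x) (g x) i)"
    unfolding pt_def using assms by (cases "i = 0"; cases "i = 1"; cases "i = 2") (auto intro: continuous_on_cos continuous_on_sin)
qed

lemma continuous_on_coord: "continuous_on S (\<lambda>x :: nat \<Rightarrow> real. x i)"
  by (rule continuous_on_subset[OF continuous_on_product_coordinates]) simp

lemma compact_cyl: "compact cyl"
proof -
  have "cyl = (\<lambda>(t, r). pt t r) ` ({0..2 * pi} \<times> {0..1})"
  proof (intro set_eqI iffI)
    fix p assume p: "p \<in> cyl"
    then obtain t where "0 \<le> t" "t \<le> 2 * pi" "p = pt t (p 2)" by (rule cyl_eq_pt)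
    then show "p \<in> (\<lambda>(t, r). pt t r) ` ({0..2 * pi} \<times> {0..1})"
      using p by (intro image_eqI[of _ _ "(t, p 2)"]) (auto simp: cyl_def)
  qed (auto simp: pt_in_cyl)
  moreover have "continuous_on ({0..2 * pi} \<times> {0..1}) (\<lambda>(t, r). pt t r)"
    unfolding case_prod_beta by (intro continuous_intros)
  ultimately show ?thesis
    by (metis compact_continuous_image compact_Times compact_Icc)
qed

text \<open>Distance from the end \<open>p 2 = 1\<close> if \<open>e\<close>, and from the end \<open>p 2 = 0\<close> otherwise.\<close>

definition hgt :: "bool \<Rightarrow> (nat \<Rightarrow> real) \<Rightarrow> real" where
  "hgt e p = (if e then 1 - p 2 else p 2)"

text \<open>Half of a collar of width \<open>h\<close> at an end. The coordinates are the angle relative to \<open>a\<close>, taken in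
  \<open>(-\<pi>/2, \<pi>/2)\<close>, and the distance from the end.\<close>

definition cch :: "real \<Rightarrow> bool \<Rightarrow> real \<Rightarrow> (nat \<Rightarrow> real) chart" where
  "cch a e h = ({p \<in> cyl. 0 < p 0 * cos a + p 1 * sin a \<and> hgt e p < h},
     \<lambda>p i. if i = 0 then arcsin (p 1 * cos a - p 0 * sin a) else if i = 1 then hgt e p else 0)"

text \<open>A total and continuous formula that inverts \<open>cch\<close>, whereas
  \<open>chart_inv\<close> is given by choice and is meaningful on the chart image only.\<close>

definition cinv :: "real \<Rightarrow> bool \<Rightarrow> (nat \<Rightarrow> real) \<Rightarrow> nat \<Rightarrow> real" where
  "cinv a e x = pt (x 0 + a) (if e then 1 - x 1 else x 1)"

definition box2 :: "real \<Rightarrow> (nat \<Rightarrow> real) set" where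
  "box2 h = {x. -(pi/2) < x 0 \<and> x 0 < pi/2 \<and> 0 \<le> x 1 \<and> x 1 < h \<and> (\<forall>i\<ge>2. x i = 0)}"

lemma cch_fst: "p \<in> fst (cch a e h) \<longleftrightarrow> p \<in> cyl \<and> 0 < p 0 * cos a + p 1 * sin a \<and> hgt e p < h"
  by (simp add: cch_def)

lemma cch_snd [simp]: "snd (cch a e h) p 0 = arcsin (p 1 * cos a - p 0 * sin a)"
  "snd (cch a e h) p (Suc 0) = hgt e p" "i \<ge> 2 \<Longrightarrow> snd (cch a e h) p i = 0"
  by (auto simp: cch_def)

lemma rotated_sq:
  fixes x y a :: real
  assumes "x\<^sup>2 + y\<^sup>2 = 1"
  shows "(x * cos a + y * sin a)\<^sup>2 + (y * cos a - x * sin a)\<^sup>2 = 1"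
proof -
  have "(x * cos a + y * sin a)\<^sup>2 + (y * cos a - x * sin a)\<^sup>2 = (x\<^sup>2 + y\<^sup>2) * ((sin a)\<^sup>2 + (cos a)\<^sup>2)"
    by algebra
  then show ?thesis using assms by simp
qed

lemma arcsin_facts:
  fixes c s :: real
  assumes "c\<^sup>2 + s\<^sup>2 = 1" "0 < c"
  shows "cos (arcsin s) = c" "sin (arcsin s) = s" "-(pi/2) < arcsin s" "arcsin s < pi/2"
proof -
  have s: "s\<^sup>2 < 1" using assms by (smt (verit) zero_less_power)
  then have "\<bar>s\<bar> < 1" by (simp add: abs_square_less_1)
  then have s': "-1 < s" "s < 1" by auto
  have "1 - s\<^sup>2 = c\<^sup>2" using assms by simp
  then show "cos (arcsin s) = c" using s' assms(2) by (simp add: cos_arcsin)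
  show "sin (arcsin s) = s" "-(pi/2) < arcsin s" "arcsin s < pi/2"
    using s' arcsin_lt_bounded[of s] by auto
qed

lemma cinv_coords:
  assumes "p \<in> fst (cch a e h)"
  shows "snd (cch a e h) p \<in> box2 h" "cinv a e (snd (cch a e h) p) = p"
proof -
  define c s where "c = p 0 * cos a + p 1 * sin a" and "s = p 1 * cos a - p 0 * sin a"
  have p: "p \<in> cyl" "0 < c" "hgt e p < h" using assms by (auto simp: cch_fst c_def)
  then have "c\<^sup>2 + s\<^sup>2 = 1" using rotated_sq[of "p 0" "p 1" a] by (simp add: c_def s_def cyl_def)
  note f = arcsin_facts[OF this p(2)]
  have s': "s = p (Suc 0) * cos a - p 0 * sin a" by (simp add: s_def)
  show "snd (cch a e h) p \<in> box2 h"
    using f p by (auto simp: box2_def s'[symmetric] hgt_def cyl_def)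
  have sc: "sin a * sin a = 1 - cos a * cos a"
    using sin_cos_squared_add[of a] by (simp add: power2_eq_square)
  have "c * cos a - s * sin a = p 0" "s * cos a + c * sin a = p 1"
    using sc unfolding c_def s_def by algebra+
  then show "cinv a e (snd (cch a e h) p) = p"
    using f p(1)
    by (intro fun_eq_3I)
       (auto simp: cinv_def s'[symmetric] cos_add sin_add hgt_def cyl_def pt_def)
qed

lemma cos_sin_shift:
  fixes t a b :: real
  shows "cos (t + a) * cos b + sin (t + a) * sin b = cos (t + (a - b))"
  "sin (t + a) * cos b - cos (t + a) * sin b = sin (t + (a - b))"
  using cos_diff[of "t + a" b] sin_diff[of "t + a" b] by (simp_all add: add_diff_eq)

lemma coords_cinv:
  assumes "x \<in> box2 h" "h \<le> 1"
  shows "cinv a e x \<in> fst (cch a e h)" "snd (cch a e h) (cinv a e x) = x"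
proof -
  have x: "-(pi/2) < x 0" "x 0 < pi/2" "0 \<le> x 1" "x 1 < h" "\<forall>i\<ge>2. x i = 0"
    using assms by (auto simp: box2_def)
  then have "0 < cos (x 0)" by (intro cos_gt_zero_pi) auto
  then show "cinv a e x \<in> fst (cch a e h)"
    using x assms(2) cos_sin_shift[of "x 0" a a]
    by (auto simp: cch_fst cinv_def pt_in_cyl hgt_def)
  show "snd (cch a e h) (cinv a e x) = x"
    using x cos_sin_shift[of "x 0" a a]
    by (intro fun_eq_2I) (auto simp: cinv_def hgt_def arcsin_sin)
qed

text \<open>Transitions and smooth functions are defined on images of sets under charts. Rewritten
  as preimages under the continuous map \<open>cinv\<close>, these images are visibly open in the
  half-space when \<open>U\<close> is open in the cylinder.\<close>

lemma image_cch_Int: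
  assumes "h \<le> 1"
  shows "snd (cch a e h) ` (U \<inter> fst (cch a e h)) = {x \<in> box2 h. cinv a e x \<in> U}"
proof (intro set_eqI iffI)
  fix x assume "x \<in> {x \<in> box2 h. cinv a e x \<in> U}"
  then show "x \<in> snd (cch a e h) ` (U \<inter> fst (cch a e h))"
    using coords_cinv[OF _ assms] by (intro image_eqI[of _ _ "cinv a e x"]) auto
qed (use cinv_coords in auto)

lemma chart_image_cch: "h \<le> 1 \<Longrightarrow> chart_image (cch a e h) = box2 h"
  using image_cch_Int[of h a e UNIV] by (simp add: chart_image_def)

lemma inj_on_cch: "inj_on (snd (cch a e h)) (fst (cch a e h))"
  by (rule inj_on_inverseI[where g = "cinv a e"]) (rule cinv_coords(2))

lemma chart_inv_cch: "x \<in> box2 h \<Longrightarrow> h \<le> 1 \<Longrightarrow> chart_inv (cch a e h) x = cinv a e x"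
  using coords_cinv[of x h a e] inv_into_f_f[OF inj_on_cch, of "cinv a e x" a e h]
  by (simp add: chart_inv_def)

lemma chart_inv_coords: "p \<in> fst (cch a e h) \<Longrightarrow> chart_inv (cch a e h) (snd (cch a e h) p) = p"
  unfolding chart_inv_def by (rule inv_into_f_f[OF inj_on_cch])

lemma continuous_on_cinv: "continuous_on S (cinv a e)"
  unfolding cinv_def
  by (cases e; simp; intro continuous_on_pt continuous_intros continuous_on_coord)

lemma continuous_on_cch: "continuous_on (fst (cch a e h)) (snd (cch a e h))"
proof (rule continuous_on_coordinatewise_then_product)
  fix i
  have "continuous_on (fst (cch a e h)) (\<lambda>p. arcsin (p 1 * cos a - p 0 * sin a))"
  proof (intro continuous_intros continuous_on_coord ballI)
    fix p assume p: "p \<in> fst (cch a e h)"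
    then have "(p 1 * cos a - p 0 * sin a)\<^sup>2 \<le> 1"
      using rotated_sq[of "p 0" "p 1" a] by (simp add: cch_fst cyl_def) (smt (verit) zero_le_power2)
    then show "-1 \<le> p 1 * cos a - p 0 * sin a \<and> p 1 * cos a - p 0 * sin a \<le> 1"
      by (simp add: abs_square_le_1 abs_le_iff)
  qed
  moreover have "continuous_on (fst (cch a e h)) (hgt e)"
    unfolding hgt_def by (cases e) (auto intro!: continuous_intros continuous_on_coord)
  ultimately show "continuous_on (fst (cch a e h)) (\<lambda>p. snd (cch a e h) p i)"
    unfolding cch_def by (cases "i = 0"; cases "i = 1") auto
qed

lemma openin_box2_preimage:
  assumes "openin (top_of_set cyl) U" "h \<le> 1"
  shows "openin (half_space 2) {x \<in> box2 h. cinv a e x \<in> U}"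
proof -
  obtain T where T: "open T" "U = cyl \<inter> T" using assms(1) by (auto simp: openin_open)
  define W where "W = {x :: nat \<Rightarrow> real. -(pi/2) < x 0} \<inter> {x. x 0 < pi/2} \<inter> {x. x 1 < h} \<inter> cinv a e -` T"
  have "open (cinv a e -` T)"
    using T(1) continuous_on_cinv[of UNIV a e] by (metis continuous_on_open_vimage open_UNIV inf_top_right)
  then have "open W" unfolding W_def
    by (intro open_Int open_Collect_less continuous_on_coord continuous_on_const) auto
  moreover have "{x \<in> box2 h. cinv a e x \<in> U} = {x. (\<forall>i\<ge>2. x i = 0) \<and> 0 \<le> x (2 - 1)} \<inter> W"
    using coords_cinv(1)[OF _ assms(2), of _ a e]
    by (auto simp: W_def T(2) box2_def cch_fst)
  ultimately show ?thesis
    unfolding half_space_top_of_set openin_open by blast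
qed

lemma openin_cch: "openin (top_of_set cyl) (fst (cch a e h))"
proof -
  have "continuous_on UNIV (hgt e)"
    unfolding hgt_def by (cases e) (auto intro!: continuous_intros continuous_on_coord)
  then have "open ({p :: nat \<Rightarrow> real. 0 < p 0 * cos a + p 1 * sin a} \<inter> {p. hgt e p < h})"
    by (intro open_Int open_Collect_less continuous_intros continuous_on_coord)
  moreover have "fst (cch a e h) = cyl \<inter> ({p. 0 < p 0 * cos a + p 1 * sin a} \<inter> {p. hgt e p < h})"
    by (auto simp: cch_fst)
  ultimately show ?thesis unfolding openin_open by blast
qed

text \<open>Every chart is a boundary chart of one end: a collar of width 1 reaches up to the
  opposite end and excludes it, so the two collars cover the cylinder without interior charts.
  Admitting all angles \<open>a\<close> keeps the atlas invariant under rotations and provides a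
  chart centred at any given point of the circle.\<close>

definition cmfd :: "(nat \<Rightarrow> real) mfd" where
  "cmfd = \<lparr>mtop = top_of_set cyl, mdim = 2, matlas = {cch a e 1 | a e. True}\<rparr>"

lemma cmfd_simps [simp]: "mtop cmfd = top_of_set cyl" "mdim cmfd = 2" "pts cmfd = cyl"
  by (auto simp: cmfd_def)

lemma atlas_cmfd: "c \<in> matlas cmfd \<longleftrightarrow> (\<exists>a e. c = cch a e 1)"
  by (auto simp: cmfd_def)

lemma homeomorphic_map_top_of_setI:
  assumes "continuous_on A f" "f ` A = B" "continuous_on B g" "\<And>x. x \<in> A \<Longrightarrow> g (f x) = x"
  shows "homeomorphic_map (top_of_set A) (top_of_set B) f"
  unfolding homeomorphic_map_maps homeomorphic_maps_def
  using assms by (intro exI[of _ g]) auto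

lemma is_chart_cch:
  assumes "h \<le> 1"
  shows "is_chart cmfd (cch a e h)"
proof -
  have box: "openin (half_space 2) (box2 h)"
    using openin_box2_preimage[OF _ assms, of cyl a e] coords_cinv(1)[OF _ assms, of _ a e]
    by (simp add: cch_fst Collect_conj_eq2 cong: conj_cong) 
  have "fst (cch a e h) \<subseteq> cyl" by (auto simp: cch_fst)
  moreover have "box2 h \<subseteq> {x. \<forall>i\<ge>2. x i = 0}" by (auto simp: box2_def)
  moreover have "homeomorphic_map (top_of_set (fst (cch a e h))) (top_of_set (box2 h)) (snd (cch a e h))"
    by (rule homeomorphic_map_top_of_setI[OF continuous_on_cch _ continuous_on_cinv[of _ a e]])
       (use chart_image_cch[OF assms, of a e] cinv_coords in \<open>auto simp: chart_image_def\<close>)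
  ultimately show ?thesis
    unfolding is_chart_def
    using box openin_cch[of a e h] chart_image_cch[OF assms, of a e]
    by (simp add: Euclidean_space_top_of_set subtopology_subtopology Int_absorb1)
qed

lemma thick_image:
  assumes "openin (top_of_set cyl) U" "h \<le> 1"
  shows "thick 2 (snd (cch a e h) ` (U \<inter> fst (cch a e h)))"
  unfolding image_cch_Int[OF assms(2)]
  by (rule thick_half_space[OF openin_box2_preimage[OF assms]])

lemma smooth_transition_cch:
  assumes "h \<le> 1"
  shows "smooth_transition 2 (cch a e h) (cch a' e' h')"
  unfolding smooth_transition_def
proof (intro allI impI)
  fix i :: nat assume "i < 2"
  define S where "S = snd (cch a e h) ` (fst (cch a e h) \<inter> fst (cch a' e' h'))"
  have S: "S = {x \<in> box2 h. cinv a e x \<in> fst (cch a' e' h')}"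
    using image_cch_Int[OF assms, of a e "fst (cch a' e' h')"] by (simp add: S_def Int_commute)
  have thick: "thick 2 S"
    using thick_image[OF openin_cch[of a' e' h'] assms, of a e] by (simp add: S_def Int_commute)
  \<comment> \<open>Membership in the half circle of the target chart says that the angle relative
    to \<open>a'\<close> has positive cosine, which is the domain where \<open>arcsin\<close> after
    \<open>sin\<close> is smooth.\<close>
  have pos: "0 < cos (x 0 + (a - a'))" if "x \<in> S" for x
    using that cos_sin_shift[of "x 0" a a'] by (simp add: S cch_fst cinv_def)
  have eq: "snd (cch a' e' h') (chart_inv (cch a e h) x) i =
     (if i = 0 then arcsin (sin (x 0 + (a - a'))) else if e = e' then 0 + 1 * x 1 else 1 + (-1) * x 1)"
    if "x \<in> S" for x
    using that \<open>i < 2\<close> assms cos_sin_shift[of "x 0" a a']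
    by (auto simp: S chart_inv_cch cinv_def less_2_cases_iff hgt_def)
  have "smooth_on_coords 2 S (\<lambda>x. if i = 0 then arcsin (sin (x 0 + (a - a')))
      else if e = e' then 0 + 1 * x 1 else 1 + (-1) * x 1)"
    using smooth_on_coords_coordinate[OF thick _ smooth_real_arcsin_sin, of 0 "a - a'"]
      smooth_on_coords_coordinate[OF thick _ smooth_real_affine[of UNIV 0 1], of 1]
      smooth_on_coords_coordinate[OF thick _ smooth_real_affine[of UNIV 1 "-1"], of 1] pos
    by (cases "i = 0"; cases "e = e'") auto
  then show "smooth_on_coords 2 S (\<lambda>x. snd (cch a' e' h') (chart_inv (cch a e h) x) i)"
    using eq by (simp cong: smooth_on_coords_cong)
qed

lemma smooth_chart_cch: "h \<le> 1 \<Longrightarrow> smooth_chart cmfd (cch a e h)"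
  by (auto simp: smooth_chart_def is_chart_cch atlas_cmfd smooth_transition_cch)

lemma ex_cch:
  assumes "p \<in> cyl" "hgt e p < h"
  shows "\<exists>a. p \<in> fst (cch a e h)"
proof -
  obtain t where "p = pt t (p 2)" using assms(1) by (rule cyl_eq_pt)
  then have "p 0 = cos t" "p 1 = sin t"
    by (metis pt_simps(1), metis pt_simps(2) One_nat_def)
  then have "p \<in> fst (cch t e h)"
    using assms sin_cos_squared_add[of t] by (simp add: cch_fst power2_eq_square)
  then show ?thesis by blast
qed

lemma ex_cch1:
  assumes "p \<in> cyl"
  shows "\<exists>a e. p \<in> fst (cch a e 1)"
proof (cases "p 2 < 1")
  case True
  then show ?thesis using ex_cch[OF assms, of False 1] by (auto simp: hgt_def)
next
  case False
  then show ?thesis using ex_cch[OF assms, of True 1] assms by (auto simp: hgt_def cyl_def)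
qed

lemma second_countable_top_of_set:
  "second_countable (top_of_set (S :: 'a::second_countable_topology set))"
proof -
  obtain B :: "'a set set" where B: "countable B" "topological_basis B"
    using ex_countable_basis by blast
  have "\<exists>V\<in>B. x \<in> V \<and> V \<subseteq> U" if "open U" "x \<in> U" for U x
    using topological_basisE[OF B(2) that] by metis
  then have "second_countable (euclidean :: 'a topology)"
    unfolding second_countable_def
    using B(1) topological_basis_open[OF B(2)] by (intro exI[of _ B]) simp
  then show ?thesis by (rule second_countable_subtopology)
qed

lemma smooth_manifold_cmfd: "smooth_manifold cmfd"
  unfolding smooth_manifold_def
proof (intro conjI)
  show "(\<Union>c\<in>matlas cmfd. fst c) = pts cmfd"
  proof (intro set_eqI iffI)
    fix p assume "p \<in> pts cmfd"
    then obtain a e where "p \<in> fst (cch a e 1)" using ex_cch1[of p] by auto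
    then show "p \<in> (\<Union>c\<in>matlas cmfd. fst c)" by (intro UN_I[of "cch a e 1"]) (auto simp: atlas_cmfd)
  next
    fix p assume "p \<in> (\<Union>c\<in>matlas cmfd. fst c)"
    then obtain c where "c \<in> matlas cmfd" "p \<in> fst c" by blast
    then show "p \<in> pts cmfd" using atlas_cmfd cch_fst by auto
  qed
qed (auto simp: atlas_cmfd smooth_chart_cch second_countable_top_of_set Hausdorff_space_subtopology)

lemma compact_space_cmfd: "compact_space (mtop cmfd)"
  by (simp add: compact_space_subtopology compact_cyl)

section \<open>The boundary of the cylinder\<close>

definition bdry :: "(nat \<Rightarrow> real) set" where
  "bdry = {p \<in> cyl. p 2 = 0 \<or> p 2 = 1}"

definition bch :: "real \<Rightarrow> bool \<Rightarrow> (nat \<Rightarrow> real) chart" where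
  "bch a e = (fst (cch a e 1) \<inter> bdry, snd (cch a e 1))"

definition box1 :: "(nat \<Rightarrow> real) set" where
  "box1 = {x. -(pi/2) < x 0 \<and> x 0 < pi/2 \<and> (\<forall>i\<ge>1. x i = 0)}"

lemma box1_eq: "box1 = {x \<in> box2 1. x 1 = 0}"
proof -
  have "(\<forall>i\<ge>1. x i = 0) \<longleftrightarrow> x 1 = 0 \<and> (\<forall>i\<ge>2. x i = 0)" for x :: "nat \<Rightarrow> real"
    by (metis One_nat_def Suc_1 le_eq_less_or_eq less_Suc_eq_le not_less_eq_eq order_refl)
  then show ?thesis by (auto simp: box1_def box2_def)
qed

lemma openin_box2: "h \<le> 1 \<Longrightarrow> openin (half_space 2) (box2 h)"
  using openin_box2_preimage[of cyl h 0 False] coords_cinv(1)[of _ h 0 False]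
  by (simp add: cch_fst Collect_conj_eq2 cong: conj_cong)

lemma bdry_cases:
  assumes "p \<in> bdry"
  obtains e where "hgt e p = 0"
  using assms that[of False] that[of True] by (auto simp: bdry_def hgt_def)

lemma bdry_subset: "p \<in> bdry \<Longrightarrow> p \<in> cyl"
  by (simp add: bdry_def)

text \<open>Boundary points have height 0 or 1 over each end, so a collar of width 1 meets the
  boundary in its own end only.\<close>

lemma bdry_hgt: "p \<in> bdry \<Longrightarrow> hgt e p < 1 \<longleftrightarrow> hgt e p = 0"
  by (auto simp: bdry_def hgt_def)

lemma hgt_0_bdry: "p \<in> cyl \<Longrightarrow> hgt e p = 0 \<Longrightarrow> p \<in> bdry"
  by (auto simp: bdry_def hgt_def split: if_splits)

lemma boundary_chart_at_cmfd:
  "boundary_chart_at cmfd c p \<longleftrightarrow> (\<exists>a e. c = cch a e 1 \<and> p \<in> fst c \<and> hgt e p = 0)"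
  unfolding boundary_chart_at_def
  by (fastforce simp: atlas_cmfd chart_image_cch openin_box2)

lemma boundary_pts_cmfd: "boundary_pts cmfd = bdry"
proof (intro set_eqI iffI)
  fix p assume "p \<in> bdry"
  then obtain e where e: "hgt e p = 0" by (rule bdry_cases)
  then obtain a where "p \<in> fst (cch a e 1)"
    using ex_cch[of p e 1] bdry_subset[OF \<open>p \<in> bdry\<close>] by auto
  then show "p \<in> boundary_pts cmfd"
    using e unfolding boundary_pts_def boundary_chart_at_cmfd by blast
qed (auto simp: boundary_pts_def boundary_chart_at_cmfd cch_fst hgt_0_bdry simp del: split_paired_Ex)

lemma boundary_cmfd_simps [simp]:
  "mtop (boundary cmfd) = top_of_set bdry" "mdim (boundary cmfd) = 1" "pts (boundary cmfd) = bdry"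
  using bdry_subset
  by (auto simp: boundary_def boundary_pts_cmfd subtopology_subtopology Int_absorb1 subsetI)

lemma atlas_boundary: "c \<in> matlas (boundary cmfd) \<longleftrightarrow> (\<exists>a e. c = bch a e)"
proof -
  have "matlas (boundary cmfd) = (\<lambda>c. (fst c \<inter> bdry, snd c)) ` matlas cmfd"
    by (simp add: boundary_def boundary_pts_cmfd)
  moreover have "matlas cmfd = range (\<lambda>(a, e). cch a e 1)"
    by (simp add: cmfd_def full_SetCompr_eq[symmetric])
  ultimately have "matlas (boundary cmfd) = range (\<lambda>(a, e). bch a e)"
    unfolding bch_def by (simp add: image_image case_prod_unfold)
  then show ?thesis by auto
qed

lemma bch_fst: "p \<in> fst (bch a e) \<longleftrightarrow> p \<in> fst (cch a e 1) \<and> hgt e p = 0"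
  using hgt_0_bdry bdry_hgt by (auto simp: bch_def cch_fst)

lemma snd_bch: "snd (bch a e) = snd (cch a e 1)"
  by (simp add: bch_def)

lemma image_bch_Int: "snd (bch a e) ` (U \<inter> fst (bch a e)) = {x \<in> box1. cinv a e x \<in> U}"
proof -
  have "U \<inter> fst (bch a e) = (U \<inter> {p. hgt e p = 0}) \<inter> fst (cch a e 1)"
    by (auto simp: bch_fst)
  then have "snd (bch a e) ` (U \<inter> fst (bch a e)) = {x \<in> box2 1. cinv a e x \<in> U \<inter> {p. hgt e p = 0}}"
    using image_cch_Int[of 1 a e "U \<inter> {p. hgt e p = 0}"] by (simp add: snd_bch)
  also have "\<dots> = {x \<in> box1. cinv a e x \<in> U}"
    by (auto simp: box1_eq cinv_def hgt_def)
  finally show ?thesis .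
qed

lemma chart_image_bch: "chart_image (bch a e) = box1"
  using image_bch_Int[of a e UNIV] by (simp add: chart_image_def)

lemma inj_on_bch: "inj_on (snd (bch a e)) (fst (bch a e))"
  by (rule inj_on_inverseI[where g = "cinv a e"]) (simp add: bch_fst snd_bch cinv_coords(2))

lemma coords_cinv_bch: "x \<in> box1 \<Longrightarrow> cinv a e x \<in> fst (bch a e) \<and> snd (bch a e) (cinv a e x) = x"
  using coords_cinv[of x 1 a e] by (auto simp: box1_eq bch_fst snd_bch cinv_def hgt_def)

lemma chart_inv_bch: "x \<in> box1 \<Longrightarrow> chart_inv (bch a e) x = cinv a e x"
  using coords_cinv_bch[of x a e] inv_into_f_f[OF inj_on_bch, of "cinv a e x" a e]
  by (simp add: chart_inv_def)

lemma openin_box1_preimage: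
  assumes "openin (top_of_set bdry) U"
  shows "openin (Euclidean_space 1) {x \<in> box1. cinv a e x \<in> U}"
proof -
  obtain T where T: "open T" "U = bdry \<inter> T" using assms(1) by (auto simp: openin_open)
  define W where "W = {x :: nat \<Rightarrow> real. -(pi/2) < x 0} \<inter> {x. x 0 < pi/2} \<inter> cinv a e -` T"
  have "open (cinv a e -` T)"
    using T(1) continuous_on_cinv[of UNIV a e] by (metis continuous_on_open_vimage open_UNIV inf_top_right)
  then have "open W" unfolding W_def
    by (intro open_Int open_Collect_less continuous_on_coord continuous_on_const) auto
  moreover have "{x \<in> box1. cinv a e x \<in> U} = {x. \<forall>i\<ge>1. x i = 0} \<inter> W"
    using coords_cinv_bch[of _ a e]
    by (auto simp: W_def T(2) box1_def bch_def)
  ultimately show ?thesis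
    unfolding Euclidean_space_top_of_set openin_open by blast
qed

lemma openin_bch: "openin (top_of_set bdry) (fst (bch a e))"
proof -
  have "bdry \<subseteq> cyl" using bdry_subset by blast
  then have "openin (top_of_set bdry) (bdry \<inter> fst (cch a e 1))"
    using openin_cch[of a e 1] unfolding openin_open by fast
  then show ?thesis by (simp add: bch_def Int_commute)
qed

lemma is_chart_bch: "is_chart (boundary cmfd) (bch a e)"
proof -
  have "openin (Euclidean_space 1) box1"
    using openin_box1_preimage[of bdry a e] coords_cinv_bch[of _ a e]
    by (simp add: bch_def Collect_conj_eq2 cong: conj_cong)
  moreover have "fst (bch a e) \<subseteq> bdry" by (auto simp: bch_def)
  moreover have "box1 \<subseteq> {x. \<forall>i\<ge>1. x i = 0}" by (auto simp: box1_def)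
  moreover have "continuous_on (fst (bch a e)) (snd (bch a e))"
    unfolding snd_bch by (rule continuous_on_subset[OF continuous_on_cch]) (auto simp: bch_def)
  then have "homeomorphic_map (top_of_set (fst (bch a e))) (top_of_set box1) (snd (bch a e))"
    by (rule homeomorphic_map_top_of_setI[OF _ _ continuous_on_cinv[of _ a e]])
       (use chart_image_bch[of a e] cinv_coords in \<open>auto simp: chart_image_def bch_fst snd_bch\<close>)
  ultimately show ?thesis
    unfolding is_chart_def
    using openin_bch[of a e] chart_image_bch[of a e]
    by (simp add: Euclidean_space_top_of_set subtopology_subtopology Int_absorb1)
qed

lemma smooth_transition_bch: "smooth_transition 1 (bch a e) (bch a' e')"
  unfolding smooth_transition_def
proof (intro allI impI)
  fix i :: nat assume "i < 1"
  define S where "S = snd (bch a e) ` (fst (bch a e) \<inter> fst (bch a' e'))"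
  have S: "S = {x \<in> box1. cinv a e x \<in> fst (bch a' e')}"
    using image_bch_Int[of a e "fst (bch a' e')"] by (simp add: S_def Int_commute)
  have thick: "thick 1 S"
    unfolding S by (rule thick_Euclidean[OF openin_box1_preimage[OF openin_bch]])
  have pos: "0 < cos (x 0 + (a - a'))" if "x \<in> S" for x
    using that cos_sin_shift[of "x 0" a a'] by (simp add: S bch_fst cch_fst cinv_def)
  have eq: "snd (bch a' e') (chart_inv (bch a e) x) i = arcsin (sin (x 0 + (a - a')))"
    if "x \<in> S" for x
    using that \<open>i < 1\<close> cos_sin_shift[of "x 0" a a']
    by (auto simp: S chart_inv_bch cinv_def snd_bch)
  have "smooth_on_coords 1 S (\<lambda>x. arcsin (sin (x 0 + (a - a'))))"
    using smooth_on_coords_coordinate[OF thick _ smooth_real_arcsin_sin, of 0 "a - a'"] pos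
    by auto
  then show "smooth_on_coords 1 S (\<lambda>x. snd (bch a' e') (chart_inv (bch a e) x) i)"
    using eq by (simp cong: smooth_on_coords_cong)
qed

lemma smooth_chart_bch: "smooth_chart (boundary cmfd) (bch a e)"
  by (auto simp: smooth_chart_def is_chart_bch atlas_boundary smooth_transition_bch simp del: One_nat_def)

text \<open>Fixing the normal coordinate at 0 does not change the slices in the tangential
  direction, so the tangential partial derivatives of \<open>f\<close> and of its restriction are
  the same.\<close>

lemma Ck_on_restrict_boundary:
  assumes "thick 2 S" "thick 1 {x \<in> S. x 1 = 0}" "Ck_on k 2 S f"
  shows "Ck_on k 1 {x \<in> S. x 1 = 0} f"
  using assms(3)
proof (induction k arbitrary: f)
  case 0
  then show ?case by (auto elim: continuous_on_subset)
next
  case (Suc k)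
  let ?S = "{x \<in> S. x 1 = 0}"
  have sl: "coord_slice ?S 0 x = coord_slice S 0 x" if "x \<in> ?S" for x
    using that by (auto simp: coord_slice_def)
  then have "partial_in ?S 0 f x = partial_in S 0 f x" if "x \<in> ?S" for x
    using that by (simp add: partial_in_def)
  moreover have "Ck_on k 1 ?S (partial_in S 0 f)"
    using Suc by auto
  ultimately have "Ck_on k 1 ?S (partial_in ?S 0 f)"
    by (subst Ck_on_cong[where g = "partial_in S 0 f"]) auto
  moreover have "continuous_on ?S f" using Suc.prems by (auto elim: continuous_on_subset)
  moreover have "(\<lambda>t. f (x(0 := t))) differentiable (at (x 0) within coord_slice ?S 0 x)"
    if "x \<in> ?S" for x
    using Suc.prems that unfolding sl[OF that] by auto
  ultimately show ?case by auto
qed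

text \<open>Derivations are cut off outside the functions smooth near the base point, and these
  classes differ for the cylinder and its boundary. The inclusion shown here makes the two cut-offs
  compatible when a boundary vector is pushed into the cylinder.\<close>

lemma smooth_near_boundary:
  assumes "f \<in> smooth_near cmfd p" "p \<in> bdry"
  shows "f \<in> smooth_near (boundary cmfd) p"
proof -
  obtain U where U: "openin (top_of_set cyl) U" "p \<in> U"
    "\<And>c. c \<in> matlas cmfd \<Longrightarrow> smooth_on_coords 2 (snd c ` (U \<inter> fst c)) (\<lambda>x. f (chart_inv c x))"
    using assms(1) by (auto simp: smooth_near_def)
  have V: "openin (top_of_set bdry) (U \<inter> bdry)"
    using U(1) bdry_subset by (fastforce simp: openin_open)
  have "smooth_on_coords 1 (snd c ` ((U \<inter> bdry) \<inter> fst c)) (\<lambda>x. f (chart_inv c x))"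
    if cin: "c \<in> matlas (boundary cmfd)" for c
  proof -
    obtain a e where c: "c = bch a e" using iffD1[OF atlas_boundary cin] by blast
    let ?S = "{x \<in> box2 1. cinv a e x \<in> U}"
    have "cinv a e x \<in> bdry" if "x \<in> box1" for x
      using coords_cinv_bch[OF that, of a e] by (auto simp: bch_def)
    then have eq: "snd c ` ((U \<inter> bdry) \<inter> fst c) = {x \<in> ?S. x 1 = 0}"
      using image_bch_Int[of a e "U \<inter> bdry"] by (auto simp: c box1_eq)
    have th: "thick 1 {x \<in> ?S. x 1 = 0}"
      using thick_Euclidean[OF openin_box1_preimage[OF V], of a e] eq image_bch_Int[of a e "U \<inter> bdry"]
      by (simp add: c)
    have "smooth_on_coords 2 ?S (\<lambda>x. f (chart_inv (cch a e 1) x))"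
      using U(3)[of "cch a e 1"] image_cch_Int[of 1 a e U] by (auto simp: atlas_cmfd)
    then have "smooth_on_coords 1 {x \<in> ?S. x 1 = 0} (\<lambda>x. f (chart_inv (cch a e 1) x))"
      using Ck_on_restrict_boundary[OF thick_half_space[OF openin_box2_preimage[OF U(1)]] th]
      by (auto simp: smooth_on_coords_def)
    moreover have "chart_inv (cch a e 1) x = chart_inv c x" if "x \<in> {x \<in> ?S. x 1 = 0}" for x
      using that by (simp add: c chart_inv_cch chart_inv_bch box1_eq)
    ultimately show ?thesis unfolding eq
      using smooth_on_coords_cong[of "{x \<in> ?S. x 1 = 0}" "\<lambda>x. f (chart_inv (cch a e 1) x)" "\<lambda>x. f (chart_inv c x)"]
      by auto
  qed
  then show ?thesis
    unfolding smooth_near_def using V U(2) assms(2) by (auto intro!: exI[of _ "U \<inter> bdry"])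
qed

section \<open>Tangent vectors of the cylinder\<close>

definition rot :: "real \<Rightarrow> (nat \<Rightarrow> real) \<Rightarrow> nat \<Rightarrow> real" where
  "rot s p = (\<lambda>i. if i = 0 then cos s * p 0 - sin s * p 1
     else if i = 1 then sin s * p 0 + cos s * p 1 else p i)"

lemma rot_simps [simp]: "rot s p 0 = cos s * p 0 - sin s * p (Suc 0)"
  "rot s p (Suc 0) = sin s * p 0 + cos s * p (Suc 0)" "i \<ge> 2 \<Longrightarrow> rot s p i = p i"
  by (auto simp: rot_def)

text \<open>The angular derivation also serves for the boundary, whose smooth functions are others.\<close>

definition dth :: "(nat \<Rightarrow> real) mfd \<Rightarrow> (nat \<Rightarrow> real) \<Rightarrow> (nat \<Rightarrow> real) tvec" where
  "dth N p = (\<lambda>f. if f \<in> smooth_near N p then vector_derivative (\<lambda>s. f (rot s p)) (at 0) else 0)"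

text \<open>The height is differentiated within the unit interval, hence one-sidedly at both ends,
  and always in the upward direction. The coordinate vector of a chart at the upper end is therefore
  \<open>- drr p\<close>.\<close>

definition drr :: "(nat \<Rightarrow> real) \<Rightarrow> (nat \<Rightarrow> real) tvec" where
  "drr p = (\<lambda>f. if f \<in> smooth_near cmfd p
     then vector_derivative (\<lambda>s. f (p(2 := s))) (at (p 2) within {0..1}) else 0)"

definition tv :: "(nat \<Rightarrow> real) \<Rightarrow> real \<Rightarrow> real \<Rightarrow> (nat \<Rightarrow> real) tvec" where
  "tv p \<alpha> \<beta> = (\<lambda>f. \<alpha> * dth cmfd p f + \<beta> * drr p f)"

definition btv :: "(nat \<Rightarrow> real) \<Rightarrow> real \<Rightarrow> (nat \<Rightarrow> real) tvec" where
  "btv p \<alpha> = (\<lambda>f. \<alpha> * dth (boundary cmfd) p f)"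

lemma rot_pt: "rot s (pt t r) = pt (t + s) r"
  by (intro fun_eq_3I) (auto simp: cos_add sin_add pt_def)

lemma cinv_rot:
  assumes "p \<in> fst (cch a e h)"
  shows "cinv a e ((snd (cch a e h) p)(0 := t)) = rot (t - snd (cch a e h) p 0) p"
proof -
  define x where "x = snd (cch a e h) p"
  have "p = cinv a e x" using cinv_coords(2)[OF assms] by (simp add: x_def)
  then have "rot (t - x 0) p = pt (x 0 + a + (t - x 0)) (if e then 1 - x 1 else x 1)"
    by (simp only: cinv_def rot_pt)
  then show ?thesis by (simp add: cinv_def x_def algebra_simps)
qed

lemma cinv_height:
  assumes "p \<in> fst (cch a e h)"
  shows "cinv a e ((snd (cch a e h) p)(1 := t)) = p(2 := if e then 1 - t else t)"
proof -
  define x where "x = snd (cch a e h) p"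
  have "p = cinv a e x" using cinv_coords(2)[OF assms] by (simp add: x_def)
  then have "p(2 := if e then 1 - t else t) = (cinv a e x)(2 := if e then 1 - t else t)" by simp
  also have "\<dots> = cinv a e (x(1 := t))"
    by (intro fun_eq_3I) (auto simp: cinv_def pt_def)
  finally show ?thesis by (simp add: x_def)
qed

section \<open>Partial derivatives in collar charts as derivatives along rotations and vertical
  shifts\<close>

lemma slice_box2:
  assumes "x \<in> box2 h"
  shows "coord_slice (box2 h) 0 x = {-(pi/2)<..<pi/2}" "coord_slice (box2 h) 1 x = {0..<h}"
  using assms by (auto simp: coord_slice_def box2_def)

lemma slice_box1:
  assumes "x \<in> box1"
  shows "coord_slice box1 0 x = {-(pi/2)<..<pi/2}"
  using assms by (auto simp: coord_slice_def box1_def)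

lemma has_vector_derivative_shift_open:
  fixes k g :: "real \<Rightarrow> real"
  assumes "open A" "x \<in> A" "\<And>t. t \<in> A \<Longrightarrow> g t = k (t - x)"
  shows "(g has_vector_derivative d) (at x within A) \<longleftrightarrow> (k has_vector_derivative d) (at 0)"
proof -
  have "(g has_vector_derivative d) (at x within A) \<longleftrightarrow> ((\<lambda>t. k (t - x)) has_vector_derivative d) (at x within A)"
    by (rule has_vector_derivative_cong_within) (use assms in auto)
  also have "\<dots> \<longleftrightarrow> ((\<lambda>t. k (t - x)) has_real_derivative d) (at (0 + x))"
    by (simp only: at_within_open[OF assms(2,1)] has_real_derivative_iff_has_vector_derivative add_0)
  also have "\<dots> \<longleftrightarrow> (k has_vector_derivative d) (at 0)"
    unfolding DERIV_shift by (simp add: has_real_derivative_iff_has_vector_derivative)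
  finally show ?thesis .
qed

lemma has_vector_derivative_reflect:
  fixes k :: "real \<Rightarrow> real"
  assumes "(k has_vector_derivative d) (at r within {0..1})"
  shows "((\<lambda>t. k (1 - t)) has_vector_derivative - d) (at (1 - r) within {0..1})"
proof -
  have "(\<lambda>t. 1 - t) ` {0..1 :: real} = {0..1}"
    by (auto simp: image_iff intro!: bexI[of _ "1 - _"])
  then have "((k \<circ> (\<lambda>t. 1 - t)) has_vector_derivative (-1) *\<^sub>R d) (at (1 - r) within {0..1})"
    using assms by (intro vector_diff_chain_within) (auto intro!: derivative_eq_intros)
  then show ?thesis by (simp add: o_def)
qed

text \<open>Near a point \<open>x < h\<close> with \<open>h \<le> 1\<close> the sets
  \<open>{0..<h}\<close> and \<open>{0..1}\<close> coincide, so they define the same filter at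
  \<open>x\<close>. The sign comes from measuring the height downwards from the upper end.\<close>

lemma has_vector_derivative_collar:
  fixes k g :: "real \<Rightarrow> real"
  assumes "h \<le> 1" "x = (if e then 1 - r else r)" "0 \<le> x" "x < h"
    "\<And>t. t \<in> {0..<h} \<Longrightarrow> g t = k (if e then 1 - t else t)"
  shows "(g has_vector_derivative d) (at x within {0..<h}) \<longleftrightarrow>
    (k has_vector_derivative (if e then - d else d)) (at r within {0..1})"
proof -
  have "at x within {0..<h} = at x within {0..1}"
    by (rule at_within_nhd[of x "{..<h}"]) (use assms in auto)
  moreover have "(g has_vector_derivative d) (at x within {0..<h}) \<longleftrightarrow>
      ((\<lambda>t. k (if e then 1 - t else t)) has_vector_derivative d) (at x within {0..<h})"
    by (rule has_vector_derivative_cong_within) (use assms(3,4,5) in auto)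
  moreover have "((\<lambda>t. k (1 - t)) has_vector_derivative d) (at (1 - r) within {0..1}) \<longleftrightarrow>
      (k has_vector_derivative - d) (at r within {0..1})"
    using has_vector_derivative_reflect[of k "-d" r]
      has_vector_derivative_reflect[of "\<lambda>t. k (1 - t)" d "1 - r"] by auto
  ultimately show ?thesis using assms(2) by (cases e) auto
qed

lemma vector_derivative_unit_interval:
  assumes "(f has_vector_derivative d) (at r within {0..1})" "0 \<le> r" "r \<le> (1::real)"
  shows "vector_derivative f (at r within {0..1}) = d"
  using assms vector_derivative_within_cbox[of 0 1 r f d] by simp

text \<open>Since this is an equivalence for every \<open>d\<close>, the choice operator behind
  \<open>vector_derivative\<close> is applied to equal predicates on both sides. Partial derivative
  and derivative along rotations thus agree whether or not they exist.\<close>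

lemma chart_derivative_angle:
  fixes f :: "(nat \<Rightarrow> real) \<Rightarrow> real"
  assumes "p \<in> fst (cch a e h)" "h \<le> 1"
  defines "x \<equiv> snd (cch a e h) p"
  shows "((\<lambda>t. f (chart_inv (cch a e h) (x(0 := t)))) has_vector_derivative d)
       (at (x 0) within coord_slice (box2 h) 0 x) \<longleftrightarrow>
     ((\<lambda>s. f (rot s p)) has_vector_derivative d) (at 0)"
proof -
  have x: "x \<in> box2 h" using cinv_coords(1)[OF assms(1)] by (simp add: x_def)
  show ?thesis unfolding slice_box2[OF x]
  proof (rule has_vector_derivative_shift_open)
    fix t assume "t \<in> {-(pi/2)<..<pi/2}"
    then have "x(0 := t) \<in> box2 h" using x by (auto simp: box2_def)
    then show "f (chart_inv (cch a e h) (x(0 := t))) = f (rot (t - x 0) p)"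
      using cinv_rot[OF assms(1), of t] by (simp add: chart_inv_cch[OF _ assms(2)] x_def)
  qed (use x in \<open>auto simp: box2_def\<close>)
qed

lemma chart_derivative_height:
  fixes f :: "(nat \<Rightarrow> real) \<Rightarrow> real"
  assumes "p \<in> fst (cch a e h)" "h \<le> 1"
  defines "x \<equiv> snd (cch a e h) p"
  shows "((\<lambda>t. f (chart_inv (cch a e h) (x(1 := t)))) has_vector_derivative d)
       (at (x 1) within coord_slice (box2 h) 1 x) \<longleftrightarrow>
     ((\<lambda>s. f (p(2 := s))) has_vector_derivative (if e then - d else d)) (at (p 2) within {0..1})"
proof -
  have x: "x \<in> box2 h" using cinv_coords(1)[OF assms(1)] by (simp add: x_def)
  show ?thesis unfolding slice_box2[OF x]
  proof (rule has_vector_derivative_collar)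
    show "x 1 = (if e then 1 - p 2 else p 2)" by (simp add: x_def hgt_def)
    fix t assume "t \<in> {0..<h}"
    then have "x(1 := t) \<in> box2 h" using x by (auto simp: box2_def)
    then show "f (chart_inv (cch a e h) (x(1 := t))) = f (p(2 := if e then 1 - t else t))"
      using cinv_height[OF assms(1), of t] by (simp add: chart_inv_cch[OF _ assms(2)] x_def)
  qed (use x assms in \<open>auto simp: box2_def\<close>)
qed

lemma smooth_near_chart:
  assumes "f \<in> smooth_near cmfd p"
  obtains T where "open T" "p \<in> T"
    "\<forall>a e k. Ck_on k 2 {x \<in> box2 1. cinv a e x \<in> T} (\<lambda>x. f (chart_inv (cch a e 1) x))"
proof -
  obtain U where U: "openin (top_of_set cyl) U" "p \<in> U"
    "\<And>c. c \<in> matlas cmfd \<Longrightarrow> smooth_on_coords 2 (snd c ` (U \<inter> fst c)) (\<lambda>x. f (chart_inv c x))"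
    using assms(1) by (auto simp: smooth_near_def)
  obtain T where T: "open T" "U = cyl \<inter> T" using U(1) by (auto simp: openin_open)
  have "Ck_on k 2 {x \<in> box2 1. cinv a e x \<in> T} (\<lambda>x. f (chart_inv (cch a e 1) x))" for a e k
  proof -
    have "cinv a e x \<in> cyl" if "x \<in> box2 1" for x
      using coords_cinv(1)[OF that, of a e] by (simp add: cch_fst)
    then have "snd (cch a e 1) ` (U \<inter> fst (cch a e 1)) = {x \<in> box2 1. cinv a e x \<in> T}"
      using image_cch_Int[of 1 a e U] T(2) by auto
    moreover have "cch a e 1 \<in> matlas cmfd" unfolding atlas_cmfd by blast
    ultimately show ?thesis using U(3)[of "cch a e 1"] unfolding smooth_on_coords_def by simp
  qed
  then show ?thesis by (intro that[of T]) (use T U(2) in auto)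
qed

text \<open>Locality of partial derivatives: smoothness near \<open>p\<close> is known on a small
  neighbourhood, while \<open>coord_vec\<close> differentiates on the whole chart image.\<close>

lemma at_within_coord_slice_Int:
  assumes "open V" "x \<in> V"
  shows "at (x i) within coord_slice (A \<inter> V) i x = at (x i) within coord_slice A i x"
proof -
  have "open ((\<lambda>t. x(i := t)) -` V)"
    using assms(1) continuous_fun_upd by (metis continuous_on_open_vimage open_UNIV inf_top_right)
  then show ?thesis
    by (intro at_within_nhd[of _ "(\<lambda>t. x(i := t)) -` V"]) (use assms(2) in \<open>auto simp: coord_slice_def\<close>)
qed

lemma Ck_on_differentiable:
  "Ck_on (Suc k) n S f \<Longrightarrow> i < n \<Longrightarrow> x \<in> S \<Longrightarrow>
    (\<lambda>t. f (x(i := t))) differentiable (at (x i) within coord_slice S i x)"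
  by simp

text \<open>Existence of the derivatives matters for the height: in a chart at the upper end the
  coordinate derivative is minus the derivative in the height, and this sign can be moved past
  \<open>vector_derivative\<close> once the derivative exists.\<close>

lemma smooth_near_differentiable:
  assumes "f \<in> smooth_near cmfd p" "p \<in> cyl"
  shows "\<exists>d. ((\<lambda>s. f (rot s p)) has_vector_derivative d) (at 0)"
    "\<exists>d. ((\<lambda>s. f (p(2 := s))) has_vector_derivative d) (at (p 2) within {0..1})"
proof -
  obtain a e where p: "p \<in> fst (cch a e 1)" using ex_cch1[OF assms(2)] by blast
  obtain T where T: "open T" "p \<in> T"
    "\<forall>a e k. Ck_on k 2 {x \<in> box2 1. cinv a e x \<in> T} (\<lambda>x. f (chart_inv (cch a e 1) x))"
    by (rule smooth_near_chart[OF assms(1)])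
  define x where "x = snd (cch a e 1) p"
  define V where "V = cinv a e -` T"
  have "open V"
    using T(1) continuous_on_cinv[of UNIV a e] unfolding V_def
    by (metis continuous_on_open_vimage open_UNIV inf_top_right)
  moreover have xV: "x \<in> V" using cinv_coords(2)[OF p] T(2) by (simp add: V_def x_def)
  ultimately have at: "at (x i) within coord_slice (box2 1 \<inter> V) i x = at (x i) within coord_slice (box2 1) i x" for i
    by (rule at_within_coord_slice_Int)
  have "{x \<in> box2 1. cinv a e x \<in> T} = box2 1 \<inter> V" by (auto simp: V_def)
  then have "Ck_on (Suc 0) 2 (box2 1 \<inter> V) (\<lambda>x. f (chart_inv (cch a e 1) x))"
    using T(3)[rule_format, of "Suc 0" a e] by (simp only:)
  note ck = Ck_on_differentiable[OF this]
  have xS: "x \<in> box2 1 \<inter> V" using cinv_coords(1)[OF p] xV by (simp add: x_def)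
  have diff: "(\<lambda>t. f (chart_inv (cch a e 1) (x(i := t)))) differentiable (at (x i) within coord_slice (box2 1) i x)"
    if "i < 2" for i
    using ck[OF that xS] unfolding at .
  have "\<exists>d. ((\<lambda>t. f (chart_inv (cch a e 1) (x(i := t)))) has_vector_derivative d) (at (x i) within coord_slice (box2 1) i x)"
    if "i < 2" for i
    using diff[OF that] unfolding vector_derivative_works by blast
  from this[of 0] this[of 1] show "\<exists>d. ((\<lambda>s. f (rot s p)) has_vector_derivative d) (at 0)"
    "\<exists>d. ((\<lambda>s. f (p(2 := s))) has_vector_derivative d) (at (p 2) within {0..1})"
    unfolding x_def chart_derivative_angle[OF p order_refl] chart_derivative_height[OF p order_refl]
    by auto
qed

lemma coord_vec_angle:
  assumes "p \<in> fst (cch a e h)" "h \<le> 1"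
  shows "coord_vec cmfd (cch a e h) 0 p = dth cmfd p"
  unfolding coord_vec_def dth_def chart_image_cch[OF assms(2)] partial_in_def vector_derivative_def
    chart_derivative_angle[OF assms] ..

lemma coord_vec_height:
  assumes "p \<in> fst (cch a e h)" "h \<le> 1"
  shows "coord_vec cmfd (cch a e h) 1 p = (\<lambda>f. (if e then -1 else 1) * drr p f)"
proof
  fix f
  define x where "x = snd (cch a e h) p"
  show "coord_vec cmfd (cch a e h) 1 p f = (if e then -1 else 1) * drr p f"
  proof (cases "f \<in> smooth_near cmfd p")
    case True
    then obtain d where d: "((\<lambda>s. f (p(2 := s))) has_vector_derivative d) (at (p 2) within {0..1})"
      using smooth_near_differentiable(2) assms(1) by (auto simp: cch_fst)
    have p: "0 \<le> p 2" "p 2 \<le> 1" using assms(1) by (auto simp: cch_fst cyl_def)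
    have "vector_derivative (\<lambda>s. f (p(2 := s))) (at (p 2) within {0..1}) = d"
      by (rule vector_derivative_unit_interval[OF d p])
    moreover have "((\<lambda>t. f (chart_inv (cch a e h) (x(1 := t)))) has_vector_derivative (if e then - d else d))
       (at (x 1) within coord_slice (box2 h) 1 x)"
      unfolding x_def chart_derivative_height[OF assms] using d by auto
    then have "partial_in (box2 h) 1 (\<lambda>x. f (chart_inv (cch a e h) x)) x = (if e then - d else d)"
      using cinv_coords(1)[OF assms(1)]
      by (intro partial_in_eqI[OF thick_half_space[OF openin_box2[OF assms(2)]]]) (auto simp: x_def)
    ultimately show ?thesis
      using True by (simp add: coord_vec_def drr_def chart_image_cch[OF assms(2)] x_def)
  qed (simp add: coord_vec_def drr_def)
qed

lemma coord_vec_bch: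
  assumes "p \<in> fst (bch a e)"
  shows "coord_vec (boundary cmfd) (bch a e) 0 p = dth (boundary cmfd) p"
proof -
  have p: "p \<in> fst (cch a e 1)" "hgt e p = 0" using assms by (auto simp: bch_fst)
  define x where "x = snd (cch a e 1) p"
  have x: "x \<in> box1" using cinv_coords(1)[OF p(1)] p(2) by (simp add: x_def box1_eq)
  have "((\<lambda>t. f (chart_inv (bch a e) (x(0 := t)))) has_vector_derivative d)
       (at (x 0) within coord_slice box1 0 x) \<longleftrightarrow>
     ((\<lambda>s. f (rot s p)) has_vector_derivative d) (at 0)" for d and f :: "(nat \<Rightarrow> real) \<Rightarrow> real"
    unfolding slice_box1[OF x]
  proof (rule has_vector_derivative_shift_open)
    fix t assume "t \<in> {-(pi/2)<..<pi/2}"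
    then have "x(0 := t) \<in> box1" using x by (auto simp: box1_def)
    then show "f (chart_inv (bch a e) (x(0 := t))) = f (rot (t - x 0) p)"
      using cinv_rot[OF p(1), of t] by (simp add: chart_inv_bch x_def)
  qed (use x in \<open>auto simp: box1_def\<close>)
  then show ?thesis
    unfolding coord_vec_def dth_def chart_image_bch partial_in_def vector_derivative_def x_def snd_bch
    by (simp only:)
qed

section \<open>Tangent spaces of the cylinder and of its boundary\<close>

lemma tangent_space_cmfd:
  assumes "p \<in> cyl"
  shows "tangent_space cmfd p = {tv p \<alpha> \<beta> | \<alpha> \<beta>. True}"
proof (intro set_eqI iffI)
  fix v assume "v \<in> tangent_space cmfd p"
  then obtain a e A where p: "p \<in> fst (cch a e 1)"
    and v: "v = (\<lambda>f. \<Sum>i<2. A i * coord_vec cmfd (cch a e 1) i p f)"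
    unfolding tangent_space_def atlas_cmfd Bex_def cmfd_simps by blast
  have "v = tv p (A 0) (if e then - A 1 else A 1)"
    using coord_vec_angle[OF p order_refl] coord_vec_height[OF p order_refl]
    by (auto simp: v tv_def numeral_2_eq_2)
  then show "v \<in> {tv p \<alpha> \<beta> | \<alpha> \<beta>. True}" by blast
next
  fix v assume "v \<in> {tv p \<alpha> \<beta> | \<alpha> \<beta>. True}"
  then obtain \<alpha> \<beta> where v: "v = tv p \<alpha> \<beta>" by blast
  obtain a e where p: "p \<in> fst (cch a e 1)" using ex_cch1[OF assms] by blast
  have "v = (\<lambda>f. \<Sum>i<2. (if i = 0 then \<alpha> else if e then - \<beta> else \<beta>) * coord_vec cmfd (cch a e 1) i p f)"
    using coord_vec_angle[OF p order_refl] coord_vec_height[OF p order_refl]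
    by (auto simp: v tv_def numeral_2_eq_2)
  then show "v \<in> tangent_space cmfd p"
    unfolding tangent_space_def mem_Collect_eq cmfd_simps
    by (intro bexI[of _ "cch a e 1"] conjI p exI) (auto simp: cmfd_def)
qed

lemma tangent_space_boundary:
  assumes "p \<in> bdry"
  shows "tangent_space (boundary cmfd) p = {btv p \<alpha> | \<alpha>. True}"
proof (intro set_eqI iffI)
  fix v assume "v \<in> tangent_space (boundary cmfd) p"
  then obtain a e A where p: "p \<in> fst (bch a e)"
    and v: "v = (\<lambda>f. \<Sum>i<1. A i * coord_vec (boundary cmfd) (bch a e) i p f)"
    unfolding tangent_space_def atlas_boundary Bex_def boundary_cmfd_simps by blast
  have "v = btv p (A 0)"
    using coord_vec_bch[OF p] by (simp add: v btv_def)
  then show "v \<in> {btv p \<alpha> | \<alpha>. True}" by blast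
next
  fix v assume "v \<in> {btv p \<alpha> | \<alpha>. True}"
  then obtain \<alpha> where v: "v = btv p \<alpha>" by blast
  obtain e where e: "hgt e p = 0" using assms by (rule bdry_cases)
  obtain a where "p \<in> fst (cch a e 1)" using ex_cch[of p e 1] bdry_subset[OF assms] e by auto
  then have p: "p \<in> fst (bch a e)" using e by (simp add: bch_fst)
  have "v = (\<lambda>f. \<Sum>i<1. \<alpha> * coord_vec (boundary cmfd) (bch a e) i p f)"
    using coord_vec_bch[OF p] by (simp add: v btv_def)
  moreover have "bch a e \<in> matlas (boundary cmfd)" unfolding atlas_boundary by blast
  ultimately show "v \<in> tangent_space (boundary cmfd) p"
    unfolding tangent_space_def mem_Collect_eq boundary_cmfd_simps
    by (intro bexI[of _ "bch a e"] conjI p exI) 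
qed

lemma smooth_nearI:
  assumes "p \<in> cyl" "\<And>a e. smooth_on_coords 2 (box2 1) (\<lambda>x. f (cinv a e x))"
  shows "f \<in> smooth_near cmfd p"
proof -
  have "smooth_on_coords 2 (snd c ` (cyl \<inter> fst c)) (\<lambda>x. f (chart_inv c x))" if c: "c \<in> matlas cmfd" for c
  proof -
    obtain a e where c: "c = cch a e 1" using iffD1[OF atlas_cmfd c] by blast
    have "snd c ` (cyl \<inter> fst c) = box2 1"
      using chart_image_cch[of 1 a e] by (simp add: c chart_image_def cch_def Int_absorb1 subset_iff)
    moreover have "smooth_on_coords 2 (box2 1) (\<lambda>x. f (chart_inv c x)) = smooth_on_coords 2 (box2 1) (\<lambda>x. f (cinv a e x))"
      by (rule smooth_on_coords_cong) (simp add: c chart_inv_cch)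
    ultimately show ?thesis using assms(2) by simp
  qed
  then show ?thesis using assms(1) unfolding smooth_near_def
    by (auto intro!: exI[of _ cyl] simp del: split_paired_All)
qed

lemma thick_box2: "h \<le> 1 \<Longrightarrow> thick 2 (box2 h)"
  by (rule thick_half_space[OF openin_box2])

lemma smooth_near_coord:
  assumes "p \<in> cyl"
  shows "(\<lambda>q. q 0) \<in> smooth_near cmfd p" "(\<lambda>q. q 1) \<in> smooth_near cmfd p" "hgt e \<in> smooth_near cmfd p"
    "(\<lambda>q. q 2) \<in> smooth_near cmfd p"
proof -
  note sm = smooth_on_coords_coordinate[OF thick_box2[OF order_refl], where T = UNIV]
  show "(\<lambda>q. q 0) \<in> smooth_near cmfd p"
    using sm[of 0, OF _ smooth_real_cos] by (intro smooth_nearI[OF assms]) (simp add: cinv_def)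
  show "(\<lambda>q. q 1) \<in> smooth_near cmfd p"
    using sm[of 0, OF _ smooth_real_sin] by (intro smooth_nearI[OF assms]) (simp add: cinv_def)
  have h: "hgt e \<in> smooth_near cmfd p" for e
  proof (rule smooth_nearI[OF assms])
    fix a e'
    show "smooth_on_coords 2 (box2 1) (\<lambda>x. hgt e (cinv a e' x))"
      using sm[of 1, OF _ smooth_real_affine[of UNIV 0 1]] sm[of 1, OF _ smooth_real_affine[of UNIV 1 "-1"]]
      by (cases e; cases e') (simp_all add: hgt_def cinv_def)
  qed
  show "hgt e \<in> smooth_near cmfd p" by (rule h)
  have "hgt False = (\<lambda>q. q 2)" by (auto simp: hgt_def)
  then show "(\<lambda>q. q 2) \<in> smooth_near cmfd p" using h[of False] by simp
qed

text \<open>The ambient coordinates as test functions recover both components of a tangent vector.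
  This makes the components unique and evaluates \<open>cmet\<close>, which is written in terms of
  these test functions; \<open>hgt e\<close> tests the inward direction at an end.\<close>

lemma tv_coord:
  assumes "p \<in> cyl"
  shows "tv p \<alpha> \<beta> (\<lambda>q. q 0) = - \<alpha> * p 1" "tv p \<alpha> \<beta> (\<lambda>q. q (Suc 0)) = \<alpha> * p 0"
    "tv p \<alpha> \<beta> (\<lambda>q. q 2) = \<beta>" "tv p \<alpha> \<beta> (hgt e) = (if e then - \<beta> else \<beta>)"
proof -
  have p: "0 \<le> p 2" "p 2 \<le> 1" using assms by (auto simp: cyl_def)
  note n = smooth_near_coord[OF assms, unfolded One_nat_def]
  have "((\<lambda>s. rot s p 0) has_vector_derivative - p 1) (at 0)"
    "((\<lambda>s. rot s p (Suc 0)) has_vector_derivative p 0) (at 0)"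
    "((\<lambda>s. rot s p 2) has_vector_derivative 0) (at 0)"
    "((\<lambda>s. hgt e (rot s p)) has_vector_derivative 0) (at 0)"
    unfolding has_real_derivative_iff_has_vector_derivative[symmetric] hgt_def
    by (cases e; auto intro!: derivative_eq_intros)+
  note * = this[THEN vector_derivative_at]
  have "((\<lambda>s. (p(2 := s)) 0) has_vector_derivative 0) (at (p 2) within {0..1})"
    "((\<lambda>s. (p(2 := s)) (Suc 0)) has_vector_derivative 0) (at (p 2) within {0..1})"
    "((\<lambda>s. (p(2 := s)) 2) has_vector_derivative 1) (at (p 2) within {0..1})"
    "((\<lambda>s. hgt e (p(2 := s))) has_vector_derivative (if e then -1 else 1)) (at (p 2) within {0..1})"
    unfolding has_real_derivative_iff_has_vector_derivative[symmetric] hgt_def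
    by (cases e; auto intro!: derivative_eq_intros)+
  note ** = this[THEN vector_derivative_unit_interval[OF _ p]]
  show "tv p \<alpha> \<beta> (\<lambda>q. q 0) = - \<alpha> * p 1" "tv p \<alpha> \<beta> (\<lambda>q. q (Suc 0)) = \<alpha> * p 0"
    "tv p \<alpha> \<beta> (\<lambda>q. q 2) = \<beta>" "tv p \<alpha> \<beta> (hgt e) = (if e then - \<beta> else \<beta>)"
    unfolding tv_def dth_def drr_def using n * ** by simp_all
qed

lemma tv_inj:
  assumes "p \<in> cyl" "tv p \<alpha> \<beta> = tv p \<alpha>' \<beta>'"
  shows "\<alpha> = \<alpha>' \<and> \<beta> = \<beta>'"
proof -
  have "\<alpha> * p 1 = \<alpha>' * p 1" "\<alpha> * p 0 = \<alpha>' * p 0"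
    using tv_coord(1,2)[OF assms(1)] assms(2) by (metis mult_minus_left neg_equal_iff_equal, metis)
  moreover have "p 0 \<noteq> 0 \<or> p 1 \<noteq> 0" using assms(1) by (auto simp: cyl_def)
  moreover have "\<beta> = \<beta>'" using tv_coord(3)[OF assms(1)] assms(2) by metis
  ultimately show ?thesis by auto
qed

text \<open>\<open>push\<close> cuts off precisely the functions that are not smooth on the
  cylinder, as \<open>tv\<close> does; the remaining ones are smooth on the boundary by
  \<open>smooth_near_boundary\<close>, so the cut-off inside \<open>btv\<close> does not
  interfere.\<close>

lemma push_btv:
  assumes "p \<in> bdry"
  shows "push cmfd p id (btv p \<alpha>) = tv p \<alpha> 0"
  using smooth_near_boundary[OF _ assms]
  by (auto simp: push_def btv_def tv_def dth_def fun_eq_iff)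

lemma push_id_btv: "push (boundary cmfd) p id (btv p \<alpha>) = btv p \<alpha>"
  by (auto simp: push_def btv_def dth_def fun_eq_iff)

section \<open>Warped metrics on the cylinder\<close>

text \<open>The metric \<open>dr\<^sup>2 + G(r) d\<theta>\<^sup>2\<close>, written as the pull-back of \<open>dr\<^sup>2 + G(r) (dx\<^sup>2 + dy\<^sup>2)\<close>.\<close>

definition cmet :: "(real \<Rightarrow> real) \<Rightarrow> (nat \<Rightarrow> real) metric" where
  "cmet G p u v = u (\<lambda>q. q 2) * v (\<lambda>q. q 2)
     + G (p 2) * (u (\<lambda>q. q 0) * v (\<lambda>q. q 0) + u (\<lambda>q. q 1) * v (\<lambda>q. q 1))"

lemma cmet_tv:
  assumes "p \<in> cyl"
  shows "cmet G p (tv p \<alpha> \<beta>) (tv p \<alpha>' \<beta>') = \<beta> * \<beta>' + G (p 2) * \<alpha> * \<alpha>'"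
proof -
  have "p 0 * p 0 + p (Suc 0) * p (Suc 0) = 1"
    using assms by (simp add: cyl_def power2_eq_square)
  then have "\<alpha> * p (Suc 0) * (\<alpha>' * p (Suc 0)) + \<alpha> * p 0 * (\<alpha>' * p 0) = \<alpha> * \<alpha>'"
    by algebra
  then show ?thesis using tv_coord[OF assms] by (simp add: cmet_def)
qed

lemma coord_vec_tv:
  assumes "p \<in> fst (cch a e h)" "h \<le> 1"
  shows "coord_vec cmfd (cch a e h) 0 p = tv p 1 0"
    "coord_vec cmfd (cch a e h) 1 p = tv p 0 (if e then -1 else 1)"
  using coord_vec_angle[OF assms] coord_vec_height[OF assms] by (auto simp: tv_def)

lemma metric_coeff_cmet:
  assumes "x \<in> box2 h" "h \<le> 1" "i < 2" "j < 2"
  shows "metric_coeff cmfd (cmet G) (cch a e h) i j x =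
    (if i \<noteq> j then 0 else if i = 0 then G (if e then 1 - x 1 else x 1) else 1)"
proof -
  have p: "cinv a e x \<in> fst (cch a e h)" by (rule coords_cinv(1)[OF assms(1,2)])
  then have "cinv a e x \<in> cyl" by (simp add: cch_fst)
  moreover have "cinv a e x 2 = (if e then 1 - x 1 else x 1)" by (simp add: cinv_def)
  moreover have "i = 0 \<or> i = 1" "j = 0 \<or> j = 1" using assms(3,4) by auto
  ultimately show ?thesis
    unfolding metric_coeff_def Let_def chart_inv_cch[OF assms(1,2)]
    using coord_vec_tv[OF p assms(2)] by (auto simp: cmet_tv)
qed

definition warp_deriv :: "(real \<Rightarrow> real) \<Rightarrow> bool \<Rightarrow> (nat \<Rightarrow> real) \<Rightarrow> real" where
  "warp_deriv G e x = (if e then - deriv G (1 - x 1) else deriv G (x 1))"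

text \<open>The properties common to the two warping functions. The value 1 at the ends gives all
  such metrics the same boundary metric, and the lower bound 1 excludes turning points of entering
  geodesics and makes lengths at least Euclidean.\<close>

locale profile =
  fixes G :: "real \<Rightarrow> real"
  assumes smooth: "smooth_real UNIV G"
    and ge_1: "\<And>r. 0 \<le> r \<Longrightarrow> r \<le> 1 \<Longrightarrow> 1 \<le> G r"
    and at_0 [simp]: "G 0 = 1" and at_1 [simp]: "G 1 = 1"
begin

lemma has_deriv: "(G has_real_derivative deriv G r) (at r)"
  using smooth unfolding smooth_real_def by (metis DERIV_imp_deriv UNIV_I)

lemma pos: "p \<in> cyl \<Longrightarrow> 1 \<le> G (p 2)"
  using ge_1 by (simp add: cyl_def)

lemma partial_metric_coeff:
  assumes "x \<in> box2 h" "h \<le> 1" "i < 2" "j < 2" "l < 2"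
  shows "partial_in (box2 h) l (metric_coeff cmfd (cmet G) (cch a e h) i j) x =
    (if i = 0 \<and> j = 0 \<and> l = 1 then warp_deriv G e x else 0)"
proof -
  let ?g = "\<lambda>x. if i \<noteq> j then 0 else if i = 0 then G (if e then 1 - x 1 else x 1) else 1"
  have "partial_in (box2 h) l (metric_coeff cmfd (cmet G) (cch a e h) i j) x = partial_in (box2 h) l ?g x"
    by (rule partial_in_cong[OF _ assms(1)]) (use metric_coeff_cmet assms in auto)
  also have "\<dots> = (if i = 0 \<and> j = 0 \<and> l = 1 then warp_deriv G e x else 0)"
  proof (rule partial_in_eqI[OF thick_box2[OF assms(2)] assms(1,5)])
    have "((\<lambda>t. G (1 - t)) has_real_derivative - deriv G (1 - t)) (at t within A)" for t A
    proof -
      have "((\<lambda>t. 1 - t) has_real_derivative -1) (at t within A)"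
        by (auto intro!: derivative_eq_intros)
      from DERIV_chain2[OF has_deriv this] show ?thesis by simp
    qed
    moreover have "(G has_real_derivative deriv G t) (at t within A)" for t A
      using has_deriv by (rule has_field_derivative_at_within)
    ultimately show "((\<lambda>t. ?g (x(l := t))) has_vector_derivative
        (if i = 0 \<and> j = 0 \<and> l = 1 then warp_deriv G e x else 0)) (at (x l) within coord_slice (box2 h) l x)"
      unfolding has_real_derivative_iff_has_vector_derivative[symmetric] warp_deriv_def
      by (cases "i = j"; cases "i = 0"; cases "l = 1"; cases e; simp)
  qed
  finally show ?thesis .
qed

lemma smooth_metric_coeff:
  assumes "h \<le> 1" "i < 2" "j < 2"
  shows "smooth_on_coords 2 (box2 h) (metric_coeff cmfd (cmet G) (cch a e h) i j)"
proof -
  have "smooth_on_coords 2 (box2 h)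
     (\<lambda>x. if i \<noteq> j then 0 else if i = 0 then G (if e then 1 - x 1 else x 1) else 1)"
    using smooth_on_coords_coordinate[OF thick_box2[OF assms(1)], of 1 UNIV G]
      smooth_on_coords_coordinate[OF thick_box2[OF assms(1)], of 1 UNIV "\<lambda>t. G (1 - t)"]
      smooth_real_compose_affine[OF smooth, of UNIV 1 "-1"] smooth
      smooth_on_coords_const[OF thick_box2[OF assms(1)]]
    by (cases "i = j"; cases "i = 0"; cases e; simp)
  moreover have "smooth_on_coords 2 (box2 h) (metric_coeff cmfd (cmet G) (cch a e h) i j) \<longleftrightarrow>
      smooth_on_coords 2 (box2 h)
     (\<lambda>x. if i \<noteq> j then 0 else if i = 0 then G (if e then 1 - x 1 else x 1) else 1)"
    by (rule smooth_on_coords_cong) (use metric_coeff_cmet assms in auto)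
  ultimately show ?thesis by simp
qed

lemma riemannian_manifold_cmet: "riemannian_manifold cmfd (cmet G)"
proof -
  have pos: "0 < cmet G p v v" if p: "p \<in> cyl" and vt: "v \<in> tangent_space cmfd p" and v0: "v \<noteq> (\<lambda>f. 0)" for p v
  proof -
    obtain \<alpha> \<beta> where v: "v = tv p \<alpha> \<beta>" using vt tangent_space_cmfd[OF p] by auto
    have "\<alpha> \<noteq> 0 \<or> \<beta> \<noteq> 0" using v0 by (auto simp: v tv_def)
    then have "0 < \<beta>\<^sup>2 + G (p 2) * \<alpha>\<^sup>2"
      using pos[OF p] by (cases "\<alpha> = 0") (auto intro!: add_nonneg_pos)
    then show ?thesis by (simp add: v cmet_tv[OF p] power2_eq_square mult.assoc)
  qed
  have "smooth_on_coords 2 (chart_image c) (metric_coeff cmfd (cmet G) c i j)"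
    if cin: "c \<in> matlas cmfd" and ij: "i < 2" "j < 2" for c i j
  proof -
    obtain a e where "c = cch a e 1" using iffD1[OF atlas_cmfd cin] by blast
    then show ?thesis using smooth_metric_coeff[of 1 i j a e] ij chart_image_cch[of 1 a e] by simp
  qed
  then show ?thesis
    unfolding riemannian_manifold_def riemannian_metric_def
    using smooth_manifold_cmfd pos by (simp add: cmet_def algebra_simps)
qed

lemma boundary_metric_btv:
  assumes "p \<in> bdry"
  shows "boundary_metric cmfd (cmet G) p (btv p \<alpha>) (btv p \<beta>) = \<alpha> * \<beta>"
proof -
  have "G (p 2) = 1" using assms by (auto simp: bdry_def)
  then show ?thesis
    by (simp add: boundary_metric_def push_btv[OF assms] cmet_tv[OF bdry_subset[OF assms]])
qed

text \<open>Orthogonality to the boundary removes the angular component, unit length leaves two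
  vertical vectors, and the last coordinate of a boundary chart selects the sign. Any such chart
  belongs to the same end \<open>e\<close>, because no point has height 0 over both ends.\<close>

lemma inward_normal_cmet:
  assumes "p \<in> bdry" "hgt e p = 0"
  shows "inward_normal cmfd (cmet G) p = tv p 0 (if e then -1 else 1)"
  unfolding inward_normal_def
proof (rule the_equality)
  have p: "p \<in> cyl" using assms(1) by (rule bdry_subset)
  have G: "G (p 2) = 1" using assms(1) by (auto simp: bdry_def)
  obtain a where a: "p \<in> fst (cch a e 1)" using ex_cch[of p e 1] p assms(2) by auto
  have snd1: "(\<lambda>q. snd (cch a' e' 1) q (mdim cmfd - 1)) = hgt e'" for a' e' by auto
  let ?v = "tv p 0 (if e then -1 else 1)"
  show "?v \<in> tangent_space cmfd p \<and> cmet G p ?v ?v = 1 \<and>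
     (\<forall>w\<in>tangent_space (boundary cmfd) p. cmet G p ?v (push cmfd p id w) = 0) \<and>
     (\<exists>c. boundary_chart_at cmfd c p \<and> 0 < ?v (\<lambda>q. snd c q (mdim cmfd - 1)))"
  proof (intro conjI exI)
    show "?v \<in> tangent_space cmfd p" using tangent_space_cmfd[OF p] by auto
    show "\<forall>w\<in>tangent_space (boundary cmfd) p. cmet G p ?v (push cmfd p id w) = 0"
      using tangent_space_boundary[OF assms(1)] by (auto simp: push_btv[OF assms(1)] cmet_tv[OF p])
    show "boundary_chart_at cmfd (cch a e 1) p"
      unfolding boundary_chart_at_cmfd using a assms(2) by blast
    show "0 < ?v (\<lambda>q. snd (cch a e 1) q (mdim cmfd - 1))"
      unfolding snd1 by (simp add: tv_coord[OF p])
  qed (auto simp: cmet_tv[OF p])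
  fix v
  assume v: "v \<in> tangent_space cmfd p \<and> cmet G p v v = 1 \<and>
     (\<forall>w\<in>tangent_space (boundary cmfd) p. cmet G p v (push cmfd p id w) = 0) \<and>
     (\<exists>c. boundary_chart_at cmfd c p \<and> 0 < v (\<lambda>q. snd c q (mdim cmfd - 1)))"
  obtain \<alpha> \<beta> where v': "v = tv p \<alpha> \<beta>" using v tangent_space_cmfd[OF p] by auto
  have "btv p 1 \<in> tangent_space (boundary cmfd) p" using tangent_space_boundary[OF assms(1)] by auto
  then have "cmet G p v (push cmfd p id (btv p 1)) = 0" using v by blast
  then have \<alpha>: "\<alpha> = 0" by (simp add: v' push_btv[OF assms(1)] cmet_tv[OF p] G)
  then have "\<beta> * \<beta> = 1" using v by (simp add: v' cmet_tv[OF p])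
  then have \<beta>: "\<beta> = 1 \<or> \<beta> = -1" using square_eq_1_iff by blast
  obtain c where c: "boundary_chart_at cmfd c p" "0 < v (\<lambda>q. snd c q (mdim cmfd - 1))" using v by blast
  obtain a' e' where c': "c = cch a' e' 1" "hgt e' p = 0"
    using iffD1[OF boundary_chart_at_cmfd c(1)] by blast
  have "e' = e" using c'(2) assms(2) by (auto simp: hgt_def split: if_splits)
  then have "0 < v (hgt e)" using c(2) snd1 by (simp add: c'(1))
  then have "\<beta> = (if e then -1 else 1)" using \<beta> by (auto simp: v' tv_coord[OF p] split: if_splits)
  then show "v = ?v" by (simp add: v' \<alpha>)
qed

lemma tangential_part_cmet:
  assumes "p \<in> bdry"
  shows "tangential_part cmfd (cmet G) (p, tv p \<alpha> \<beta>) = (p, btv p \<alpha>)"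
proof -
  obtain e where e: "hgt e p = 0" using assms by (rule bdry_cases)
  have p: "p \<in> cyl" using assms by (rule bdry_subset)
  let ?n = "inward_normal cmfd (cmet G) p"
  have "(\<lambda>f. tv p \<alpha> \<beta> f - cmet G p (tv p \<alpha> \<beta>) ?n * ?n f) = tv p \<alpha> 0"
    unfolding inward_normal_cmet[OF assms e] cmet_tv[OF p] by (auto simp: tv_def)
  moreover have "(THE w. w \<in> tangent_space (boundary cmfd) p \<and> push cmfd p id w = tv p \<alpha> 0) = btv p \<alpha>"
  proof (rule the_equality)
    fix w assume "w \<in> tangent_space (boundary cmfd) p \<and> push cmfd p id w = tv p \<alpha> 0"
    then show "w = btv p \<alpha>"
      by (auto simp: tangent_space_boundary[OF assms] push_btv[OF assms] dest: tv_inj[OF p])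
  qed (auto simp: tangent_space_boundary[OF assms] push_btv[OF assms])
  ultimately show ?thesis by (simp add: tangential_part_def)
qed

end

lemma isometry_boundary:
  assumes "profile G" "profile H"
  shows "isometry (boundary cmfd) (boundary_metric cmfd (cmet G))
    (boundary cmfd) (boundary_metric cmfd (cmet H)) id"
proof -
  interpret G: profile G by fact
  interpret H: profile H by fact
  \<comment> \<open>Stated for every \<open>F\<close> that fixes the boundary pointwise, so as to
    cover the inverse map \<open>inv_into bdry id\<close> as well, which is determined on
    \<open>bdry\<close> only.\<close>
  have sm: "smooth_map (boundary cmfd) (boundary cmfd) F" if F: "\<And>p. p \<in> bdry \<Longrightarrow> F p = p" for F
    unfolding smooth_map_def
  proof (intro conjI ballI allI impI)
    have "continuous_on bdry F" using F by (simp cong: continuous_on_cong)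
    then show "continuous_map (mtop (boundary cmfd)) (mtop (boundary cmfd)) F"
      using F by simp
    fix c d and i :: nat
    assume c: "c \<in> matlas (boundary cmfd)" and d: "d \<in> matlas (boundary cmfd)"
      and i: "i < mdim (boundary cmfd)"
    obtain a e where c: "c = bch a e" using iffD1[OF atlas_boundary c] by blast
    obtain a' e' where d: "d = bch a' e'" using iffD1[OF atlas_boundary d] by blast
    have dom: "fst c \<inter> F -` fst d = fst c \<inter> fst d" using F by (auto simp: c bch_def)
    have "chart_inv c x \<in> bdry" if "x \<in> snd c ` (fst c \<inter> fst d)" for x
    proof -
      have "x \<in> box1" using that image_bch_Int[of a e "fst d"] by (auto simp: c Int_commute)
      then show ?thesis using coords_cinv_bch[of x a e] by (simp add: c chart_inv_bch) (simp add: bch_def)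
    qed
    then have "smooth_on_coords 1 (snd c ` (fst c \<inter> fst d)) (\<lambda>x. snd d (F (chart_inv c x)) i) \<longleftrightarrow>
        smooth_on_coords 1 (snd c ` (fst c \<inter> fst d)) (\<lambda>x. snd d (chart_inv c x) i)"
      by (intro smooth_on_coords_cong) (simp add: F)
    then show "smooth_on_coords (mdim (boundary cmfd)) (snd c ` (fst c \<inter> F -` fst d))
        (\<lambda>x. snd d (F (chart_inv c x)) i)"
      using smooth_transition_bch[of a e a' e'] i unfolding dom smooth_transition_def
      by (simp add: c d)
  qed
  have "inv_into bdry id p = p" if "p \<in> bdry" for p
    using that inv_into_f_f[of id bdry p] by simp
  moreover have "boundary_metric cmfd (cmet H) p (push (boundary cmfd) p id v) (push (boundary cmfd) p id w)
      = boundary_metric cmfd (cmet G) p v w"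
    if "p \<in> bdry" "v \<in> tangent_space (boundary cmfd) p" "w \<in> tangent_space (boundary cmfd) p" for p v w
    using that(2,3)
    by (auto simp: tangent_space_boundary[OF that(1)] push_id_btv G.boundary_metric_btv[OF that(1)]
        H.boundary_metric_btv[OF that(1)])
  ultimately show ?thesis
    unfolding isometry_def using sm by auto
qed

section \<open>Curves and geodesics on the cylinder\<close>

text \<open>A curve with angular velocity \<open>\<omega>\<close> and vertical velocity \<open>\<rho>\<close>.\<close>

definition moves :: "real set \<Rightarrow> (real \<Rightarrow> nat \<Rightarrow> real) \<Rightarrow> (real \<Rightarrow> real) \<Rightarrow> (real \<Rightarrow> real) \<Rightarrow> bool" where
  "moves J \<gamma> \<omega> \<rho> \<longleftrightarrow> (\<forall>t\<in>J. \<gamma> t \<in> cyl \<and>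
     ((\<lambda>s. \<gamma> s 0) has_real_derivative - (\<gamma> t 1 * \<omega> t)) (at t within J) \<and>
     ((\<lambda>s. \<gamma> s 1) has_real_derivative \<gamma> t 0 * \<omega> t) (at t within J) \<and>
     ((\<lambda>s. \<gamma> s 2) has_real_derivative \<rho> t) (at t within J))"

lemma movesD:
  assumes "moves J \<gamma> \<omega> \<rho>" "t \<in> J"
  shows "\<gamma> t \<in> cyl"
    "((\<lambda>s. \<gamma> s 0) has_real_derivative - (\<gamma> t 1 * \<omega> t)) (at t within J)"
    "((\<lambda>s. \<gamma> s 1) has_real_derivative \<gamma> t 0 * \<omega> t) (at t within J)"
    "((\<lambda>s. \<gamma> s (Suc 0)) has_real_derivative \<gamma> t 0 * \<omega> t) (at t within J)"
    "((\<lambda>s. \<gamma> s 2) has_real_derivative \<rho> t) (at t within J)"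
  using assms by (auto simp: moves_def)

lemma moves_continuous:
  assumes "moves J \<gamma> \<omega> \<rho>"
  shows "continuous_on J \<gamma>"
proof (rule continuous_on_coordinatewise_then_product)
  fix i :: nat
  consider "i = 0" | "i = 1" | "i = 2" | "i \<ge> 3" by linarith
  then show "continuous_on J (\<lambda>t. \<gamma> t i)"
  proof cases
    case 4
    then have "\<gamma> t i = 0" if "t \<in> J" for t using movesD(1)[OF assms that] by (simp add: cyl_def)
    then show ?thesis by (simp cong: continuous_on_cong)
  qed (use movesD(2,3,5)[OF assms] in \<open>auto intro!: DERIV_continuous_on\<close>)
qed

lemma vector_derivative_Icc:
  assumes "(f has_real_derivative d) (at t within {l..u})" "t \<in> {l..u}" "l < (u::real)"
  shows "vector_derivative f (at t within {l..u}) = d"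
  using assms vector_derivative_within_cbox[of l u t f d]
  by (simp add: has_real_derivative_iff_has_vector_derivative)

lemma eventually_in_cch:
  assumes "continuous_on J \<gamma>" "\<gamma> ` J \<subseteq> cyl" "t \<in> J" "\<gamma> t \<in> fst (cch a e h)"
  shows "\<forall>\<^sub>F s in at t within J. \<gamma> s \<in> fst (cch a e h)"
proof -
  obtain W where W: "open W" "fst (cch a e h) = cyl \<inter> W"
    using openin_cch[of a e h] by (auto simp: openin_open)
  have "(\<gamma> \<longlongrightarrow> \<gamma> t) (at t within J)" using assms(1,3) by (simp add: continuous_on_def)
  then have "\<forall>\<^sub>F s in at t within J. \<gamma> s \<in> W"
    using W assms(4) by (auto dest: topological_tendstoD)
  moreover have "\<forall>\<^sub>F s in at t within J. s \<in> J" by (simp add: eventually_at_filter)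
  ultimately show ?thesis
    by eventually_elim (use assms(2) W(2) in auto)
qed

text \<open>Since \<open>c c' + s s' = 0\<close> for \<open>c = x cos a + y sin a\<close> and \<open>s = y cos a - x sin a\<close>, the derivative of
  \<open>arcsin s\<close> is the angular velocity.\<close>

lemma chart_velocity:
  assumes m: "moves J \<gamma> \<omega> \<rho>" and t: "t \<in> J" and c: "\<gamma> t \<in> fst (cch a e h)"
  shows "((\<lambda>r. snd (cch a e h) (\<gamma> r) 0) has_real_derivative \<omega> t) (at t within J)"
    "((\<lambda>r. snd (cch a e h) (\<gamma> r) 1) has_real_derivative (if e then - \<rho> t else \<rho> t)) (at t within J)"
proof -
  define c0 s0 where "c0 = \<gamma> t 0 * cos a + \<gamma> t 1 * sin a" and "s0 = \<gamma> t 1 * cos a - \<gamma> t 0 * sin a"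
  have "0 < c0" "\<gamma> t \<in> cyl" using c by (auto simp: cch_fst c0_def)
  then have cs: "c0\<^sup>2 + s0\<^sup>2 = 1" using rotated_sq[of "\<gamma> t 0" "\<gamma> t 1" a] by (simp add: c0_def s0_def cyl_def)
  note f = arcsin_facts[OF cs \<open>0 < c0\<close>]
  have "s0\<^sup>2 < 1" using cs \<open>0 < c0\<close> by (smt (verit) zero_less_power)
  then have "\<bar>s0\<bar> < 1" by (simp add: abs_square_less_1)
  then have s1: "-1 < s0" "s0 < 1" by auto
  have sq: "sqrt (1 - s0\<^sup>2) = c0"
    using f(1) cos_arcsin[of s0] s1 by simp
  have "((\<lambda>r. \<gamma> r 1 * cos a - \<gamma> r 0 * sin a) has_real_derivative
      \<gamma> t 0 * \<omega> t * cos a - - (\<gamma> t 1 * \<omega> t) * sin a) (at t within J)"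
    by (intro DERIV_diff DERIV_cmult_right movesD[OF m t])
  then have "((\<lambda>r. \<gamma> r 1 * cos a - \<gamma> r 0 * sin a) has_real_derivative c0 * \<omega> t) (at t within J)"
    by (simp add: c0_def algebra_simps)
  moreover have "(arcsin has_real_derivative inverse c0) (at s0)"
    using DERIV_arcsin[OF s1] by (simp add: sq)
  ultimately have "((\<lambda>r. arcsin (\<gamma> r 1 * cos a - \<gamma> r 0 * sin a)) has_real_derivative inverse c0 * (c0 * \<omega> t)) (at t within J)"
    unfolding s0_def by (intro DERIV_chain2[where f = arcsin])
  then show "((\<lambda>r. snd (cch a e h) (\<gamma> r) 0) has_real_derivative \<omega> t) (at t within J)"
    using \<open>0 < c0\<close> by (simp add: mult.assoc[symmetric])
  have "((\<lambda>r. 1 - \<gamma> r 2) has_real_derivative 0 - \<rho> t) (at t within J)"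
    by (intro DERIV_diff DERIV_const movesD[OF m t])
  then show "((\<lambda>r. snd (cch a e h) (\<gamma> r) 1) has_real_derivative (if e then - \<rho> t else \<rho> t)) (at t within J)"
    using movesD(5)[OF m t] by (cases e) (auto simp: hgt_def)
qed

text \<open>At each time the two rates are read off in some chart around the point. Transported by
  \<open>cinv\<close> to the ambient coordinates they satisfy the chart-free equations of
  \<open>moves\<close>, so choosing them separately for each time is harmless.\<close>

lemma movesI_chart:
  assumes cont: "continuous_on J \<gamma>" and cyl: "\<gamma> ` J \<subseteq> cyl"
    and diff: "\<And>a e t k. t \<in> J \<Longrightarrow> \<gamma> t \<in> fst (cch a e 1) \<Longrightarrow> k < 2 \<Longrightarrow>
      (\<lambda>s. snd (cch a e 1) (\<gamma> s) k) differentiable (at t within J)"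
  shows "\<exists>\<omega> \<rho>. moves J \<gamma> \<omega> \<rho>"
proof -
  have "\<exists>w r. ((\<lambda>s. \<gamma> s 0) has_real_derivative - (\<gamma> t 1 * w)) (at t within J) \<and>
     ((\<lambda>s. \<gamma> s 1) has_real_derivative \<gamma> t 0 * w) (at t within J) \<and>
     ((\<lambda>s. \<gamma> s 2) has_real_derivative r) (at t within J)" if t: "t \<in> J" for t
  proof -
    obtain a e where c: "\<gamma> t \<in> fst (cch a e 1)" using ex_cch1[of "\<gamma> t"] cyl t by blast
    define x where "x = (\<lambda>s. snd (cch a e 1) (\<gamma> s))"
    obtain w where w: "((\<lambda>s. x s 0) has_real_derivative w) (at t within J)"
      using diff[OF t c, of 0] unfolding real_differentiable_def x_def by auto
    obtain r where r: "((\<lambda>s. x s 1) has_real_derivative r) (at t within J)"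
      using diff[OF t c, of 1] unfolding real_differentiable_def x_def by auto
    have ev: "\<forall>\<^sub>F s in at t within J. \<gamma> s = cinv a e (x s)"
      using eventually_in_cch[OF cont cyl t c]
      by eventually_elim (simp add: x_def cinv_coords(2))
    have eq: "\<gamma> t = cinv a e (x t)" using cinv_coords(2)[OF c] by (simp add: x_def)
    have "((\<lambda>s. cinv a e (x s) 0) has_real_derivative - (\<gamma> t 1 * w)) (at t within J)"
      unfolding eq cinv_def using w by (auto intro!: derivative_eq_intros)
    moreover have "((\<lambda>s. cinv a e (x s) 1) has_real_derivative \<gamma> t 0 * w) (at t within J)"
      unfolding eq cinv_def using w by (auto intro!: derivative_eq_intros)
    moreover have "((\<lambda>s. cinv a e (x s) 2) has_real_derivative (if e then - r else r)) (at t within J)"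
      unfolding cinv_def using r by (cases e) (auto intro!: derivative_eq_intros)
    moreover have "((\<lambda>s. \<gamma> s i) has_real_derivative d) (at t within J) \<longleftrightarrow>
        ((\<lambda>s. cinv a e (x s) i) has_real_derivative d) (at t within J)" for i d
      by (rule has_field_derivative_cong_eventually)
         (use ev eq in \<open>auto elim: eventually_mono\<close>)
    ultimately show ?thesis by blast
  qed
  then have "\<forall>t\<in>J. \<exists>w r. ((\<lambda>s. \<gamma> s 0) has_real_derivative - (\<gamma> t 1 * w)) (at t within J) \<and>
     ((\<lambda>s. \<gamma> s 1) has_real_derivative \<gamma> t 0 * w) (at t within J) \<and>
     ((\<lambda>s. \<gamma> s 2) has_real_derivative r) (at t within J)" by blast
  then obtain \<omega> \<rho> where "\<forall>t\<in>J. ((\<lambda>s. \<gamma> s 0) has_real_derivative - (\<gamma> t 1 * \<omega> t)) (at t within J) \<and>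
     ((\<lambda>s. \<gamma> s 1) has_real_derivative \<gamma> t 0 * \<omega> t) (at t within J) \<and>
     ((\<lambda>s. \<gamma> s 2) has_real_derivative \<rho> t) (at t within J)"
    by (elim bchoice[THEN exE] bchoice) (metis (no_types, lifting))
  then show ?thesis using cyl unfolding moves_def by blast
qed

lemma coord_deriv_cch:
  assumes "moves {l..u} \<gamma> \<omega> \<rho>" "l < u" "t \<in> {l..u}" "\<gamma> t \<in> fst (cch a e h)"
  shows "coord_deriv (cch a e h) {l..u} \<gamma> 0 t = \<omega> t"
    "coord_deriv (cch a e h) {l..u} \<gamma> 1 t = (if e then - \<rho> t else \<rho> t)"
  unfolding coord_deriv_def
  by (rule vector_derivative_Icc[OF chart_velocity(1)[OF assms(1,3,4)] assms(3,2)],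
      rule vector_derivative_Icc[OF chart_velocity(2)[OF assms(1,3,4)] assms(3,2)])

text \<open>Agreement near \<open>t\<close> and not just at \<open>t\<close> is required to
  differentiate \<open>coord_deriv\<close> once more, or to speak of its continuity. It holds
  because the curve stays in the open chart domain for a while; outside, the chart formula is not an
  angle coordinate.\<close>

lemma eventually_coord_deriv:
  assumes "moves {l..u} \<gamma> \<omega> \<rho>" "l < u" "t \<in> {l..u}" "\<gamma> t \<in> fst (cch a e h)"
  shows "\<forall>\<^sub>F s in at t within {l..u}. coord_deriv (cch a e h) {l..u} \<gamma> 0 s = \<omega> s"
    "\<forall>\<^sub>F s in at t within {l..u}. coord_deriv (cch a e h) {l..u} \<gamma> 1 s = (if e then - \<rho> s else \<rho> s)"
proof -
  have "\<gamma> ` {l..u} \<subseteq> cyl" using movesD(1)[OF assms(1)] by blast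
  from eventually_in_cch[OF moves_continuous[OF assms(1)] this assms(3,4)]
  have ev: "\<forall>\<^sub>F s in at t within {l..u}. \<gamma> s \<in> fst (cch a e h)" .
  moreover have "\<forall>\<^sub>F s in at t within {l..u}. s \<in> {l..u}" by (simp add: eventually_at_filter)
  ultimately have "\<forall>\<^sub>F s in at t within {l..u}. \<gamma> s \<in> fst (cch a e h) \<and> s \<in> {l..u}"
    by (rule eventually_conj)
  then show "\<forall>\<^sub>F s in at t within {l..u}. coord_deriv (cch a e h) {l..u} \<gamma> 0 s = \<omega> s"
    "\<forall>\<^sub>F s in at t within {l..u}. coord_deriv (cch a e h) {l..u} \<gamma> 1 s = (if e then - \<rho> s else \<rho> s)"
    by (auto elim!: eventually_mono simp: coord_deriv_cch[OF assms(1,2)] simp del: One_nat_def)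
qed

text \<open>In every chart the coordinate velocities are \<open>\<omega>\<close> and
  \<open>\<rho>\<close> up to sign, so their continuity in all charts amounts to the continuity of
  two global functions.\<close>

lemma C1_curve_cmfd:
  assumes "l < u"
  shows "C1_curve cmfd {l..u} \<gamma> \<longleftrightarrow>
    (\<exists>\<omega> \<rho>. moves {l..u} \<gamma> \<omega> \<rho> \<and> continuous_on {l..u} \<omega> \<and> continuous_on {l..u} \<rho>)"
proof
  assume C: "C1_curve cmfd {l..u} \<gamma>"
  have atl: "cch a e 1 \<in> matlas cmfd" for a e unfolding atlas_cmfd by blast
  have cont: "continuous_on {l..u} \<gamma>" "\<gamma> ` {l..u} \<subseteq> cyl"
    using C by (auto simp: C1_curve_def)
  have C': "(\<lambda>s. snd (cch a e 1) (\<gamma> s) k) differentiable (at t within {l..u})"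
    "continuous (at t within {l..u}) (coord_deriv (cch a e 1) {l..u} \<gamma> k)"
    if "t \<in> {l..u}" "\<gamma> t \<in> fst (cch a e 1)" "k < 2" for t a e k
    using C that atl[of a e] unfolding C1_curve_def cmfd_simps by blast+
  obtain \<omega> \<rho> where m: "moves {l..u} \<gamma> \<omega> \<rho>"
    using movesI_chart[OF cont C'(1)] by blast
  have "continuous (at t within {l..u}) \<omega> \<and> continuous (at t within {l..u}) \<rho>" if t: "t \<in> {l..u}" for t
  proof -
    obtain a e where c: "\<gamma> t \<in> fst (cch a e 1)" using ex_cch1[of "\<gamma> t"] cont(2) t by blast
    note cd = C'(2)[OF t c, unfolded continuous_within]
    have "(\<omega> \<longlongrightarrow> \<omega> t) (at t within {l..u})"
      using cd[of 0] tendsto_cong[OF eventually_coord_deriv(1)[OF m assms t c]]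
      by (simp add: coord_deriv_cch[OF m assms t c])
    moreover have "((\<lambda>s. if e then - \<rho> s else \<rho> s) \<longlongrightarrow> (if e then - \<rho> t else \<rho> t)) (at t within {l..u})"
      using cd[of 1] tendsto_cong[OF eventually_coord_deriv(2)[OF m assms t c]]
      by (simp add: coord_deriv_cch[OF m assms t c] del: One_nat_def)
    then have "(\<rho> \<longlongrightarrow> \<rho> t) (at t within {l..u})"
      by (cases e) (auto dest: tendsto_minus)
    ultimately show ?thesis by (simp add: continuous_within)
  qed
  then show "\<exists>\<omega> \<rho>. moves {l..u} \<gamma> \<omega> \<rho> \<and> continuous_on {l..u} \<omega> \<and> continuous_on {l..u} \<rho>"
    using m unfolding continuous_on_eq_continuous_within by blast
next
  assume "\<exists>\<omega> \<rho>. moves {l..u} \<gamma> \<omega> \<rho> \<and> continuous_on {l..u} \<omega> \<and> continuous_on {l..u} \<rho>"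
  then obtain \<omega> \<rho> where m: "moves {l..u} \<gamma> \<omega> \<rho>"
    and co: "continuous_on {l..u} \<omega>" "continuous_on {l..u} \<rho>" by blast
  show "C1_curve cmfd {l..u} \<gamma>"
    unfolding C1_curve_def
  proof (intro conjI ballI impI allI)
    show "continuous_map (top_of_set {l..u}) (mtop cmfd) \<gamma>"
      using moves_continuous[OF m] movesD(1)[OF m] by auto
    fix c t and k :: nat assume c: "c \<in> matlas cmfd" and t: "t \<in> {l..u}" and ct: "\<gamma> t \<in> fst c"
      and k: "k < mdim cmfd"
    obtain a e where c: "c = cch a e 1" using iffD1[OF atlas_cmfd c] by blast
    have k: "k = 0 \<or> k = 1" using k by auto
    note ct = ct[unfolded c]
    show "(\<lambda>s. snd c (\<gamma> s) k) differentiable (at t within {l..u})"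
      unfolding real_differentiable_def c using chart_velocity[OF m t ct] k by blast
    have "(\<omega> \<longlongrightarrow> \<omega> t) (at t within {l..u})" "(\<rho> \<longlongrightarrow> \<rho> t) (at t within {l..u})"
      using co t by (auto simp: continuous_on_def)
    moreover from this(2) have "((\<lambda>s. if e then - \<rho> s else \<rho> s) \<longlongrightarrow> (if e then - \<rho> t else \<rho> t)) (at t within {l..u})"
      by (cases e) (auto intro: tendsto_minus)
    ultimately show "continuous (at t within {l..u}) (coord_deriv c {l..u} \<gamma> k)"
      unfolding continuous_within c
      using tendsto_cong[OF eventually_coord_deriv(1)[OF m assms t ct]]
        tendsto_cong[OF eventually_coord_deriv(2)[OF m assms t ct]] k
        coord_deriv_cch[OF m assms t ct] by auto
  qed
qed

section \<open>The geodesic equation of a warped metric\<close>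

context profile
begin

text \<open>The Euler-Lagrange equations of the energy r'^2 + G(r) theta'^2, solved for the second
  derivatives. The one for \<open>\<omega>\<close> expresses that the angular momentum G theta' has
  derivative 0.\<close>

definition geo_path :: "real set \<Rightarrow> (real \<Rightarrow> nat \<Rightarrow> real) \<Rightarrow> (real \<Rightarrow> real) \<Rightarrow> (real \<Rightarrow> real) \<Rightarrow> bool" where
  "geo_path J \<gamma> \<omega> \<rho> \<longleftrightarrow> moves J \<gamma> \<omega> \<rho> \<and>
     (\<forall>t\<in>J. (\<omega> has_real_derivative - (deriv G (\<gamma> t 2) * \<rho> t * \<omega> t / G (\<gamma> t 2))) (at t within J) \<and>
            (\<rho> has_real_derivative deriv G (\<gamma> t 2) * (\<omega> t)\<^sup>2 / 2) (at t within J))"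

text \<open>The free index 0 gives the angular equation multiplied by G, and the free index 1 the
  vertical one up to orientation; G is positive, so both can be solved for the second
  derivatives.\<close>

lemma geodesic_equation_cch:
  assumes m: "moves {l..u} \<gamma> \<omega> \<rho>" and lu: "l < u" and t: "t \<in> {l..u}" and c: "\<gamma> t \<in> fst (cch a e 1)"
    and w: "(\<omega> has_real_derivative w) (at t within {l..u})"
    and r: "(\<rho> has_real_derivative r) (at t within {l..u})"
  defines "C \<equiv> cch a e 1"
  shows "(\<forall>l'<2. (\<Sum>k<2. metric_coeff cmfd (cmet G) C l' k (snd C (\<gamma> t)) * coord_deriv2 C {l..u} \<gamma> k t) +
           (\<Sum>i<2. \<Sum>j<2. christoffel cmfd (cmet G) C l' i j (snd C (\<gamma> t)) *
              coord_deriv C {l..u} \<gamma> i t * coord_deriv C {l..u} \<gamma> j t) = 0) \<longleftrightarrow>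
      w = - (deriv G (\<gamma> t 2) * \<rho> t * \<omega> t / G (\<gamma> t 2)) \<and> r = deriv G (\<gamma> t 2) * (\<omega> t)\<^sup>2 / 2"
proof -
  have x: "snd C (\<gamma> t) \<in> box2 1" using cinv_coords(1)[OF c] by (simp add: C_def)
  have cyl: "\<gamma> t \<in> cyl" using movesD(1)[OF m t] .
  have G0: "G (\<gamma> t 2) \<noteq> 0" using pos[OF cyl] by linarith
  note mc = metric_coeff_cmet[OF x order_refl, of _ _ G a e, folded C_def]
  note pm = partial_metric_coeff[OF x order_refl, of _ _ _ a e, folded C_def]
  have im: "chart_image C = box2 1" by (simp add: C_def chart_image_cch)
  have x1: "snd C (\<gamma> t) 1 = (if e then 1 - \<gamma> t 2 else \<gamma> t 2)" by (simp add: C_def hgt_def)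
  have d: "coord_deriv C {l..u} \<gamma> 0 t = \<omega> t"
    "coord_deriv C {l..u} \<gamma> 1 t = (if e then - \<rho> t else \<rho> t)"
    using coord_deriv_cch[OF m lu t c] by (simp_all add: C_def)
  have "(coord_deriv C {l..u} \<gamma> 0 has_real_derivative w) (at t within {l..u})"
    using has_field_derivative_cong_eventually[OF eventually_coord_deriv(1)[OF m lu t c, folded C_def] d(1)] w
    by blast
  then have d20: "coord_deriv2 C {l..u} \<gamma> 0 t = w"
    unfolding coord_deriv2_def by (rule vector_derivative_Icc[OF _ t lu])
  have "((\<lambda>s. if e then - \<rho> s else \<rho> s) has_real_derivative (if e then - r else r)) (at t within {l..u})"
    using r by (cases e) (auto intro: derivative_eq_intros)
  then have "(coord_deriv C {l..u} \<gamma> 1 has_real_derivative (if e then - r else r)) (at t within {l..u})"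
    using has_field_derivative_cong_eventually[OF eventually_coord_deriv(2)[OF m lu t c, folded C_def] d(2)]
    by blast
  then have d21: "coord_deriv2 C {l..u} \<gamma> 1 t = (if e then - r else r)"
    unfolding coord_deriv2_def by (rule vector_derivative_Icc[OF _ t lu])
  define g where "g = warp_deriv G e (snd C (\<gamma> t))"
  have g: "g = (if e then - deriv G (\<gamma> t 2) else deriv G (\<gamma> t 2))"
    unfolding g_def warp_deriv_def x1 by auto
  \<comment> \<open>Only the coefficient with indices 0, 0 depends on the point, and it depends on
    the height only, which leaves three nonzero symbols of the first kind: \<open>g / 2\<close>
    twice and \<open>- g / 2\<close> once.\<close>
  have ch: "christoffel cmfd (cmet G) C l' i j (snd C (\<gamma> t)) =
     ((if j = 0 \<and> l' = 0 \<and> i = 1 then g else 0) + (if i = 0 \<and> l' = 0 \<and> j = 1 then g else 0)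
       - (if i = 0 \<and> j = 0 \<and> l' = 1 then g else 0)) / 2" if "l' < 2" "i < 2" "j < 2" for l' i j
    unfolding christoffel_def im using that by (simp add: pm g_def del: One_nat_def)
  have sum2: "(\<Sum>k<2. f k) = f 0 + f 1" for f :: "nat \<Rightarrow> real" by (simp add: numeral_2_eq_2)
  have all2: "(\<forall>l'<2. P l') \<longleftrightarrow> P 0 \<and> P 1" for P :: "nat \<Rightarrow> bool"
    using less_2_cases_iff by auto
  have "(\<forall>l'<2. (\<Sum>k<2. metric_coeff cmfd (cmet G) C l' k (snd C (\<gamma> t)) * coord_deriv2 C {l..u} \<gamma> k t) +
           (\<Sum>i<2. \<Sum>j<2. christoffel cmfd (cmet G) C l' i j (snd C (\<gamma> t)) *
              coord_deriv C {l..u} \<gamma> i t * coord_deriv C {l..u} \<gamma> j t) = 0) \<longleftrightarrow>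
      G (\<gamma> t 2) * w + g * \<omega> t * (if e then - \<rho> t else \<rho> t) = 0 \<and>
      (if e then - r else r) - g / 2 * \<omega> t * \<omega> t = 0"
    unfolding all2 sum2 d20 d21 d by (simp add: mc ch x1 algebra_simps del: One_nat_def cch_snd)
  \<comment> \<open>In a chart at the upper end \<open>g\<close> and the vertical velocity and
    acceleration all change sign, so both orientations lead to the same pair of equations.\<close>
  also have "\<dots> \<longleftrightarrow> w = - (deriv G (\<gamma> t 2) * \<rho> t * \<omega> t / G (\<gamma> t 2)) \<and> r = deriv G (\<gamma> t 2) * (\<omega> t)\<^sup>2 / 2"
    using G0 unfolding g by (cases e) (auto simp: field_simps power2_eq_square)
  finally show ?thesis .
qed

lemma geodesic_cmfd:
  assumes lu: "l < u"
  shows "geodesic cmfd (cmet G) {l..u} \<gamma> \<longleftrightarrow> (\<exists>\<omega> \<rho>. geo_path {l..u} \<gamma> \<omega> \<rho>)"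
proof
  assume C: "geodesic cmfd (cmet G) {l..u} \<gamma>"
  have atl: "cch a e 1 \<in> matlas cmfd" for a e unfolding atlas_cmfd by blast
  have cont: "continuous_on {l..u} \<gamma>" "\<gamma> ` {l..u} \<subseteq> cyl"
    using C by (auto simp: geodesic_def)
  have C': "(\<lambda>s. snd (cch a e 1) (\<gamma> s) k) differentiable (at t within {l..u})"
    "coord_deriv (cch a e 1) {l..u} \<gamma> k differentiable (at t within {l..u})"
    if "t \<in> {l..u}" "\<gamma> t \<in> fst (cch a e 1)" "k < 2" for t a e k
    using C that atl[of a e] unfolding geodesic_def cmfd_simps by blast+
  obtain \<omega> \<rho> where m: "moves {l..u} \<gamma> \<omega> \<rho>"
    using movesI_chart[OF cont C'(1)] by blast
  have "(\<omega> has_real_derivative - (deriv G (\<gamma> t 2) * \<rho> t * \<omega> t / G (\<gamma> t 2))) (at t within {l..u}) \<and>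
        (\<rho> has_real_derivative deriv G (\<gamma> t 2) * (\<omega> t)\<^sup>2 / 2) (at t within {l..u})" if t: "t \<in> {l..u}" for t
  proof -
    obtain a e where c: "\<gamma> t \<in> fst (cch a e 1)" using ex_cch1[of "\<gamma> t"] cont(2) t by blast
    note d = coord_deriv_cch[OF m lu t c]
    obtain w where "(coord_deriv (cch a e 1) {l..u} \<gamma> 0 has_real_derivative w) (at t within {l..u})"
      using C'(2)[OF t c, of 0] unfolding real_differentiable_def by auto
    then have w: "(\<omega> has_real_derivative w) (at t within {l..u})"
      using has_field_derivative_cong_eventually[OF eventually_coord_deriv(1)[OF m lu t c] d(1)] by blast
    obtain r where "(coord_deriv (cch a e 1) {l..u} \<gamma> 1 has_real_derivative r) (at t within {l..u})"
      using C'(2)[OF t c, of 1] unfolding real_differentiable_def by auto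
    then have "((\<lambda>s. if e then - \<rho> s else \<rho> s) has_real_derivative r) (at t within {l..u})"
      using has_field_derivative_cong_eventually[OF eventually_coord_deriv(2)[OF m lu t c] d(2)] by blast
    then have r: "(\<rho> has_real_derivative (if e then - r else r)) (at t within {l..u})"
      by (cases e) (auto dest: DERIV_minus)
    show ?thesis
      using C[unfolded geodesic_def, THEN conjunct2, THEN bspec, OF atl, THEN bspec, OF t, THEN mp, OF c, THEN conjunct2]
        w r
      unfolding cmfd_simps geodesic_equation_cch[OF m lu t c w r] by metis
  qed
  then show "\<exists>\<omega> \<rho>. geo_path {l..u} \<gamma> \<omega> \<rho>" using m unfolding geo_path_def by blast
next
  assume "\<exists>\<omega> \<rho>. geo_path {l..u} \<gamma> \<omega> \<rho>"
  then obtain \<omega> \<rho> where g: "geo_path {l..u} \<gamma> \<omega> \<rho>" by blast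
  then have m: "moves {l..u} \<gamma> \<omega> \<rho>" by (simp add: geo_path_def)
  show "geodesic cmfd (cmet G) {l..u} \<gamma>"
    unfolding geodesic_def
  proof (intro conjI ballI impI)
    show "continuous_map (top_of_set {l..u}) (mtop cmfd) \<gamma>"
      using moves_continuous[OF m] movesD(1)[OF m] by auto
    fix c t assume c: "c \<in> matlas cmfd" and t: "t \<in> {l..u}" and ct: "\<gamma> t \<in> fst c"
    obtain a e where c: "c = cch a e 1" using iffD1[OF atlas_cmfd c] by blast
    note ct = ct[unfolded c]
    have w: "(\<omega> has_real_derivative - (deriv G (\<gamma> t 2) * \<rho> t * \<omega> t / G (\<gamma> t 2))) (at t within {l..u})"
      and r: "(\<rho> has_real_derivative deriv G (\<gamma> t 2) * (\<omega> t)\<^sup>2 / 2) (at t within {l..u})"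
      using g t by (auto simp: geo_path_def)
    show "\<forall>k<mdim cmfd. (\<lambda>s. snd c (\<gamma> s) k) differentiable (at t within {l..u}) \<and>
        coord_deriv c {l..u} \<gamma> k differentiable (at t within {l..u})"
    proof (intro allI impI)
      fix k :: nat assume "k < mdim cmfd"
      then have k: "k = 0 \<or> k = 1" by auto
      have "((\<lambda>s. if e then - \<rho> s else \<rho> s) has_real_derivative (if e then - (deriv G (\<gamma> t 2) * (\<omega> t)\<^sup>2 / 2) else deriv G (\<gamma> t 2) * (\<omega> t)\<^sup>2 / 2)) (at t within {l..u})"
        using DERIV_minus[OF r] r by (cases e) auto
      then have "\<exists>d. (coord_deriv c {l..u} \<gamma> 1 has_real_derivative d) (at t within {l..u})"
        unfolding c using has_field_derivative_cong_eventually[OF eventually_coord_deriv(2)[OF m lu t ct]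
            coord_deriv_cch(2)[OF m lu t ct]] by blast
      moreover have "\<exists>d. (coord_deriv c {l..u} \<gamma> 0 has_real_derivative d) (at t within {l..u})"
        unfolding c using has_field_derivative_cong_eventually[OF eventually_coord_deriv(1)[OF m lu t ct]
            coord_deriv_cch(1)[OF m lu t ct]] w by blast
      ultimately show "(\<lambda>s. snd c (\<gamma> s) k) differentiable (at t within {l..u}) \<and>
          coord_deriv c {l..u} \<gamma> k differentiable (at t within {l..u})"
        unfolding real_differentiable_def c using chart_velocity[OF m t ct] k by blast
    qed
    show "\<forall>l'<mdim cmfd.
         (\<Sum>k<mdim cmfd. metric_coeff cmfd (cmet G) c l' k (snd c (\<gamma> t)) * coord_deriv2 c {l..u} \<gamma> k t) +
         (\<Sum>i<mdim cmfd. \<Sum>j<mdim cmfd. christoffel cmfd (cmet G) c l' i j (snd c (\<gamma> t)) *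
            coord_deriv c {l..u} \<gamma> i t * coord_deriv c {l..u} \<gamma> j t) = 0"
      unfolding cmfd_simps c geodesic_equation_cch[OF m lu t ct w r] by simp
  qed
qed

end

section \<open>Lengths and distances\<close>

lemma piecewise_C1_curve_cmfd:
  "piecewise_C1_curve cmfd \<gamma> \<longleftrightarrow> (\<exists>(N::nat) b. b 0 = 0 \<and> b N = 1 \<and>
     (\<forall>i<N. b i < b (Suc i) \<and> (\<exists>\<omega> \<rho>. moves {b i..b (Suc i)} \<gamma> \<omega> \<rho> \<and>
        continuous_on {b i..b (Suc i)} \<omega> \<and> continuous_on {b i..b (Suc i)} \<rho>)))
     \<and> continuous_on {0..1} \<gamma> \<and> \<gamma> ` {0..1} \<subseteq> cyl"
  unfolding piecewise_C1_curve_def by (auto simp: C1_curve_cmfd cong: conj_cong)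

lemma breakpoints_mono:
  fixes b :: "nat \<Rightarrow> real"
  assumes "\<And>i. i < N \<Longrightarrow> b i < b (Suc i)" "i \<le> j" "j \<le> N"
  shows "b i \<le> b j"
  using assms(2,3)
proof (induction j rule: dec_induct)
  case (step n)
  then show ?case using assms(1)[of n] by simp
qed simp

lemma breakpoints_cover:
  fixes b :: "nat \<Rightarrow> real"
  assumes "b 0 \<le> t" "t < b N"
  shows "\<exists>i<N. b i \<le> t \<and> t < b (Suc i)"
  using assms
proof (induction N)
  case (Suc N)
  then show ?case by (cases "t < b N") (auto intro: less_SucI)
qed simp

definition speed :: "(real \<Rightarrow> real) \<Rightarrow> (real \<Rightarrow> nat \<Rightarrow> real) \<Rightarrow> real \<Rightarrow> real" where
  "speed G \<gamma> t = sqrt (cmet G (\<gamma> t) (velocity cmfd {0..1} \<gamma> t) (velocity cmfd {0..1} \<gamma> t))"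

lemma curve_length_cmet: "curve_length cmfd (cmet G) \<gamma> = integral {0..1} (speed G \<gamma>)"
  by (simp add: curve_length_def speed_def[abs_def])

text \<open>\<open>cmet\<close> tests vectors on the ambient coordinates, so the derivatives of
  these coordinates along the curve already determine the speed. Lengths can thus be treated before
  the velocity is identified as a tangent vector.\<close>

lemma cmet_velocity:
  assumes "\<gamma> t \<in> cyl"
    "((\<lambda>s. \<gamma> s 0) has_real_derivative - (\<gamma> t 1 * w)) (at t within {l..u})"
    "((\<lambda>s. \<gamma> s 1) has_real_derivative \<gamma> t 0 * w) (at t within {l..u})"
    "((\<lambda>s. \<gamma> s 2) has_real_derivative r) (at t within {l..u})"
    "t \<in> {l..u}" "l < u"
  shows "cmet G (\<gamma> t) (velocity cmfd {l..u} \<gamma> t) (velocity cmfd {l..u} \<gamma> t) = r\<^sup>2 + G (\<gamma> t 2) * w\<^sup>2"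
proof -
  have "(\<gamma> t 0)\<^sup>2 + (\<gamma> t 1)\<^sup>2 = 1" using assms(1) by (simp add: cyl_def)
  then have "r * r + G (\<gamma> t 2) * (- (\<gamma> t 1 * w) * - (\<gamma> t 1 * w) + \<gamma> t 0 * w * (\<gamma> t 0 * w)) = r\<^sup>2 + G (\<gamma> t 2) * w\<^sup>2"
    by algebra
  then show ?thesis
    using smooth_near_coord[OF assms(1)] assms(2-4)[THEN vector_derivative_Icc[OF _ assms(5,6)]]
    by (simp add: cmet_def velocity_def)
qed

text \<open>Strictly inside a smooth piece derivatives are two-sided, so the velocity within
  \<open>{0..1}\<close> that enters \<open>curve_length\<close> agrees with the one within the
  piece. At a breakpoint it may fail to exist, but finitely many times do not affect the
  integral.\<close>

definition regular_at :: "(real \<Rightarrow> nat \<Rightarrow> real) \<Rightarrow> (real \<Rightarrow> real) \<Rightarrow> (real \<Rightarrow> real) \<Rightarrow> real \<Rightarrow> bool" where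
  "regular_at \<gamma> \<omega> \<rho> t \<longleftrightarrow> (\<exists>l u. 0 \<le> l \<and> l < t \<and> t < u \<and> u \<le> 1 \<and> moves {l..u} \<gamma> \<omega> \<rho>)"

lemma regular_at_deriv:
  assumes "regular_at \<gamma> \<omega> \<rho> t"
  shows "\<gamma> t \<in> cyl" "0 < t" "t < 1"
    "((\<lambda>s. \<gamma> s 0) has_real_derivative - (\<gamma> t 1 * \<omega> t)) (at t)"
    "((\<lambda>s. \<gamma> s 1) has_real_derivative \<gamma> t 0 * \<omega> t) (at t)"
    "((\<lambda>s. \<gamma> s 2) has_real_derivative \<rho> t) (at t)"
proof -
  obtain l u where lu: "0 \<le> l" "l < t" "t < u" "u \<le> 1" "moves {l..u} \<gamma> \<omega> \<rho>"
    using assms unfolding regular_at_def by blast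
  have "at t within {l..u} = at t" using lu by (intro at_within_interior) simp
  then show "\<gamma> t \<in> cyl" "0 < t" "t < 1"
    "((\<lambda>s. \<gamma> s 0) has_real_derivative - (\<gamma> t 1 * \<omega> t)) (at t)"
    "((\<lambda>s. \<gamma> s 1) has_real_derivative \<gamma> t 0 * \<omega> t) (at t)"
    "((\<lambda>s. \<gamma> s 2) has_real_derivative \<rho> t) (at t)"
    using movesD[OF lu(5), of t] lu by auto
qed

lemma speed_regular:
  assumes "regular_at \<gamma> \<omega> \<rho> t"
  shows "speed G \<gamma> t = sqrt ((\<rho> t)\<^sup>2 + G (\<gamma> t 2) * (\<omega> t)\<^sup>2)"
  unfolding speed_def
  using regular_at_deriv(2,3)[OF assms]
  by (subst cmet_velocity[OF regular_at_deriv(1)[OF assms] regular_at_deriv(4-6)[OF assms, THEN has_field_derivative_at_within]])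
     auto

lemma finite_irregular:
  assumes "piecewise_C1_curve cmfd \<gamma>"
  obtains E where "finite E" "\<And>t. t \<in> {0..1} - E \<Longrightarrow> \<exists>\<omega> \<rho>. regular_at \<gamma> \<omega> \<rho> t"
proof -
  obtain N b where b0: "b 0 = 0" "b N = 1" and b1: "\<forall>i<N. b i < b (Suc i) \<and>
      (\<exists>\<omega> \<rho>. moves {b i..b (Suc i)} \<gamma> \<omega> \<rho> \<and>
        continuous_on {b i..b (Suc i)} \<omega> \<and> continuous_on {b i..b (Suc i)} \<rho>)"
    using assms unfolding piecewise_C1_curve_cmfd by (elim exE conjE)
  have b3: "b i < b (Suc i)" and b4: "\<exists>\<omega> \<rho>. moves {b i..b (Suc i)} \<gamma> \<omega> \<rho>" if "i < N" for i
    using b1 that by blast+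
  note b = b0 b3 b4
  have "\<exists>\<omega> \<rho>. regular_at \<gamma> \<omega> \<rho> t" if t: "t \<in> {0..1} - b ` {..N}" for t
  proof -
    have "t \<noteq> b N" using t by auto
    then have "b 0 \<le> t" "t < b N" using t b(1,2) by auto
    then obtain i where i: "i < N" "b i \<le> t" "t < b (Suc i)" using breakpoints_cover by blast
    have "b i \<noteq> t" using t i(1) by auto
    moreover have "b 0 \<le> b i" "b (Suc i) \<le> b N"
      using breakpoints_mono[of N b, OF b(3)] i(1) by auto
    ultimately show ?thesis using b(4)[OF i(1)] i b(1,2) unfolding regular_at_def
      by (metis order_le_imp_less_or_eq)
  qed
  then show ?thesis by (intro that[of "b ` {..N}"]) auto
qed

lemma integrable_on_pieces:
  fixes f :: "real \<Rightarrow> real"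
  assumes "\<And>i. i < N \<Longrightarrow> b i < b (Suc i)" "\<And>i. i < N \<Longrightarrow> f integrable_on {b i..b (Suc i)}"
  shows "f integrable_on {b 0..b N}"
proof -
  have "f integrable_on {b 0..b i}" if "i \<le> N" for i
    using that
  proof (induction i)
    case 0
    show ?case using integrable_on_refl[of f "b 0"] by simp
  next
    case (Suc i)
    then show ?case
      using assms(1)[of i] assms(2)[of i] breakpoints_mono[of N b 0 i, OF assms(1)]
      by (intro Henstock_Kurzweil_Integration.integrable_combine[of "b 0" "b i" "b (Suc i)"]) auto
  qed
  then show ?thesis by simp
qed

section \<open>Length integrals and lower bounds for lengths\<close>

context profile
begin

lemma continuous_on_G: "continuous_on S G"
  using has_deriv DERIV_isCont continuous_at_imp_continuous_on by blast

lemma speed_integrable: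
  assumes "piecewise_C1_curve cmfd \<gamma>"
  shows "speed G \<gamma> integrable_on {0..1}"
proof -
  obtain N b where b0: "b 0 = 0" "b N = 1" and b1: "\<forall>i<N. b i < b (Suc i) \<and>
      (\<exists>\<omega> \<rho>. moves {b i..b (Suc i)} \<gamma> \<omega> \<rho> \<and>
        continuous_on {b i..b (Suc i)} \<omega> \<and> continuous_on {b i..b (Suc i)} \<rho>)"
    using assms unfolding piecewise_C1_curve_cmfd by (elim exE conjE)
  have b3: "b i < b (Suc i)" and b4: "\<exists>\<omega> \<rho>. moves {b i..b (Suc i)} \<gamma> \<omega> \<rho> \<and>
        continuous_on {b i..b (Suc i)} \<omega> \<and> continuous_on {b i..b (Suc i)} \<rho>" if "i < N" for i
    using b1 that by auto
  note b = b0 b3 b4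
  have "speed G \<gamma> integrable_on {b i..b (Suc i)}" if i: "i < N" for i
  proof -
    obtain \<omega> \<rho> where m: "moves {b i..b (Suc i)} \<gamma> \<omega> \<rho>"
      "continuous_on {b i..b (Suc i)} \<omega>" "continuous_on {b i..b (Suc i)} \<rho>"
      using b(4)[OF i] by blast
    have "continuous_on {b i..b (Suc i)} (\<lambda>t. \<gamma> t 2)"
      using moves_continuous[OF m(1)] by (rule continuous_on_product_then_coordinatewise)
    then have "continuous_on {b i..b (Suc i)} (\<lambda>t. sqrt ((\<rho> t)\<^sup>2 + G (\<gamma> t 2) * (\<omega> t)\<^sup>2))"
      by (intro continuous_intros m continuous_on_compose2[OF continuous_on_G[of UNIV]]) auto
    then have int: "(\<lambda>t. sqrt ((\<rho> t)\<^sup>2 + G (\<gamma> t 2) * (\<omega> t)\<^sup>2)) integrable_on {b i..b (Suc i)}"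
      by (rule integrable_continuous_interval)
    have "b 0 \<le> b i" "b (Suc i) \<le> b N"
      using breakpoints_mono[of N b, OF b(3)] i(1) by auto
    then have "regular_at \<gamma> \<omega> \<rho> t" if "t \<in> {b i..b (Suc i)} - {b i, b (Suc i)}" for t
      unfolding regular_at_def using m(1) that b(1,2)
      by (intro exI[of _ "b i"] exI[of _ "b (Suc i)"]) auto
    then show ?thesis
      using integrable_spike_finite[OF _ _ int, of "{b i, b (Suc i)}"] speed_regular by blast
  qed
  then show ?thesis using integrable_on_pieces[of N b, OF b(3)] b(1,2) by metis
qed

lemma speed_nonneg:
  assumes "\<gamma> t \<in> cyl"
  shows "0 \<le> speed G \<gamma> t"
  using pos[OF assms] by (simp add: speed_def cmet_def)

text \<open>Along the curve, the linear function with unit gradient \<open>(a, b, c)\<close> grows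
  at most with the Euclidean speed, hence at most with \<open>speed G\<close> because
  \<open>1 \<le> G\<close>. A linear function is differentiable everywhere, unlike the distance from
  the starting point.\<close>

lemma curve_length_ge_linear:
  assumes \<gamma>: "piecewise_C1_curve cmfd \<gamma>" and k: "a\<^sup>2 + b\<^sup>2 + c\<^sup>2 = 1"
  shows "a * (\<gamma> 1 0 - \<gamma> 0 0) + b * (\<gamma> 1 1 - \<gamma> 0 1) + c * (\<gamma> 1 2 - \<gamma> 0 2) \<le> curve_length cmfd (cmet G) \<gamma>"
proof -
  define h where "h t = a * \<gamma> t 0 + b * \<gamma> t 1 + c * \<gamma> t 2" for t
  obtain E where E: "finite E" "\<And>t. t \<in> {0..1} - E \<Longrightarrow> \<exists>\<omega> \<rho>. regular_at \<gamma> \<omega> \<rho> t"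
    using finite_irregular[OF \<gamma>] by blast
  have cont: "continuous_on {0..1} \<gamma>" "\<gamma> ` {0..1} \<subseteq> cyl"
    using \<gamma> unfolding piecewise_C1_curve_cmfd by blast+
  have "\<exists>d. (h has_real_derivative d) (at t) \<and> d \<le> speed G \<gamma> t" if t: "t \<in> {0..1} - E" for t
  proof -
    obtain \<omega> \<rho> where r: "regular_at \<gamma> \<omega> \<rho> t" using E(2)[OF t] by blast
    define x y w v where "x = \<gamma> t 0" and "y = \<gamma> t 1" and "w = \<omega> t" and "v = \<rho> t"
    have xy: "x\<^sup>2 + y\<^sup>2 = 1" using regular_at_deriv(1)[OF r] by (simp add: cyl_def x_def y_def)
    have "(h has_real_derivative a * - (y * w) + b * (x * w) + c * v) (at t)"
      unfolding h_def x_def y_def w_def v_def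
      by (intro DERIV_add DERIV_cmult regular_at_deriv[OF r])
    moreover have "a * - (y * w) + b * (x * w) + c * v \<le> speed G \<gamma> t"
    proof -
      \<comment> \<open>Lagrange's identity for the gradient \<open>(a, b, c)\<close> and the
        velocity \<open>(- y w, x w, v)\<close>: the squared scalar product and the squared cross
        product add up to the product of the squared norms.\<close>
      have "(a * - (y * w) + b * (x * w) + c * v)\<^sup>2 + ((a * (x * w) + b * (y * w))\<^sup>2
          + (- a * v - c * (y * w))\<^sup>2 + (b * v - c * (x * w))\<^sup>2) = (a\<^sup>2 + b\<^sup>2 + c\<^sup>2) * ((x\<^sup>2 + y\<^sup>2) * w\<^sup>2 + v\<^sup>2)"
        by algebra
      moreover have "0 \<le> (a * (x * w) + b * (y * w))\<^sup>2 + (- a * v - c * (y * w))\<^sup>2 + (b * v - c * (x * w))\<^sup>2"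
        by simp
      ultimately have "(a * - (y * w) + b * (x * w) + c * v)\<^sup>2 \<le> v\<^sup>2 + w\<^sup>2"
        unfolding k xy mult_1 by linarith
      also have "\<dots> \<le> v\<^sup>2 + G (\<gamma> t 2) * w\<^sup>2"
        using pos[OF regular_at_deriv(1)[OF r]] by (simp add: mult_le_cancel_right1)
      finally show ?thesis
        unfolding speed_regular[OF r] w_def v_def by (rule real_le_rsqrt)
    qed
    ultimately show ?thesis by blast
  qed
  then obtain h' where h': "\<And>t. t \<in> {0..1} - E \<Longrightarrow> (h has_real_derivative h' t) (at t) \<and> h' t \<le> speed G \<gamma> t"
    by metis
  \<comment> \<open>At the exceptional times there is no bound for the derivative. The value 0
    leaves the integral unchanged and lies below the speed, which is nonnegative there as
    well.\<close>
  define h'' where "h'' t = (if t \<in> E then 0 else h' t)" for t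
  have "continuous_on {0..1} h" unfolding h_def
    by (intro continuous_intros continuous_on_product_then_coordinatewise[OF cont(1)])
  then have "(h'' has_integral (h 1 - h 0)) {0..1}"
    using h' E(1)
    by (intro fundamental_theorem_of_calculus_strong[of E])
       (auto simp: h''_def has_real_derivative_iff_has_vector_derivative)
  moreover have "(speed G \<gamma> has_integral curve_length cmfd (cmet G) \<gamma>) {0..1}"
    unfolding curve_length_cmet using speed_integrable[OF \<gamma>] by (rule integrable_integral)
  moreover have "h'' t \<le> speed G \<gamma> t" if "t \<in> {0..1}" for t
    using h'[of t] that speed_nonneg[of \<gamma> t] subsetD[OF cont(2), of "\<gamma> t"]
    by (cases "t \<in> E") (auto simp: h''_def)
  ultimately have "h 1 - h 0 \<le> curve_length cmfd (cmet G) \<gamma>"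
    by (rule has_integral_le)
  then show ?thesis by (simp add: h_def algebra_simps)
qed

definition edist :: "(nat \<Rightarrow> real) \<Rightarrow> (nat \<Rightarrow> real) \<Rightarrow> real" where
  "edist p q = sqrt ((q 0 - p 0)\<^sup>2 + (q 1 - p 1)\<^sup>2 + (q 2 - p 2)\<^sup>2)"

text \<open>The linear bound is applied in the direction of the chord. A chord of length 0 has no
  direction and is treated separately.\<close>

lemma edist_le_curve_length:
  assumes "piecewise_C1_curve cmfd \<gamma>"
  shows "edist (\<gamma> 0) (\<gamma> 1) \<le> curve_length cmfd (cmet G) \<gamma>"
proof (cases "edist (\<gamma> 0) (\<gamma> 1) = 0")
  case True
  have "\<gamma> t \<in> cyl" if "t \<in> {0..1}" for t
    using assms that unfolding piecewise_C1_curve_cmfd by blast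
  then have "0 \<le> curve_length cmfd (cmet G) \<gamma>"
    unfolding curve_length_cmet using speed_integrable[OF assms] speed_nonneg by (intro integral_nonneg) auto
  then show ?thesis using True by simp
next
  case False
  define L x y z where "L = edist (\<gamma> 0) (\<gamma> 1)" and "x = \<gamma> 1 0 - \<gamma> 0 0" and "y = \<gamma> 1 1 - \<gamma> 0 1" and "z = \<gamma> 1 2 - \<gamma> 0 2"
  have "0 \<le> L" by (simp add: L_def edist_def)
  then have L: "0 < L" using False by (simp add: L_def)
  have L2: "x\<^sup>2 + y\<^sup>2 + z\<^sup>2 = L\<^sup>2" by (simp add: L_def edist_def x_def y_def z_def)
  have "(x / L)\<^sup>2 + (y / L)\<^sup>2 + (z / L)\<^sup>2 = 1"
    using L L2 by (simp add: power_divide add_divide_distrib[symmetric])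
  then have "x / L * x + y / L * y + z / L * z \<le> curve_length cmfd (cmet G) \<gamma>"
    using curve_length_ge_linear[OF assms] by (simp only: x_def y_def z_def)
  moreover have "x / L * x + y / L * y + z / L * z = (x\<^sup>2 + y\<^sup>2 + z\<^sup>2) / L"
    by (simp add: power2_eq_square add_divide_distrib)
  then have "x / L * x + y / L * y + z / L * z = L"
    using L unfolding L2 by (simp add: power2_eq_square)
  ultimately show ?thesis by (simp add: L_def)
qed

lemma edist_le_riem_dist: "ennreal (edist p q) \<le> riem_dist cmfd (cmet G) p q"
  unfolding riem_dist_def using edist_le_curve_length by (intro INF_greatest) (auto intro!: ennreal_leI)

text \<open>A vertical segment has the same length for every profile, since \<open>G\<close>
  multiplies the angular velocity only. With the chord as lower bound this determines the distance
  to an end.\<close>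

lemma riem_dist_vertical:
  assumes "p \<in> cyl" "0 \<le> r" "r \<le> 1"
  shows "riem_dist cmfd (cmet G) p (p(2 := r)) \<le> ennreal \<bar>r - p 2\<bar>"
proof -
  define \<gamma> where "\<gamma> t = p(2 := p 2 + t * (r - p 2))" for t
  have "0 \<le> p 2 + t * (r - p 2) \<and> p 2 + t * (r - p 2) \<le> 1" if "t \<in> {0..1}" for t
  proof -
    have "0 \<le> (1 - t) * p 2 + t * r" using assms that by (auto simp: cyl_def)
    moreover have "(1 - t) * p 2 + t * r \<le> (1 - t) * 1 + t * 1"
      using assms that by (intro add_mono mult_left_mono) (auto simp: cyl_def)
    ultimately show ?thesis by (simp add: algebra_simps)
  qed
  then have cyl: "\<gamma> t \<in> cyl" if "t \<in> {0..1}" for t using that assms(1) by (auto simp: cyl_def \<gamma>_def)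
  have m: "moves {0..1} \<gamma> (\<lambda>t. 0) (\<lambda>t. r - p 2)"
    using cyl unfolding moves_def \<gamma>_def by (auto intro!: derivative_eq_intros)
  have "continuous_on {0..1::real} (\<lambda>t. 0::real)" "continuous_on {0..1::real} (\<lambda>t. r - p 2)"
    by (rule continuous_on_const)+
  then have ex: "\<exists>\<omega> \<rho>. moves {0..1} \<gamma> \<omega> \<rho> \<and> continuous_on {0..1} \<omega> \<and> continuous_on {0..1} \<rho>"
    using m by blast
  have pw: "piecewise_C1_curve cmfd \<gamma>"
    unfolding piecewise_C1_curve_cmfd
    by (intro conjI exI[of _ "1::nat"] exI[of _ real])
       (use ex moves_continuous[OF m] cyl in auto)
  have "speed G \<gamma> t = \<bar>r - p 2\<bar>" if "t \<in> {0..1} - {0, 1}" for t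
  proof -
    have "regular_at \<gamma> (\<lambda>t. 0) (\<lambda>t. r - p 2) t"
      unfolding regular_at_def using m that by (intro exI[of _ 0] exI[of _ 1]) auto
    from speed_regular[OF this] show ?thesis by simp
  qed
  then have "curve_length cmfd (cmet G) \<gamma> = integral {0..1} (\<lambda>t::real. \<bar>r - p 2\<bar>)"
    unfolding curve_length_cmet by (intro integral_spike[of "{0, 1}"]) auto
  then have "curve_length cmfd (cmet G) \<gamma> = \<bar>r - p 2\<bar>" by simp
  moreover have "\<gamma> 0 = p" "\<gamma> 1 = p(2 := r)" by (auto simp: \<gamma>_def)
  ultimately show ?thesis
    unfolding riem_dist_def using pw by (intro INF_lower2[of \<gamma>]) auto
qed

end

text \<open>A reflection of the circle combined with the exchange of the two ends. Composed with a time
  reversal it preserves angular and vertical velocities.\<close>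

definition flip :: "real \<Rightarrow> real \<Rightarrow> (nat \<Rightarrow> real) \<Rightarrow> nat \<Rightarrow> real" where
  "flip c s p = (\<lambda>i. if i = 0 then c * p 0 + s * p 1 else if i = 1 then s * p 0 - c * p 1
     else if i = 2 then 1 - p 2 else 0)"

lemma flip_simps [simp]: "flip c s p 0 = c * p 0 + s * p (Suc 0)"
  "flip c s p (Suc 0) = s * p 0 - c * p (Suc 0)" "flip c s p 2 = 1 - p 2"
  by (auto simp: flip_def)

lemma flip_cyl:
  assumes "c\<^sup>2 + s\<^sup>2 = 1" "p \<in> cyl"
  shows "flip c s p \<in> cyl"
proof -
  have "(c * p 0 + s * p 1)\<^sup>2 + (s * p 0 - c * p 1)\<^sup>2 = (c\<^sup>2 + s\<^sup>2) * ((p 0)\<^sup>2 + (p 1)\<^sup>2)"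
    by algebra
  then show ?thesis using assms by (auto simp: cyl_def flip_def)
qed

lemma has_real_derivative_reverse:
  assumes "(f has_real_derivative d) (at (T - t) within {l..u})"
  shows "((\<lambda>t. f (T - t)) has_real_derivative - d) (at t within {T - u..T - l :: real})"
proof -
  have "(\<lambda>t. T - t) ` {T - u..T - l} = {l..u}"
    by (auto simp: image_iff intro!: bexI[of _ "T - _"])
  then have "(f \<circ> (\<lambda>t. T - t) has_real_derivative d * (-1)) (at t within {T - u..T - l})"
    using assms by (intro DERIV_image_chain) (auto intro!: derivative_eq_intros)
  then show ?thesis by (simp add: o_def)
qed

lemma moves_flip:
  assumes "c\<^sup>2 + s\<^sup>2 = 1" "moves {l..u} \<gamma> \<omega> \<rho>"
  shows "moves {T - u..T - l} (\<lambda>t. flip c s (\<gamma> (T - t))) (\<lambda>t. \<omega> (T - t)) (\<lambda>t. \<rho> (T - t))"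
  unfolding moves_def
proof (intro ballI conjI)
  fix t assume "t \<in> {T - u..T - l}"
  then have t: "T - t \<in> {l..u}" by auto
  note m = movesD[OF assms(2) t]
  note m' = m(2,4,5)[THEN has_real_derivative_reverse]
  let ?F = "at t within {T - u..T - l}"
  show "flip c s (\<gamma> (T - t)) \<in> cyl" by (rule flip_cyl[OF assms(1) m(1)])
  have "((\<lambda>t. c * \<gamma> (T - t) 0 + s * \<gamma> (T - t) (Suc 0)) has_real_derivative
      c * - (- (\<gamma> (T - t) 1 * \<omega> (T - t))) + s * - (\<gamma> (T - t) 0 * \<omega> (T - t))) ?F"
    by (intro DERIV_add DERIV_cmult m')
  then show "((\<lambda>t. flip c s (\<gamma> (T - t)) 0) has_real_derivative
      - (flip c s (\<gamma> (T - t)) 1 * \<omega> (T - t))) ?F"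
    by (simp add: algebra_simps)
  have "((\<lambda>t. s * \<gamma> (T - t) 0 - c * \<gamma> (T - t) (Suc 0)) has_real_derivative
      s * - (- (\<gamma> (T - t) 1 * \<omega> (T - t))) - c * - (\<gamma> (T - t) 0 * \<omega> (T - t))) ?F"
    by (intro DERIV_diff DERIV_cmult m')
  then show "((\<lambda>t. flip c s (\<gamma> (T - t)) 1) has_real_derivative
      flip c s (\<gamma> (T - t)) 0 * \<omega> (T - t)) ?F"
    by (simp add: algebra_simps)
  have "((\<lambda>t. 1 - \<gamma> (T - t) 2) has_real_derivative 0 - (- \<rho> (T - t))) ?F"
    by (intro DERIV_diff DERIV_const m')
  then show "((\<lambda>t. flip c s (\<gamma> (T - t)) 2) has_real_derivative \<rho> (T - t)) ?F"
    by simp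
qed

text \<open>With \<open>c + i s = p q\<close> in complex notation, the reflection \<open>z \<mapsto> p q / z\<close> of the unit circle
  exchanges \<open>p\<close> and \<open>q\<close>.\<close>

lemma flip_exchange:
  assumes "p \<in> cyl" "q \<in> cyl" "q 2 = 1 - p 2"
  defines "c \<equiv> p 0 * q 0 - p 1 * q 1" and "s \<equiv> p 0 * q 1 + p 1 * q 0"
  shows "c\<^sup>2 + s\<^sup>2 = 1" "flip c s p = q" "flip c s q = p"
proof -
  have pq: "(p 0)\<^sup>2 + (p 1)\<^sup>2 = 1" "(q 0)\<^sup>2 + (q 1)\<^sup>2 = 1" using assms(1,2) by (auto simp: cyl_def)
  show "c\<^sup>2 + s\<^sup>2 = 1" using pq unfolding c_def s_def by algebra
  have "c * p 0 + s * p 1 = q 0" "s * p 0 - c * p 1 = q 1" "c * q 0 + s * q 1 = p 0" "s * q 0 - c * q 1 = p 1"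
    using pq unfolding c_def s_def by algebra+
  then show "flip c s p = q" "flip c s q = p"
    using assms(1-3) by (auto intro!: fun_eq_3I simp: cyl_def flip_def)
qed

lemma piecewise_C1_flip:
  assumes "c\<^sup>2 + s\<^sup>2 = 1" "piecewise_C1_curve cmfd \<gamma>"
  shows "piecewise_C1_curve cmfd (\<lambda>t. flip c s (\<gamma> (1 - t)))"
proof -
  obtain N b where b0: "b 0 = 0" "b N = 1" and b1: "\<forall>i<N. b i < b (Suc i) \<and>
      (\<exists>\<omega> \<rho>. moves {b i..b (Suc i)} \<gamma> \<omega> \<rho> \<and>
        continuous_on {b i..b (Suc i)} \<omega> \<and> continuous_on {b i..b (Suc i)} \<rho>)"
    and cont: "continuous_on {0..1} \<gamma>" "\<gamma> ` {0..1} \<subseteq> cyl"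
    using assms(2) unfolding piecewise_C1_curve_cmfd by (elim exE conjE)
  \<comment> \<open>The reversed breakpoints: piece \<open>i\<close> of the new curve is piece
    \<open>N - Suc i\<close> of the old one, run backwards.\<close>
  define b' where "b' i = 1 - b (N - i)" for i
  have "b' i < b' (Suc i) \<and> (\<exists>\<omega> \<rho>. moves {b' i..b' (Suc i)} (\<lambda>t. flip c s (\<gamma> (1 - t))) \<omega> \<rho> \<and>
        continuous_on {b' i..b' (Suc i)} \<omega> \<and> continuous_on {b' i..b' (Suc i)} \<rho>)" if i: "i < N" for i
  proof -
    define j where "j = N - Suc i"
    have j: "j < N" "N - i = Suc j" using i by (auto simp: j_def)
    have b': "b' i = 1 - b (Suc j)" "b' (Suc i) = 1 - b j" by (auto simp: b'_def j(2)) (simp add: j_def)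
    obtain \<omega> \<rho> where m: "moves {b j..b (Suc j)} \<gamma> \<omega> \<rho>"
      "continuous_on {b j..b (Suc j)} \<omega>" "continuous_on {b j..b (Suc j)} \<rho>"
      using b1 j(1) by blast
    have "continuous_on {1 - b (Suc j)..1 - b j} (\<lambda>t. \<omega> (1 - t))"
      "continuous_on {1 - b (Suc j)..1 - b j} (\<lambda>t. \<rho> (1 - t))"
      by (rule continuous_on_compose2[OF m(2)] continuous_on_compose2[OF m(3)]; auto intro: continuous_intros)+
    then show ?thesis
      using moves_flip[OF assms(1) m(1), of 1] b1 j(1) unfolding b' by auto
  qed
  moreover have "b' 0 = 0" "b' N = 1" using b0 by (auto simp: b'_def)
  moreover have cont': "continuous_on {0..1} (\<lambda>t. \<gamma> (1 - t))"
    by (rule continuous_on_compose2[OF cont(1)]) (auto intro: continuous_intros)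
  have "continuous_on {0..1} (\<lambda>t. flip c s (\<gamma> (1 - t)))"
  proof (rule continuous_on_coordinatewise_then_product)
    fix i
    show "continuous_on {0..1} (\<lambda>t. flip c s (\<gamma> (1 - t)) i)"
      unfolding flip_def
      by (cases "i = 0"; cases "i = 1"; cases "i = 2")
         (auto intro!: continuous_on_add continuous_on_diff continuous_on_mult continuous_on_const
           continuous_on_product_then_coordinatewise[OF cont'])
  qed
  moreover have "(\<lambda>t. flip c s (\<gamma> (1 - t))) ` {0..1} \<subseteq> cyl"
    using flip_cyl[OF assms(1)] cont(2) by (auto simp: image_subset_iff)
  ultimately show ?thesis unfolding piecewise_C1_curve_cmfd by blast
qed

lemma regular_at_flip:
  assumes "c\<^sup>2 + s\<^sup>2 = 1" "regular_at \<gamma> \<omega> \<rho> (1 - t)"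
  shows "regular_at (\<lambda>t. flip c s (\<gamma> (1 - t))) (\<lambda>t. \<omega> (1 - t)) (\<lambda>t. \<rho> (1 - t)) t"
proof -
  obtain l u where lu: "0 \<le> l" "l < 1 - t" "1 - t < u" "u \<le> 1" "moves {l..u} \<gamma> \<omega> \<rho>"
    using assms(2) unfolding regular_at_def by blast
  then show ?thesis
    unfolding regular_at_def using moves_flip[OF assms(1) lu(5), of 1]
    by (intro exI[of _ "1 - u"] exI[of _ "1 - l"]) auto
qed

lemma has_integral_reverse_unit:
  fixes f :: "real \<Rightarrow> real"
  assumes "(f has_integral i) {0..1}"
  shows "((\<lambda>t. f (1 - t)) has_integral i) {0..1}"
proof -
  have "(\<lambda>t. 1 - t) ` {0..1 :: real} = {0..1}"
    by (auto simp: image_iff intro!: bexI[of _ "1 - _"])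
  then show ?thesis using has_integral_affinity[of f i 0 1 "-1" 1] assms by simp
qed

lemma moves_project:
  assumes "moves J \<gamma> \<omega> \<rho>" "0 \<le> v" "v \<le> 1"
  shows "moves J (\<lambda>t. (\<gamma> t)(2 := v)) \<omega> (\<lambda>t. 0)"
  using assms by (auto simp: moves_def cyl_def)

lemma piecewise_C1_project:
  assumes "piecewise_C1_curve cmfd \<gamma>" "0 \<le> v" "v \<le> 1"
  shows "piecewise_C1_curve cmfd (\<lambda>t. (\<gamma> t)(2 := v))"
proof -
  obtain N b where b0: "b 0 = 0" "b N = 1" and b1: "\<forall>i<N. b i < b (Suc i) \<and>
      (\<exists>\<omega> \<rho>. moves {b i..b (Suc i)} \<gamma> \<omega> \<rho> \<and>
        continuous_on {b i..b (Suc i)} \<omega> \<and> continuous_on {b i..b (Suc i)} \<rho>)"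
    and cont: "continuous_on {0..1} \<gamma>" "\<gamma> ` {0..1} \<subseteq> cyl"
    using assms(1) unfolding piecewise_C1_curve_cmfd by (elim exE conjE)
  have "\<exists>\<omega> \<rho>. moves {b i..b (Suc i)} (\<lambda>t. (\<gamma> t)(2 := v)) \<omega> \<rho> \<and>
        continuous_on {b i..b (Suc i)} \<omega> \<and> continuous_on {b i..b (Suc i)} \<rho>" if i: "i < N" for i
  proof -
    obtain \<omega> \<rho> where m: "moves {b i..b (Suc i)} \<gamma> \<omega> \<rho>" "continuous_on {b i..b (Suc i)} \<omega>"
      using b1 i by blast
    show ?thesis using moves_project[OF m(1) assms(2,3)] m(2)
      by (intro exI[of _ \<omega>] exI[of _ "\<lambda>t. 0"]) (auto intro: continuous_on_const)
  qed
  moreover have "continuous_on {0..1} (\<lambda>t. (\<gamma> t)(2 := v))"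
  proof (rule continuous_on_coordinatewise_then_product)
    fix i
    show "continuous_on {0..1} (\<lambda>t. ((\<gamma> t)(2 := v)) i)"
      using continuous_on_product_then_coordinatewise[OF cont(1), of i] by (cases "i = 2") auto
  qed
  moreover have "(\<lambda>t. (\<gamma> t)(2 := v)) ` {0..1} \<subseteq> cyl"
    using cont(2) assms(2,3) by (auto simp: cyl_def image_subset_iff)
  ultimately show ?thesis using b0 b1 unfolding piecewise_C1_curve_cmfd
    by (intro conjI exI[of _ N] exI[of _ b]) auto
qed

text \<open>The relation between \<open>G\<close> and \<open>H\<close> is symmetric. Inequalities of
  distances and inclusions of lens data are shown from \<open>G\<close> to \<open>H\<close> and
  become equalities by exchanging the two.\<close>

locale profile_pair = G: profile G + H: profile H for G H +
  assumes swap: "\<And>r. H r = G (1 - r)"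
begin

text \<open>At corresponding regular times the two velocities agree and \<open>H\<close> at the
  reflected height equals \<open>G\<close> at the original one, so the speed of the new curve is the
  old speed read backwards.\<close>

lemma curve_length_flip:
  assumes "c\<^sup>2 + s\<^sup>2 = 1" "piecewise_C1_curve cmfd \<gamma>"
  shows "curve_length cmfd (cmet H) (\<lambda>t. flip c s (\<gamma> (1 - t))) = curve_length cmfd (cmet G) \<gamma>"
proof -
  obtain E where E: "finite E" "\<And>t. t \<in> {0..1} - E \<Longrightarrow> \<exists>\<omega> \<rho>. regular_at \<gamma> \<omega> \<rho> t"
    using finite_irregular[OF assms(2)] by blast
  let ?\<delta> = "\<lambda>t. flip c s (\<gamma> (1 - t))"
  have "speed H ?\<delta> t = speed G \<gamma> (1 - t)" if "t \<in> {0..1} - (\<lambda>t. 1 - t) ` E" for t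
  proof -
    have "1 - t \<notin> E" using that by (auto simp: image_iff)
    then have "1 - t \<in> {0..1} - E" using that by auto
    then obtain \<omega> \<rho> where r: "regular_at \<gamma> \<omega> \<rho> (1 - t)" using E(2) by blast
    show ?thesis
      unfolding speed_regular[OF r] speed_regular[OF regular_at_flip[OF assms(1) r]] by (simp add: swap)
  qed
  then have "(speed H ?\<delta> has_integral curve_length cmfd (cmet G) \<gamma>) {0..1}"
    unfolding curve_length_cmet
    by (rule has_integral_spike_finite[OF finite_imageI[OF E(1)] _
          has_integral_reverse_unit[OF integrable_integral[OF G.speed_integrable[OF assms(2)]]]])
  then show ?thesis unfolding curve_length_cmet[of H] by (rule integral_unique)
qed

text \<open>The projected curve keeps the angular velocity, loses the vertical one, and runs where
  the warping function has the value 1, the lower bound of \<open>G\<close>.\<close>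

lemma curve_length_project:
  assumes "piecewise_C1_curve cmfd \<gamma>" "v = 0 \<or> v = 1"
  shows "curve_length cmfd (cmet H) (\<lambda>t. (\<gamma> t)(2 := v)) \<le> curve_length cmfd (cmet G) \<gamma>"
proof -
  let ?\<delta> = "\<lambda>t. (\<gamma> t)(2 := v)"
  have v: "0 \<le> v" "v \<le> 1" "H v = 1" using assms(2) by auto
  obtain E where E: "finite E" "\<And>t. t \<in> {0..1} - E \<Longrightarrow> \<exists>\<omega> \<rho>. regular_at \<gamma> \<omega> \<rho> t"
    using finite_irregular[OF assms(1)] by blast
  have cyl: "\<gamma> t \<in> cyl" if "t \<in> {0..1}" for t
    using assms(1) that unfolding piecewise_C1_curve_cmfd by blast
  have le: "speed H ?\<delta> t \<le> speed G \<gamma> t" if t: "t \<in> {0..1} - E" for t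
  proof -
    obtain \<omega> \<rho> where r: "regular_at \<gamma> \<omega> \<rho> t" using E(2)[OF t] by blast
    then have r': "regular_at ?\<delta> \<omega> (\<lambda>t. 0) t"
      unfolding regular_at_def using moves_project[OF _ v(1,2)] by blast
    have "(\<omega> t)\<^sup>2 \<le> G (\<gamma> t 2) * (\<omega> t)\<^sup>2"
      using G.pos[OF regular_at_deriv(1)[OF r]] by (simp add: mult_le_cancel_right1)
    then have "(\<omega> t)\<^sup>2 \<le> (\<rho> t)\<^sup>2 + G (\<gamma> t 2) * (\<omega> t)\<^sup>2"
      using zero_le_power2[of "\<rho> t"] by linarith
    then show ?thesis
      unfolding speed_regular[OF r] speed_regular[OF r'] by (intro real_sqrt_le_mono) (simp add: v(3))
  qed
  \<comment> \<open>The speeds are compared at regular times only. Elsewhere the speed is replaced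
    by 0, which keeps its integral and makes the comparison valid at every time.\<close>
  define f where "f t = (if t \<in> E then 0 else speed H ?\<delta> t)" for t
  have "(speed H ?\<delta> has_integral curve_length cmfd (cmet H) ?\<delta>) {0..1}"
    unfolding curve_length_cmet
    using H.speed_integrable[OF piecewise_C1_project[OF assms(1) v(1,2)]] by (rule integrable_integral)
  then have "(f has_integral curve_length cmfd (cmet H) ?\<delta>) {0..1}"
    by (rule has_integral_spike_finite[OF E(1), rotated]) (simp add: f_def)
  moreover have "(speed G \<gamma> has_integral curve_length cmfd (cmet G) \<gamma>) {0..1}"
    unfolding curve_length_cmet using G.speed_integrable[OF assms(1)] by (rule integrable_integral)
  ultimately show ?thesis
    by (rule has_integral_le) (use le G.speed_nonneg cyl in \<open>auto simp: f_def\<close>)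
qed

text \<open>Each curve for \<open>G\<close> has a competitor for \<open>H\<close> with the same end
  points that is not longer. If both points lie at one end, it is the projection to this end;
  otherwise the reflection that exchanges the points is combined with time reversal, which restores
  the direction from \<open>p\<close> to \<open>q\<close>.\<close>

lemma riem_dist_le:
  assumes p: "p \<in> bdry" and q: "q \<in> bdry"
  shows "riem_dist cmfd (cmet H) p q \<le> riem_dist cmfd (cmet G) p q"
  unfolding riem_dist_def
proof (rule INF_mono)
  fix \<gamma> assume "\<gamma> \<in> {\<gamma>. piecewise_C1_curve cmfd \<gamma> \<and> \<gamma> 0 = p \<and> \<gamma> 1 = q}"
  then have \<gamma>: "piecewise_C1_curve cmfd \<gamma>" "\<gamma> 0 = p" "\<gamma> 1 = q" by auto
  have "\<exists>\<delta>. piecewise_C1_curve cmfd \<delta> \<and> \<delta> 0 = p \<and> \<delta> 1 = q \<and>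
      curve_length cmfd (cmet H) \<delta> \<le> curve_length cmfd (cmet G) \<gamma>"
  proof (cases "p 2 = q 2")
    case True
    have v: "p 2 = 0 \<or> p 2 = 1" using p by (auto simp: bdry_def)
    have "(\<gamma> 0)(2 := p 2) = p" "(\<gamma> 1)(2 := p 2) = q" using \<gamma> True by auto
    moreover have "piecewise_C1_curve cmfd (\<lambda>t. (\<gamma> t)(2 := p 2))"
      using v by (intro piecewise_C1_project[OF \<gamma>(1)]) auto
    ultimately show ?thesis using curve_length_project[OF \<gamma>(1) v] by blast
  next
    case False
    then have "q 2 = 1 - p 2" using p q by (auto simp: bdry_def)
    note f = flip_exchange[OF bdry_subset[OF p] bdry_subset[OF q] this]
    show ?thesis
      using piecewise_C1_flip[OF f(1) \<gamma>(1)] curve_length_flip[OF f(1) \<gamma>(1)] f(2,3) \<gamma>(2,3)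
      by (intro exI[of _ "\<lambda>t. flip _ _ (\<gamma> (1 - t))"]) auto
  qed
  then show "\<exists>\<delta>\<in>{\<gamma>. piecewise_C1_curve cmfd \<gamma> \<and> \<gamma> 0 = p \<and> \<gamma> 1 = q}.
      ennreal (curve_length cmfd (cmet H) \<delta>) \<le> ennreal (curve_length cmfd (cmet G) \<gamma>)"
    by (auto intro!: ennreal_leI)
qed

end

lemma (in profile_pair) profile_pair_swap: "profile_pair H G"
  by unfold_locales (simp add: swap)

section \<open>Velocity vectors and lens data\<close>

text \<open>Identifies pairs of reals with points of two-dimensional coordinate space, so that total
  derivatives of functions of the coordinates can be taken on
  \<open>real \<times> real\<close>.\<close>

definition plane :: "real \<times> real \<Rightarrow> nat \<Rightarrow> real" where
  "plane z = (\<lambda>i. if i = 0 then fst z else if i = 1 then snd z else 0)"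

lemma continuous_on_plane: "continuous_on S plane"
proof (rule continuous_on_coordinatewise_then_product)
  fix i
  show "continuous_on S (\<lambda>z. plane z i)"
    unfolding plane_def by (cases "i = 0"; cases "i = 1") (auto intro!: continuous_intros)
qed

text \<open>\<open>Ck_on\<close> speaks of partial derivatives only, while a chain rule along a
  curve requires a total derivative. The latter exists since one partial derivative exists at the
  point and the other one is continuous around it. This works up to the boundary of the
  half-space.\<close>

lemma C1_partials_chain:
  fixes F :: "(nat \<Rightarrow> real) \<Rightarrow> real"
  assumes S: "openin (half_space 2) S" and F: "Ck_on (Suc 0) 2 S F" and t: "t \<in> J" "x t \<in> S"
    and ev: "\<forall>\<^sub>F s in at t within J. 0 \<le> x s 1 \<and> (\<forall>i\<ge>2. x s i = 0)"
    and d0: "((\<lambda>s. x s 0) has_real_derivative a) (at t within J)"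
    and d1: "((\<lambda>s. x s 1) has_real_derivative b) (at t within J)"
  shows "((\<lambda>s. F (x s)) has_real_derivative a * partial_in S 0 F (x t) + b * partial_in S 1 F (x t)) (at t within J)"
proof -
  obtain W where W: "open W" "S = {x. (\<forall>i\<ge>2. x i = 0) \<and> 0 \<le> x 1} \<inter> W"
    using S by (auto simp: half_space_top_of_set openin_open)
  define u0 v0 where "u0 = x t 0" and "v0 = x t 1"
  have xt: "x t = plane (u0, v0)" "0 \<le> v0" using t(2) by (auto simp: W(2) plane_def u0_def v0_def intro!: fun_eq_2I)
  have "open (plane -` W)"
    using W(1) continuous_on_plane[of UNIV] by (metis continuous_on_open_vimage open_UNIV inf_top_right)
  moreover have "(u0, v0) \<in> plane -` W" using t(2) xt(1) by (simp add: W(2))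
  ultimately obtain A B where AB: "open A" "open B" "u0 \<in> A" "v0 \<in> B" "A \<times> B \<subseteq> plane -` W"
    by (metis open_prod_elim mem_Sigma_iff)
  obtain e where e: "0 < e" "ball u0 e \<subseteq> A" using AB(1,3) open_contains_ball by blast
  obtain e' where e': "0 < e'" "ball v0 e' \<subseteq> B" using AB(2,4) open_contains_ball by blast
  \<comment> \<open>A product of intervals on which \<open>F\<close> is defined, with the vertical
    one cut off at height 0. The cut interval is still convex, as the mean value argument in the
    vertical direction requires.\<close>
  define I K where "I = ball u0 e" and "K = ball v0 e' \<inter> {0..}"
  have IK: "plane (u, v) \<in> S" if "u \<in> I" "v \<in> K" for u v
    using that AB(5) e(2) e'(2) by (auto simp: I_def K_def W(2) plane_def subset_iff)
  have mem: "u0 \<in> I" "v0 \<in> K" using e(1) e'(1) xt(2) by (auto simp: I_def K_def)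
  have thick: "thick 2 S" by (rule thick_half_space[OF S])
  have part: "((\<lambda>r. F (y(i := r))) has_vector_derivative partial_in S i F y) (at (y i) within coord_slice S i y)"
    if "y \<in> S" "i < 2" for y i
    using Ck_on_differentiable[OF F that(2,1)] unfolding vector_derivative_works partial_in_def .
  have upd: "(plane (u, v))(0 := r) = plane (r, v)" "(plane (u, v))(1 := r) = plane (u, r)" for u v r
    by (auto simp: plane_def)
  have fx: "((\<lambda>u. F (plane (u, v0))) has_derivative (\<lambda>h. h * partial_in S 0 F (x t))) (at u0 within I)"
  proof -
    have "((\<lambda>r. F (plane (r, v0))) has_vector_derivative partial_in S 0 F (x t)) (at u0 within coord_slice S 0 (x t))"
      using part[OF t(2), of 0] unfolding xt(1) upd by (simp add: plane_def)
    then have "((\<lambda>r. F (plane (r, v0))) has_vector_derivative partial_in S 0 F (x t)) (at u0 within I)"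
      by (rule has_vector_derivative_within_subset) (use IK mem in \<open>auto simp: coord_slice_def xt(1) upd\<close>)
    then show ?thesis by (simp add: has_vector_derivative_def)
  qed
  have fy: "((\<lambda>v. F (plane (u, v))) has_derivative blinfun_apply (blinfun_scaleR_left (partial_in S 1 F (plane (u, v)))))
      (at v within K)" if "u \<in> I" "v \<in> K" for u v
  proof -
    have "((\<lambda>r. F (plane (u, r))) has_vector_derivative partial_in S 1 F (plane (u, v))) (at v within coord_slice S 1 (plane (u, v)))"
      using part[OF IK[OF that], of 1] unfolding upd by (simp add: plane_def)
    then have "((\<lambda>r. F (plane (u, r))) has_vector_derivative partial_in S 1 F (plane (u, v))) (at v within K)"
      by (rule has_vector_derivative_within_subset) (use IK that in \<open>auto simp: coord_slice_def upd simp del: One_nat_def\<close>)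
    then show ?thesis by (simp add: has_vector_derivative_def)
  qed
  have "continuous_on S (partial_in S 1 F)" using F by simp
  then have "continuous_on (I \<times> K) (\<lambda>z. partial_in S 1 F (plane z))"
    by (rule continuous_on_compose2[OF _ continuous_on_plane]) (use IK in auto)
  then have "continuous_on (I \<times> K) (\<lambda>z. blinfun_scaleR_left (partial_in S 1 F (plane z)))"
    by (rule bounded_linear.continuous_on[OF bounded_linear_blinfun_scaleR_left])
  then have fyc: "continuous (at (u0, v0) within I \<times> K) (\<lambda>(u, v). blinfun_scaleR_left (partial_in S 1 F (plane (u, v))))"
    using mem by (simp add: continuous_on_eq_continuous_within case_prod_unfold)
  have "convex K" unfolding K_def by (intro convex_Int convex_ball convex_real_interval)
  from has_derivative_partialsI[OF fx fy fyc mem(2) this]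
  have D: "((\<lambda>z. F (plane z)) has_derivative (\<lambda>(h, k). h * partial_in S 0 F (x t) + k * partial_in S 1 F (x t)))
      (at (u0, v0) within I \<times> K)"
    by (simp add: case_prod_unfold xt(1))
  have lim: "((\<lambda>s. x s 0) \<longlongrightarrow> u0) (at t within J)" "((\<lambda>s. x s 1) \<longlongrightarrow> v0) (at t within J)"
    using DERIV_continuous[OF d0] DERIV_continuous[OF d1] by (simp_all add: continuous_within u0_def v0_def)
  have "\<forall>\<^sub>F s in at t within J. x s 0 \<in> I"
    unfolding I_def by (rule topological_tendstoD[OF lim(1) open_ball]) (simp add: e(1))
  moreover have "\<forall>\<^sub>F s in at t within J. x s 1 \<in> ball v0 e'"
    by (rule topological_tendstoD[OF lim(2) open_ball]) (simp add: e'(1))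
  ultimately have "\<forall>\<^sub>F s in at t within J. x s = plane (x s 0, x s 1) \<and> (x s 0, x s 1) \<in> I \<times> K"
    using ev by eventually_elim (auto simp: K_def plane_def intro!: fun_eq_2I)
  then obtain U where U: "open U" "t \<in> U"
    "\<forall>s\<in>U. s \<noteq> t \<longrightarrow> s \<in> J \<longrightarrow> x s = plane (x s 0, x s 1) \<and> (x s 0, x s 1) \<in> I \<times> K"
    unfolding eventually_at_topological by blast
  have U': "x s = plane (x s 0, x s 1)" "(x s 0, x s 1) \<in> I \<times> K" if "s \<in> J \<inter> U" for s
    using U(3) that xt(1) mem by (auto simp: u0_def v0_def)
  \<comment> \<open>Shrinking the time set to \<open>U\<close> keeps the filter at \<open>t\<close>
    and ensures that all curve points come from the box \<open>I \<times> K\<close>.\<close>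
  have at: "at t within J \<inter> U = at t within J"
    by (rule at_within_nhd[OF U(2,1)]) auto
  have "((\<lambda>s. (x s 0, x s 1)) has_derivative (\<lambda>h. (h * a, h * b))) (at t within J \<inter> U)"
    using d0 d1 unfolding at has_field_derivative_def
    by (intro has_derivative_Pair) (simp_all add: mult_commute_abs)
  moreover have "((\<lambda>z. F (plane z)) has_derivative (\<lambda>(h, k). h * partial_in S 0 F (x t) + k * partial_in S 1 F (x t)))
      (at (x t 0, x t 1) within (\<lambda>s. (x s 0, x s 1)) ` (J \<inter> U))"
    by (rule has_derivative_subset[OF D[unfolded u0_def v0_def]]) (use U'(2) in blast)
  ultimately have "((\<lambda>s. F (plane (x s 0, x s 1))) has_derivative
      (\<lambda>h. case (h * a, h * b) of (h, k) \<Rightarrow> h * partial_in S 0 F (x t) + k * partial_in S 1 F (x t))) (at t within J \<inter> U)"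
    by (rule has_derivative_in_compose)
  then have "((\<lambda>s. F (plane (x s 0, x s 1))) has_real_derivative
      a * partial_in S 0 F (x t) + b * partial_in S 1 F (x t)) (at t within J \<inter> U)"
    unfolding has_field_derivative_def by (rule has_derivative_eq_rhs) (auto simp: algebra_simps)
  then have "((\<lambda>s. F (x s)) has_real_derivative
      a * partial_in S 0 F (x t) + b * partial_in S 1 F (x t)) (at t within J \<inter> U)"
    by (rule has_field_derivative_transform_within[where d = 1]) (use U'(1)[symmetric] t U(2) in auto)
  then show ?thesis unfolding at .
qed

text \<open>Equality of derivations involves arbitrary smooth test functions, beyond the ambient
  coordinates that sufficed for lengths. In a chart the chain rule splits the derivative along the
  curve into the two coordinate derivations, and the signs at the upper end cancel.\<close>

lemma velocity_moves:
  assumes m: "moves {l..u} \<gamma> \<omega> \<rho>" and lu: "l < u" and t: "t \<in> {l..u}"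
  shows "velocity cmfd {l..u} \<gamma> t = tv (\<gamma> t) (\<omega> t) (\<rho> t)"
proof
  fix f
  have cyl: "\<gamma> t \<in> cyl" by (rule movesD(1)[OF m t])
  show "velocity cmfd {l..u} \<gamma> t f = tv (\<gamma> t) (\<omega> t) (\<rho> t) f"
  proof (cases "f \<in> smooth_near cmfd (\<gamma> t)")
    case True
    obtain a e where c: "\<gamma> t \<in> fst (cch a e 1)" using ex_cch1[OF cyl] by blast
    obtain T where T: "open T" "\<gamma> t \<in> T"
      "\<forall>a e k. Ck_on k 2 {x \<in> box2 1. cinv a e x \<in> T} (\<lambda>x. f (chart_inv (cch a e 1) x))"
      by (rule smooth_near_chart[OF True])
    define F where "F = (\<lambda>x. f (chart_inv (cch a e 1) x))"
    define x where "x s = snd (cch a e 1) (\<gamma> s)" for s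
    define S where "S = {x \<in> box2 1. cinv a e x \<in> cyl \<inter> T}"
    have S': "S = box2 1 \<inter> cinv a e -` T"
      using coords_cinv(1)[of _ 1 a e] by (auto simp: S_def cch_fst)
    have S: "openin (half_space 2) S"
      unfolding S_def using T(1) by (intro openin_box2_preimage) (auto simp: openin_open)
    have "{x \<in> box2 1. cinv a e x \<in> T} = S" unfolding S' by auto
    then have F: "Ck_on (Suc 0) 2 S F"
      using T(3)[rule_format, of "Suc 0" a e] unfolding F_def by (simp only:)
    have xt: "x t \<in> box2 1" "cinv a e (x t) = \<gamma> t" using cinv_coords[OF c] by (simp_all add: x_def)
    then have xS: "x t \<in> S" using T(2) by (simp add: S')
    have "\<gamma> ` {l..u} \<subseteq> cyl" using movesD(1)[OF m] by blast
    from eventually_in_cch[OF moves_continuous[OF m] this t c]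
    have ev: "\<forall>\<^sub>F s in at t within {l..u}. \<gamma> s \<in> fst (cch a e 1)" .
    then have ev': "\<forall>\<^sub>F s in at t within {l..u}. 0 \<le> x s 1 \<and> (\<forall>i\<ge>2. x s i = 0)"
    proof eventually_elim
      case (elim s)
      then show ?case using cinv_coords(1)[OF elim] by (simp add: x_def box2_def)
    qed
    have D: "((\<lambda>s. F (x s)) has_real_derivative
        \<omega> t * partial_in S 0 F (x t) + (if e then - \<rho> t else \<rho> t) * partial_in S 1 F (x t)) (at t within {l..u})"
      by (rule C1_partials_chain[OF S F t xS ev'])
         (use chart_velocity[OF m t c] in \<open>simp_all add: x_def\<close>)
    have "open (cinv a e -` T)"
      using T(1) continuous_on_cinv[of UNIV a e] by (metis continuous_on_open_vimage open_UNIV inf_top_right)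
    then have "partial_in S i F (x t) = partial_in (box2 1) i F (x t)" for i
      unfolding partial_in_def S' using at_within_coord_slice_Int[of "cinv a e -` T" "x t"] xt T(2) by simp
    then have "partial_in S i F (x t) = coord_vec cmfd (cch a e 1) i (\<gamma> t) f" for i
      using True by (simp add: coord_vec_def chart_image_cch F_def x_def)
    then have p: "partial_in S 0 F (x t) = dth cmfd (\<gamma> t) f"
      "partial_in S 1 F (x t) = (if e then -1 else 1) * drr (\<gamma> t) f"
      using coord_vec_angle[OF c order_refl] coord_vec_height[OF c order_refl] by simp_all
    have eq: "\<omega> t * partial_in S 0 F (x t) + (if e then - \<rho> t else \<rho> t) * partial_in S 1 F (x t)
        = tv (\<gamma> t) (\<omega> t) (\<rho> t) f"
      unfolding p tv_def by simp
    have "\<forall>\<^sub>F s in at t within {l..u}. F (x s) = f (\<gamma> s)"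
      using ev by eventually_elim (simp add: F_def x_def chart_inv_coords)
    then have "((\<lambda>s. f (\<gamma> s)) has_real_derivative tv (\<gamma> t) (\<omega> t) (\<rho> t) f) (at t within {l..u})"
      using D has_field_derivative_cong_eventually[of "\<lambda>s. F (x s)" "\<lambda>s. f (\<gamma> s)" t "{l..u}"]
      unfolding eq by (simp add: F_def x_def chart_inv_coords[OF c])
    from vector_derivative_Icc[OF this t lu] show ?thesis
      using True by (simp add: velocity_def)
  qed (simp add: velocity_def tv_def dth_def drr_def)
qed

section \<open>Geodesics that join boundary points\<close>

definition inner_curve :: "real \<Rightarrow> (real \<Rightarrow> nat \<Rightarrow> real) \<Rightarrow> bool" where
  "inner_curve T \<gamma> \<longleftrightarrow> \<gamma> 0 \<in> bdry \<and> \<gamma> T \<in> bdry \<and> (\<forall>t\<in>{0<..<T}. \<gamma> t \<notin> bdry)"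

context profile
begin

text \<open>For a starting point on the boundary exactly one \<open>e\<close> satisfies
  \<open>hgt e (\<gamma> 0) = 0\<close>, and the last conjunct says that the scalar product of the
  initial velocity with the inward normal of that end is positive.\<close>

definition lens_geodesic :: "real \<Rightarrow> (real \<Rightarrow> nat \<Rightarrow> real) \<Rightarrow> (real \<Rightarrow> real) \<Rightarrow> (real \<Rightarrow> real) \<Rightarrow> bool" where
  "lens_geodesic T \<gamma> \<omega> \<rho> \<longleftrightarrow> 0 < T \<and> geo_path {0..T} \<gamma> \<omega> \<rho> \<and> inner_curve T \<gamma> \<and>
     (\<forall>t\<in>{0..T}. (\<rho> t)\<^sup>2 + G (\<gamma> t 2) * (\<omega> t)\<^sup>2 = 1) \<and>
     (\<forall>e. hgt e (\<gamma> 0) = 0 \<longrightarrow> 0 < (if e then - \<rho> 0 else \<rho> 0))"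

lemma lens_set_cmet:
  "lens_set cmfd (cmet G) = {((\<gamma> 0, tv (\<gamma> 0) (\<omega> 0) (\<rho> 0)), (\<gamma> T, tv (\<gamma> T) (\<omega> T) (\<rho> T)), T) | \<gamma> \<omega> \<rho> T.
     lens_geodesic T \<gamma> \<omega> \<rho>}"
proof -
  have key: "(0 < T \<and> unit_speed_geodesic cmfd (cmet G) {0..T} \<gamma> \<and>
     \<gamma> 0 \<in> boundary_pts cmfd \<and> 0 < cmet G (\<gamma> 0) (velocity cmfd {0..T} \<gamma> 0) (inward_normal cmfd (cmet G) (\<gamma> 0)) \<and>
     \<gamma> T \<in> boundary_pts cmfd \<and> (\<forall>t\<in>{0<..<T}. \<gamma> t \<notin> boundary_pts cmfd)) \<longleftrightarrow>
     (\<exists>\<omega> \<rho>. lens_geodesic T \<gamma> \<omega> \<rho>)" for T \<gamma>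
  \<comment> \<open>The inward normal has been computed at boundary points only. If the curve does
    not run between boundary points in this way, both sides are false.\<close>
  proof (cases "0 < T \<and> inner_curve T \<gamma>")
    case True
    then have T: "0 < T" and in0: "\<gamma> 0 \<in> bdry" by (auto simp: inner_curve_def)
    obtain e where e: "hgt e (\<gamma> 0) = 0" using in0 by (rule bdry_cases)
    have e': "hgt e' (\<gamma> 0) = 0 \<longleftrightarrow> e' = e" for e' using e by (auto simp: hgt_def split: if_splits)
    have "((\<forall>t\<in>{0..T}. cmet G (\<gamma> t) (velocity cmfd {0..T} \<gamma> t) (velocity cmfd {0..T} \<gamma> t) = 1) \<and>
        0 < cmet G (\<gamma> 0) (velocity cmfd {0..T} \<gamma> 0) (inward_normal cmfd (cmet G) (\<gamma> 0))) \<longleftrightarrow>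
        (\<forall>t\<in>{0..T}. (\<rho> t)\<^sup>2 + G (\<gamma> t 2) * (\<omega> t)\<^sup>2 = 1) \<and>
        (\<forall>e. hgt e (\<gamma> 0) = 0 \<longrightarrow> 0 < (if e then - \<rho> 0 else \<rho> 0))" if g: "geo_path {0..T} \<gamma> \<omega> \<rho>" for \<omega> \<rho>
    proof -
      have m: "moves {0..T} \<gamma> \<omega> \<rho>" using g by (simp add: geo_path_def)
      have v: "velocity cmfd {0..T} \<gamma> t = tv (\<gamma> t) (\<omega> t) (\<rho> t)" if "t \<in> {0..T}" for t
        by (rule velocity_moves[OF m T that])
      have "cmet G (\<gamma> t) (velocity cmfd {0..T} \<gamma> t) (velocity cmfd {0..T} \<gamma> t) = (\<rho> t)\<^sup>2 + G (\<gamma> t 2) * (\<omega> t)\<^sup>2"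
        if "t \<in> {0..T}" for t
        unfolding v[OF that] by (simp add: cmet_tv[OF movesD(1)[OF m that]] power2_eq_square)
      moreover have "cmet G (\<gamma> 0) (velocity cmfd {0..T} \<gamma> 0) (inward_normal cmfd (cmet G) (\<gamma> 0))
          = (if e then - \<rho> 0 else \<rho> 0)"
        using v[of 0] T by (simp add: cmet_tv[OF bdry_subset[OF in0]] inward_normal_cmet[OF in0 e])
      ultimately show ?thesis unfolding e' by simp
    qed
    then show ?thesis
      using True unfolding unit_speed_geodesic_def geodesic_cmfd[OF T] boundary_pts_cmfd lens_geodesic_def inner_curve_def
      by blast
  next
    case False
    then show ?thesis unfolding boundary_pts_cmfd lens_geodesic_def inner_curve_def by blast
  qed
  have v: "velocity cmfd {0..T} \<gamma> 0 = tv (\<gamma> 0) (\<omega> 0) (\<rho> 0)" "velocity cmfd {0..T} \<gamma> T = tv (\<gamma> T) (\<omega> T) (\<rho> T)"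
    if "lens_geodesic T \<gamma> \<omega> \<rho>" for T \<gamma> \<omega> \<rho>
    using that unfolding lens_geodesic_def geo_path_def by (auto intro!: velocity_moves)
  show ?thesis unfolding lens_set_def key
  proof (intro set_eqI iffI)
    fix X
    assume "X \<in> {((\<gamma> 0, velocity cmfd {0..T} \<gamma> 0), (\<gamma> T, velocity cmfd {0..T} \<gamma> T), T) | \<gamma> T.
      \<exists>\<omega> \<rho>. lens_geodesic T \<gamma> \<omega> \<rho>}"
    then obtain \<gamma> T \<omega> \<rho> where *: "X = ((\<gamma> 0, velocity cmfd {0..T} \<gamma> 0), (\<gamma> T, velocity cmfd {0..T} \<gamma> T), T)"
      "lens_geodesic T \<gamma> \<omega> \<rho>" by blast
    show "X \<in> {((\<gamma> 0, tv (\<gamma> 0) (\<omega> 0) (\<rho> 0)), (\<gamma> T, tv (\<gamma> T) (\<omega> T) (\<rho> T)), T) | \<gamma> \<omega> \<rho> T.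
       lens_geodesic T \<gamma> \<omega> \<rho>}"
      using *(2) unfolding *(1) v[OF *(2)] by blast
  next
    fix X
    assume "X \<in> {((\<gamma> 0, tv (\<gamma> 0) (\<omega> 0) (\<rho> 0)), (\<gamma> T, tv (\<gamma> T) (\<omega> T) (\<rho> T)), T) | \<gamma> \<omega> \<rho> T.
       lens_geodesic T \<gamma> \<omega> \<rho>}"
    then obtain \<gamma> T \<omega> \<rho> where *: "X = ((\<gamma> 0, tv (\<gamma> 0) (\<omega> 0) (\<rho> 0)), (\<gamma> T, tv (\<gamma> T) (\<omega> T) (\<rho> T)), T)"
      "lens_geodesic T \<gamma> \<omega> \<rho>" by blast
    show "X \<in> {((\<gamma> 0, velocity cmfd {0..T} \<gamma> 0), (\<gamma> T, velocity cmfd {0..T} \<gamma> T), T) | \<gamma> T.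
      \<exists>\<omega> \<rho>. lens_geodesic T \<gamma> \<omega> \<rho>}"
      using *(2) unfolding *(1) v[OF *(2), symmetric] by blast
  qed
qed

lemma projected_lens_set_cmet:
  "projected_lens_set cmfd (cmet G) = {((\<gamma> 0, btv (\<gamma> 0) (\<omega> 0)), (\<gamma> T, btv (\<gamma> T) (\<omega> T)), T) | \<gamma> \<omega> \<rho> T.
     lens_geodesic T \<gamma> \<omega> \<rho>}"
proof -
  have t: "tangential_part cmfd (cmet G) (\<gamma> 0, tv (\<gamma> 0) (\<omega> 0) (\<rho> 0)) = (\<gamma> 0, btv (\<gamma> 0) (\<omega> 0))"
    "tangential_part cmfd (cmet G) (\<gamma> T, tv (\<gamma> T) (\<omega> T) (\<rho> T)) = (\<gamma> T, btv (\<gamma> T) (\<omega> T))"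
    if "lens_geodesic T \<gamma> \<omega> \<rho>" for T \<gamma> \<omega> \<rho>
    using that by (auto simp: lens_geodesic_def inner_curve_def intro!: tangential_part_cmet)
  show ?thesis unfolding projected_lens_set_def lens_set_cmet
  proof (intro set_eqI iffI)
    fix X
    assume "X \<in> (\<lambda>(X, Y, T). (tangential_part cmfd (cmet G) X, tangential_part cmfd (cmet G) Y, T)) `
      {((\<gamma> 0, tv (\<gamma> 0) (\<omega> 0) (\<rho> 0)), (\<gamma> T, tv (\<gamma> T) (\<omega> T) (\<rho> T)), T) | \<gamma> \<omega> \<rho> T.
       lens_geodesic T \<gamma> \<omega> \<rho>}"
    then obtain \<gamma> T \<omega> \<rho> where *: "lens_geodesic T \<gamma> \<omega> \<rho>" "X =
        (tangential_part cmfd (cmet G) (\<gamma> 0, tv (\<gamma> 0) (\<omega> 0) (\<rho> 0)),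
         tangential_part cmfd (cmet G) (\<gamma> T, tv (\<gamma> T) (\<omega> T) (\<rho> T)), T)" by auto
    show "X \<in> {((\<gamma> 0, btv (\<gamma> 0) (\<omega> 0)), (\<gamma> T, btv (\<gamma> T) (\<omega> T)), T) | \<gamma> \<omega> \<rho> T.
     lens_geodesic T \<gamma> \<omega> \<rho>}"
      using *(1) unfolding *(2) t[OF *(1)] by blast
  next
    fix X
    assume "X \<in> {((\<gamma> 0, btv (\<gamma> 0) (\<omega> 0)), (\<gamma> T, btv (\<gamma> T) (\<omega> T)), T) | \<gamma> \<omega> \<rho> T.
     lens_geodesic T \<gamma> \<omega> \<rho>}"
    then obtain \<gamma> T \<omega> \<rho> where *: "lens_geodesic T \<gamma> \<omega> \<rho>"
      "X = ((\<gamma> 0, btv (\<gamma> 0) (\<omega> 0)), (\<gamma> T, btv (\<gamma> T) (\<omega> T)), T)" by blast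
    have "((\<gamma> 0, tv (\<gamma> 0) (\<omega> 0) (\<rho> 0)), (\<gamma> T, tv (\<gamma> T) (\<omega> T) (\<rho> T)), T) \<in>
      {((\<gamma> 0, tv (\<gamma> 0) (\<omega> 0) (\<rho> 0)), (\<gamma> T, tv (\<gamma> T) (\<omega> T) (\<rho> T)), T) | \<gamma> \<omega> \<rho> T.
       lens_geodesic T \<gamma> \<omega> \<rho>}" using *(1) by blast
    then show "X \<in> (\<lambda>(X, Y, T). (tangential_part cmfd (cmet G) X, tangential_part cmfd (cmet G) Y, T)) `
      {((\<gamma> 0, tv (\<gamma> 0) (\<omega> 0) (\<rho> 0)), (\<gamma> T, tv (\<gamma> T) (\<omega> T) (\<rho> T)), T) | \<gamma> \<omega> \<rho> T.
       lens_geodesic T \<gamma> \<omega> \<rho>}"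
      by (rule rev_image_eqI) (simp add: *(2) t[OF *(1)])
  qed
qed

text \<open>A zero of \<open>\<rho>\<close> would be a turning point, and Clairaut's relation
  excludes it for a transversal start. The height therefore changes monotonically from one end to
  the other, where the warping function is again 1 and the angular velocity equals the angular
  momentum. The third fact makes the flipped geodesic enter at its start.\<close>

lemma lens_geodesic_facts:
  assumes "lens_geodesic T \<gamma> \<omega> \<rho>"
  shows "\<omega> T = \<omega> 0" "\<gamma> T 2 = 1 - \<gamma> 0 2" "0 < \<rho> 0 * \<rho> T"
proof -
  have T: "0 < T" and g: "geo_path {0..T} \<gamma> \<omega> \<rho>"
    and b: "\<gamma> 0 \<in> bdry" "\<gamma> T \<in> bdry"
    and unit: "\<And>t. t \<in> {0..T} \<Longrightarrow> (\<rho> t)\<^sup>2 + G (\<gamma> t 2) * (\<omega> t)\<^sup>2 = 1"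
    and inward: "\<And>e. hgt e (\<gamma> 0) = 0 \<Longrightarrow> 0 < (if e then - \<rho> 0 else \<rho> 0)"
    using assms by (auto simp: lens_geodesic_def inner_curve_def)
  have m: "moves {0..T} \<gamma> \<omega> \<rho>" using g by (simp add: geo_path_def)
  have Gb: "G (\<gamma> 0 2) = 1" "G (\<gamma> T 2) = 1" using b by (auto simp: bdry_def)
  define L where "L = \<omega> 0"
  have clairaut: "G (\<gamma> t 2) * \<omega> t = L" if t: "t \<in> {0..T}" for t
  proof -
    have "((\<lambda>s. G (\<gamma> s 2) * \<omega> s) has_real_derivative 0) (at s within {0..T})" if s: "s \<in> {0..T}" for s
    proof -
      have "G (\<gamma> s 2) \<noteq> 0" using pos[OF movesD(1)[OF m s]] by linarith
      moreover have "((\<lambda>s. G (\<gamma> s 2)) has_real_derivative deriv G (\<gamma> s 2) * \<rho> s) (at s within {0..T})"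
        by (rule DERIV_chain2[OF has_deriv movesD(5)[OF m s]])
      moreover have "(\<omega> has_real_derivative - (deriv G (\<gamma> s 2) * \<rho> s * \<omega> s / G (\<gamma> s 2))) (at s within {0..T})"
        using g s by (simp add: geo_path_def)
      ultimately show ?thesis
        by (auto intro!: derivative_eq_intros)
    qed
    then obtain c where c: "\<And>s. s \<in> {0..T} \<Longrightarrow> G (\<gamma> s 2) * \<omega> s = c"
      using has_field_derivative_zero_constant[of "{0..T}" "\<lambda>s. G (\<gamma> s 2) * \<omega> s"] by auto
    show ?thesis using c[OF t] c[of 0] T Gb(1) by (simp add: L_def)
  qed
  show "\<omega> T = \<omega> 0" using clairaut[of T] T Gb(2) by (simp add: L_def)
  obtain e where "hgt e (\<gamma> 0) = 0" using b(1) by (rule bdry_cases)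
  then have "\<rho> 0 \<noteq> 0" using inward[of e] by (cases e) auto
  \<comment> \<open>At the start \<open>G\<close> is 1, so unit speed reads
    \<open>(\<rho> 0)^2 + L^2 = 1\<close>; transversal entry makes the bound for \<open>L\<close>
    strict.\<close>
  then have L: "L\<^sup>2 < 1" using unit[of 0] T Gb(1) by (simp add: L_def) (smt (verit) zero_less_power2)
  \<comment> \<open>With \<open>\<rho> t = 0\<close> unit speed gives G \<omega>^2 = 1, hence L^2 =
    G (G \<omega>^2) = G \<ge> 1.\<close>
  have nz: "\<rho> t \<noteq> 0" if t: "t \<in> {0..T}" for t
  proof
    assume "\<rho> t = 0"
    then have "G (\<gamma> t 2) * (\<omega> t)\<^sup>2 = 1" using unit[OF t] by simp
    moreover have "L\<^sup>2 = G (\<gamma> t 2) * (G (\<gamma> t 2) * (\<omega> t)\<^sup>2)"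
      using clairaut[OF t] by (simp add: power2_eq_square mult_ac flip: clairaut[OF t])
    ultimately show False using L pos[OF movesD(1)[OF m t]] by simp
  qed
  \<comment> \<open>By the mean value theorem a return to the initial height would force a zero of
    \<open>\<rho>\<close>. Both heights are 0 or 1, so the final one is the opposite one.\<close>
  obtain z where z: "z \<in> {0<..<T}" "\<gamma> T 2 - \<gamma> 0 2 = (T - 0) * \<rho> z"
    using mvt_simple[OF T, of "\<lambda>s. \<gamma> s 2" "\<lambda>t. (*) (\<rho> t)"] movesD(5)[OF m]
    unfolding has_field_derivative_def by (auto simp: mult.commute[of T])
  then have "\<gamma> T 2 \<noteq> \<gamma> 0 2" using nz[of z] T by auto
  then show "\<gamma> T 2 = 1 - \<gamma> 0 2" using b by (auto simp: bdry_def)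
  have cont: "continuous_on {0..T} \<rho>"
    using g unfolding geo_path_def by (intro DERIV_continuous_on) blast
  show "0 < \<rho> 0 * \<rho> T"
  proof (rule ccontr)
    assume "\<not> 0 < \<rho> 0 * \<rho> T"
    then have "\<rho> 0 \<le> 0 \<and> 0 \<le> \<rho> T \<or> \<rho> T \<le> 0 \<and> 0 \<le> \<rho> 0"
      by (auto simp: zero_less_mult_iff not_less)
    then obtain t where "0 \<le> t" "t \<le> T" "\<rho> t = 0"
      using IVT'[of \<rho> 0 0 T] IVT2'[of \<rho> T 0 0] T cont by auto
    then show False using nz[of t] by simp
  qed
qed

end

section \<open>Mirror images of geodesics and equality of the lens data\<close>

context profile_pair
begin

text \<open>The end points lie at opposite ends, as required for a reflection that exchanges them,
  so the reversed image runs between the same points. Initial and final angular velocity coincide,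
  hence their exchange by the time reversal is not visible.\<close>

lemma lens_geodesic_flip:
  assumes lens: "G.lens_geodesic T \<gamma> \<omega> \<rho>"
  shows "\<exists>\<delta> \<omega>' \<rho>'. H.lens_geodesic T \<delta> \<omega>' \<rho>' \<and> \<delta> 0 = \<gamma> 0 \<and> \<delta> T = \<gamma> T \<and> \<omega>' 0 = \<omega> 0 \<and> \<omega>' T = \<omega> T"
proof -
  note f = G.lens_geodesic_facts[OF lens]
  have T: "0 < T" and g: "G.geo_path {0..T} \<gamma> \<omega> \<rho>"
    and b: "\<gamma> 0 \<in> bdry" "\<gamma> T \<in> bdry" "\<And>t. t \<in> {0<..<T} \<Longrightarrow> \<gamma> t \<notin> bdry"
    and unit: "\<And>t. t \<in> {0..T} \<Longrightarrow> (\<rho> t)\<^sup>2 + G (\<gamma> t 2) * (\<omega> t)\<^sup>2 = 1"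
    and inward: "\<And>e. hgt e (\<gamma> 0) = 0 \<Longrightarrow> 0 < (if e then - \<rho> 0 else \<rho> 0)"
    using lens by (auto simp: G.lens_geodesic_def inner_curve_def)
  have m: "moves {0..T} \<gamma> \<omega> \<rho>" using g by (simp add: G.geo_path_def)
  define c s where "c = \<gamma> 0 0 * \<gamma> T 0 - \<gamma> 0 1 * \<gamma> T 1" and "s = \<gamma> 0 0 * \<gamma> T 1 + \<gamma> 0 1 * \<gamma> T 0"
  note ex = flip_exchange[OF bdry_subset[OF b(1)] bdry_subset[OF b(2)] f(2), folded c_def s_def]
  define \<delta> where "\<delta> = (\<lambda>t. flip c s (\<gamma> (T - t)))"
  have ends: "\<delta> 0 = \<gamma> 0" "\<delta> T = \<gamma> T" using ex(2,3) by (simp_all add: \<delta>_def)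
  \<comment> \<open>This sign and the sign that time reversal gives to the derivatives of
    \<open>\<omega>\<close> and \<open>\<rho>\<close> cancel in both geodesic equations.\<close>
  have dH: "deriv H (1 - r) = - deriv G r" for r
  proof (rule DERIV_imp_deriv)
    have H: "H = (\<lambda>r. G (1 - r))" using swap by auto
    have "((\<lambda>r. 1 - r) has_real_derivative -1) (at (1 - r))" by (auto intro!: derivative_eq_intros)
    from DERIV_chain2[OF G.has_deriv this] show "(H has_real_derivative - deriv G r) (at (1 - r))"
      by (simp add: H)
  qed
  have Hd: "H (\<delta> t 2) = G (\<gamma> (T - t) 2)" for t by (simp add: \<delta>_def swap)
  have m': "moves {0..T} \<delta> (\<lambda>t. \<omega> (T - t)) (\<lambda>t. \<rho> (T - t))"
    using moves_flip[OF ex(1) m, of T] by (simp add: \<delta>_def)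
  have "H.geo_path {0..T} \<delta> (\<lambda>t. \<omega> (T - t)) (\<lambda>t. \<rho> (T - t))"
    unfolding H.geo_path_def
  proof (intro conjI ballI m')
    fix t assume "t \<in> {0..T}"
    then have "T - t \<in> {0..T}" by auto
    then have "(\<omega> has_real_derivative - (deriv G (\<gamma> (T - t) 2) * \<rho> (T - t) * \<omega> (T - t) / G (\<gamma> (T - t) 2))) (at (T - t) within {0..T})"
      "(\<rho> has_real_derivative deriv G (\<gamma> (T - t) 2) * (\<omega> (T - t))\<^sup>2 / 2) (at (T - t) within {0..T})"
      using g unfolding G.geo_path_def by blast+
    note d = this[THEN has_real_derivative_reverse]
    show "((\<lambda>t. \<omega> (T - t)) has_real_derivative - (deriv H (\<delta> t 2) * \<rho> (T - t) * \<omega> (T - t) / H (\<delta> t 2))) (at t within {0..T})"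
      unfolding Hd using d(1) by (simp add: \<delta>_def dH)
    show "((\<lambda>t. \<rho> (T - t)) has_real_derivative deriv H (\<delta> t 2) * (\<omega> (T - t))\<^sup>2 / 2) (at t within {0..T})"
      using d(2) by (simp add: \<delta>_def dH)
  qed
  moreover have "inner_curve T \<delta>"
  proof -
    have "\<delta> t \<notin> bdry" if t: "t \<in> {0<..<T}" for t
    proof
      assume "\<delta> t \<in> bdry"
      then have "\<gamma> (T - t) 2 = 0 \<or> \<gamma> (T - t) 2 = 1" by (auto simp: bdry_def \<delta>_def)
      moreover have "\<gamma> (T - t) \<in> cyl" using movesD(1)[OF m] t by auto
      ultimately have "\<gamma> (T - t) \<in> bdry" by (simp add: bdry_def)
      then show False using b(3)[of "T - t"] t by auto
    qed
    then show ?thesis using b by (simp add: inner_curve_def ends)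
  qed
  moreover have "\<rho> (T - t)^2 + H (\<delta> t 2) * (\<omega> (T - t))\<^sup>2 = 1" if "t \<in> {0..T}" for t
    unfolding Hd using that by (intro unit) auto
  \<comment> \<open>The new initial vertical velocity is the old final one, and this has the sign of
    the old initial one.\<close>
  moreover have "0 < (if e then - \<rho> (T - 0) else \<rho> (T - 0))" if "hgt e (\<delta> 0) = 0" for e
    using inward[of e] that f(3) by (auto simp: ends zero_less_mult_iff split: if_splits)
  ultimately have "H.lens_geodesic T \<delta> (\<lambda>t. \<omega> (T - t)) (\<lambda>t. \<rho> (T - t))"
    using T unfolding H.lens_geodesic_def by blast
  moreover have "\<omega> (T - 0) = \<omega> 0" "\<omega> (T - T) = \<omega> T" using f(1) by simp_all
  ultimately show ?thesis using ends by blast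
qed

lemma projected_lens_set_subset:
  "projected_lens_set cmfd (cmet G) \<subseteq> projected_lens_set cmfd (cmet H)"
proof
  fix X assume "X \<in> projected_lens_set cmfd (cmet G)"
  then obtain \<gamma> \<omega> \<rho> T where X: "X = ((\<gamma> 0, btv (\<gamma> 0) (\<omega> 0)), (\<gamma> T, btv (\<gamma> T) (\<omega> T)), T)"
    and "G.lens_geodesic T \<gamma> \<omega> \<rho>" unfolding G.projected_lens_set_cmet by blast
  then obtain \<delta> \<omega>' \<rho>' where d: "H.lens_geodesic T \<delta> \<omega>' \<rho>'" "\<delta> 0 = \<gamma> 0" "\<delta> T = \<gamma> T" "\<omega>' 0 = \<omega> 0" "\<omega>' T = \<omega> T"
    using lens_geodesic_flip by blast
  show "X \<in> projected_lens_set cmfd (cmet H)"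
    unfolding H.projected_lens_set_cmet X d(2-5)[symmetric] using d(1) by blast
qed

end

lemma (in profile_pair) same_lens_data_id: "same_lens_data cmfd (cmet G) cmfd (cmet H) id"
proof -
  interpret swapped: profile_pair H G by (rule profile_pair_swap)
  have eq: "projected_lens_set cmfd (cmet H) = projected_lens_set cmfd (cmet G)"
    using projected_lens_set_subset swapped.projected_lens_set_subset by blast
  have "(\<lambda>(X, Y, T). ((\<lambda>(p, v). (id p, push (boundary cmfd) (id p) id v)) X,
      (\<lambda>(p, v). (id p, push (boundary cmfd) (id p) id v)) Y, T)) Z = Z"
    if "Z \<in> projected_lens_set cmfd (cmet G)" for Z
    using that unfolding G.projected_lens_set_cmet by (auto simp: push_id_btv)
  then have "(\<lambda>(X, Y, T). ((\<lambda>(p, v). (id p, push (boundary cmfd) (id p) id v)) X,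
      (\<lambda>(p, v). (id p, push (boundary cmfd) (id p) id v)) Y, T)) ` projected_lens_set cmfd (cmet G)
      = (\<lambda>Z. Z) ` projected_lens_set cmfd (cmet G)"
    by (intro image_cong refl)
  moreover have "riem_dist cmfd (cmet H) p q = riem_dist cmfd (cmet G) p q" if "p \<in> bdry" "q \<in> bdry" for p q
    using riem_dist_le[OF that] swapped.riem_dist_le[OF that] by (rule antisym)
  ultimately show ?thesis
    unfolding same_lens_data_def Let_def boundary_pts_cmfd eq by simp
qed

section \<open>Boundary normal coordinates and jets\<close>

context profile
begin

text \<open>Below height 1/2 the lower end is strictly closer than the upper one, hence the width of
  the collar. The chart \<open>b\<close> is prescribed on its domain only, because transport by the
  inverse of the boundary isometry produces a chart map that is known only there.\<close>

lemma boundary_normal_chart_cmet: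
  assumes b: "fst b = fst (bch 0 False)" "\<And>q. q \<in> fst (bch 0 False) \<Longrightarrow> snd b q = snd (bch 0 False) q"
  shows "boundary_normal_chart cmfd (cmet G) b (cch 0 False (1/2))"
  unfolding boundary_normal_chart_def
proof (intro conjI ballI)
  show "smooth_chart cmfd (cch 0 False (1/2))" by (rule smooth_chart_cch) simp
  fix p assume "p \<in> fst (cch 0 False (1/2))"
  then have p: "p \<in> cyl" "0 < p 0" "p 2 < 1/2" "0 \<le> p 2"
    by (auto simp: cch_fst hgt_def cyl_def)
  define q where "q = p(2 := 0)"
  have q: "q \<in> fst (bch 0 False)" "q \<in> bdry"
    using p by (auto simp: bch_fst cch_fst q_def hgt_def bdry_def cyl_def)
  have d: "riem_dist cmfd (cmet G) p q = ennreal (p 2)"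
  proof (rule antisym)
    show "riem_dist cmfd (cmet G) p q \<le> ennreal (p 2)"
      using riem_dist_vertical[OF p(1), of 0] p(4) by (simp add: q_def)
    show "ennreal (p 2) \<le> riem_dist cmfd (cmet G) p q"
      using edist_le_riem_dist[of p q] p(4) by (simp add: edist_def q_def)
  qed
  \<comment> \<open>A boundary point within chord distance \<open>p 2\<close> of \<open>p\<close>
    cannot have height 1, which is more than 1/2 away. At height 0 the vertical difference already
    uses up the chord, so the horizontal position is that of \<open>p\<close>.\<close>
  have far: "p 2 \<le> edist p q'" and eq: "edist p q' \<le> p 2 \<Longrightarrow> q' = q" if q': "q' \<in> bdry" for q'
  proof -
    have h: "q' 2 = 0 \<or> q' 2 = 1" "\<forall>i\<ge>3. q' i = 0" using q' by (auto simp: bdry_def cyl_def)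
    have "\<bar>q' 2 - p 2\<bar> \<le> edist p q'"
      unfolding edist_def by (rule real_le_rsqrt) simp
    then show "p 2 \<le> edist p q'" using h p by auto
    assume le: "edist p q' \<le> p 2"
    with \<open>\<bar>q' 2 - p 2\<bar> \<le> edist p q'\<close> h p have q'2: "q' 2 = 0" by auto
    have "(q' 0 - p 0)\<^sup>2 + (q' 1 - p 1)\<^sup>2 + (q' 2 - p 2)\<^sup>2 \<le> (p 2)\<^sup>2"
      using le unfolding edist_def by (rule sqrt_le_D)
    then have "(q' 0 - p 0)\<^sup>2 + (q' 1 - p 1)\<^sup>2 \<le> 0" by (simp add: q'2)
    then have "q' 0 = p 0" "q' 1 = p 1" by (simp_all add: sum_power2_le_zero_iff)
    then show "q' = q" using h(2) q'2 p(1) by (intro fun_eq_3I) (auto simp: q_def cyl_def)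
  qed
  show "\<exists>q\<in>fst b. closest_boundary_pt cmfd (cmet G) p q \<and>
        (\<forall>q'. closest_boundary_pt cmfd (cmet G) p q' \<longrightarrow> q' = q) \<and>
        snd (cch 0 False (1/2)) p = (snd b q)(mdim cmfd - 1 := enn2real (riem_dist cmfd (cmet G) p q))"
  proof (intro bexI[of _ q] conjI allI impI)
    show "q \<in> fst b" using q(1) b(1) by simp
    show "closest_boundary_pt cmfd (cmet G) p q"
      unfolding closest_boundary_pt_def boundary_pts_cmfd d
      using q(2) order_trans[OF ennreal_leI[OF far] edist_le_riem_dist] by auto
    show "q' = q" if "closest_boundary_pt cmfd (cmet G) p q'" for q'
    proof (rule eq)
      show "q' \<in> bdry" using that by (simp add: closest_boundary_pt_def boundary_pts_cmfd)
      have "riem_dist cmfd (cmet G) p q' \<le> ennreal (p 2)"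
        using that q(2) unfolding closest_boundary_pt_def boundary_pts_cmfd d[symmetric] by blast
      then have "ennreal (edist p q') \<le> ennreal (p 2)" using edist_le_riem_dist order_trans by blast
      then show "edist p q' \<le> p 2" using p(4) by (simp add: ennreal_le_iff)
    qed
    show "snd (cch 0 False (1/2)) p = (snd b q)(mdim cmfd - 1 := enn2real (riem_dist cmfd (cmet G) p q))"
      unfolding d b(2)[OF q(1)] snd_bch using p(4)
      by (intro fun_eq_2I) (auto simp: q_def hgt_def)
  qed
qed

text \<open>All profiles have the same jet of order 0 at an end, and only the coefficient with both
  indices 0 varies with the height; the two metrics are thus told apart by this entry.\<close>

lemma boundary_jet_cmet:
  "boundary_jet cmfd (cmet G) (cch 0 False (1/2)) 1 0 0 (pt 0 0) = deriv G 0"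
proof -
  have "pt 0 0 \<in> fst (cch 0 False (1/2))" by (auto simp: cch_fst pt_in_cyl hgt_def)
  then have "snd (cch 0 False (1/2)) (pt 0 0) \<in> box2 (1/2)" by (rule cinv_coords(1))
  from partial_metric_coeff[OF this, of 0 0 1 0 False] show ?thesis
    by (simp add: boundary_jet_def chart_image_cch warp_deriv_def hgt_def)
qed

end

lemma C1_jets_differ_cmet:
  assumes "profile G" "profile H" "deriv G 0 \<noteq> deriv H 0"
  shows "C1_jets_differ cmfd (cmet G) cmfd (cmet H) id"
proof -
  interpret G: profile G by fact
  interpret H: profile H by fact
  let ?b = "bch 0 False" and ?d = "cch 0 False (1/2)" and ?q = "pt 0 0"
  have q: "?q \<in> fst ?b" "?q \<in> fst ?d"
    by (auto simp: bch_fst cch_fst pt_in_cyl hgt_def)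
  have inv: "inv_into bdry id p = p" if "p \<in> fst ?b" for p
    using that inv_into_f_f[of id bdry p] by (simp add: bch_def)
  have "boundary_normal_chart cmfd (cmet G) ?b ?d"
    by (rule G.boundary_normal_chart_cmet) auto
  moreover have "boundary_normal_chart cmfd (cmet H) (id ` fst ?b, snd ?b \<circ> inv_into (boundary_pts cmfd) id) ?d"
    unfolding boundary_pts_cmfd by (rule H.boundary_normal_chart_cmet) (auto simp: inv)
  moreover have "boundary_jet cmfd (cmet G) ?d 1 0 0 ?q \<noteq> boundary_jet cmfd (cmet H) ?d 1 0 0 (id ?q)"
    using assms(3) G.boundary_jet_cmet H.boundary_jet_cmet by simp
  ultimately show ?thesis
    unfolding C1_jets_differ_def
    using q smooth_chart_bch[of 0 False]
    by (intro exI[of _ ?b] exI[of _ ?d] exI[of _ ?q] bexI[of _ "1::nat"] exI[of _ "0::nat"] conjI) simp_all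
qed

text \<open>r - r^3 = r (1 - r) (1 + r) vanishes at both ends and is positive between them, with
  slopes 1 and -2 there. The degree is 3 because a quadratic polynomial with equal values at 0 and 1
  is its own mirror image. As a \<open>poly\<close>, the function has its derivatives of all orders
  given by \<open>pderiv\<close>.\<close>

definition bump :: "real \<Rightarrow> real" where
  "bump r = poly [:1, 1, 0, -1:] r"

lemma bump_eq: "bump r = 1 + r - r ^ 3"
  by (simp add: bump_def algebra_simps power3_eq_cube)

lemma bump_ge_1:
  assumes "0 \<le> r" "r \<le> 1"
  shows "1 \<le> bump r"
proof -
  have "r ^ 3 \<le> r ^ 1" using assms by (intro power_decreasing) auto
  then show ?thesis by (simp add: bump_eq)
qed

lemma profile_pair_bump: "profile_pair bump (\<lambda>r. bump (1 - r))"
proof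
  have "bump = poly [:1, 1, 0, -1:]" by (auto simp: bump_def)
  then have sm: "smooth_real UNIV bump" using smooth_real_poly by metis
  then show "smooth_real UNIV bump" .
  show "smooth_real UNIV (\<lambda>r. bump (1 - r))"
    using smooth_real_compose_affine[OF sm, of UNIV 1 "-1"] by simp
  show "1 \<le> bump r" "1 \<le> bump (1 - r)" if "0 \<le> r" "r \<le> 1" for r
    using that by (auto intro: bump_ge_1)
qed (simp_all add: bump_eq)

theorem theorem5p1:
  shows "\<exists>(M1 :: (nat \<Rightarrow> real) mfd) g1 (M2 :: (nat \<Rightarrow> real) mfd) g2 \<phi>.
    riemannian_manifold M1 g1 \<and> compact_space (mtop M1) \<and>
    riemannian_manifold M2 g2 \<and> compact_space (mtop M2) \<and>
    isometry (boundary M1) (boundary_metric M1 g1) (boundary M2) (boundary_metric M2 g2) \<phi> \<and>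
    same_lens_data M1 g1 M2 g2 \<phi> \<and>
    C1_jets_differ M1 g1 M2 g2 \<phi>"
proof -
  interpret profile_pair bump "\<lambda>r. bump (1 - r)" by (rule profile_pair_bump)
  have "(bump has_real_derivative 1) (at 0)" "((\<lambda>r. bump (1 - r)) has_real_derivative 2) (at 0)"
    unfolding bump_eq[abs_def] by (auto intro!: derivative_eq_intros)
  then have "deriv bump 0 \<noteq> deriv (\<lambda>r. bump (1 - r)) 0"
    by (simp add: DERIV_imp_deriv)
  then have "C1_jets_differ cmfd (cmet bump) cmfd (cmet (\<lambda>r. bump (1 - r))) id"
    by (rule C1_jets_differ_cmet[OF G.profile_axioms H.profile_axioms])
  then show ?thesis
    using G.riemannian_manifold_cmet H.riemannian_manifold_cmet compact_space_cmfd
      isometry_boundary[OF G.profile_axioms H.profile_axioms] same_lens_data_id by blast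
qed

end
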